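(* Let $\mathcal{D}$ be a datum of Cartan type $A_n$ with group $\Gamma$ and let $\mu\in\mathbf{k}^{\Phi^+}$ satisfy (R2) for $\mathcal{D}$. Then the map $$u(\mathcal{D}^{\sigma},\sigma^{\mathcal{D}}(\mu))\to u(\mathcal{D},\mu)$$ given by $x_i^{\sigma}\mapsto x_{\sigma(i)}$, $g\mapsto g$ for $1\le i\le n$, $g\in\Gamma$, is an isomorphism of Hopf algebras. Here $x_i^\sigma$ and $x_i$ denote the standard generators of $u(\mathcal{D}^{\sigma},\sigma^{\mathcal{D}}(\mu))$ and $u(\mathcal{D},\mu)$ respectively.
   Context: $\mathbf{k}$ is an algebraically closed field of characteristic $0$. Let $n\ge 2$ and let $(a_{ij})_{1\le i,j\le n}$ be the Cartan matrix of type $A_n$: $a_{ii}=2$, $a_{ij}=-1$ if $|i-j|=1$, $a_{ij}=0$ if $|i-j|>1$. A datum of Cartan type $A_n$, $\mathcal{D}$, consists of a finite abelian group $\Gamma$, elements $g_1,\dots,g_n\in\Gamma$ and characters $\chi_1,\dots,\chi_n:\Gamma\to\mathbf{k}^\times$ such that, with $q_{ij}=\chi_j(g_i)$, there is a root of unity $q\in\mathbf{k}$ of order $N>1$, with $N$ odd, such that $q_{ii}=q$ for all $i$, $q_{ij}q_{ji}=q^{-1}$ if $|i-j|=1$, and $q_{ij}q_{ji}=1$ if $|i-j|>1$. Let $\sigma(i)=n-i+1$ for $1\le i\le n$; $\mathcal{D}^\sigma$ is the datum with the same $\Gamma$ and with $g_i^\sigma=g_{\sigma(i)}$, $\chi_i^\sigma=\chi_{\sigma(i)}$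 (same $q$, $N$). For $1\le i<j\le n+1$ put $g_{ij}=\prod_{i\le l<j}g_l$, $\chi_{ij}=\prod_{i\le l<j}\chi_l$. $\mathbf{k}^{\Phi^+}$ is the set of families $\mu=(\mu_{ij})_{1\le i<j\le n+1}$ in $\mathbf{k}$. Condition (R2) for $\mathcal{D}$: $\mu_{ij}=0$ whenever $\chi_{ij}^N\ne1$. If $\mu$ satisfies (R2) for $\mathcal{D}$, then $\sigma^{\mathcal{D}}(\mu)$ (defined below) satisfies (R2) for $\mathcal{D}^\sigma$. Let $I_{ij}=\{(i_1,\dots,i_r)\mid r\ge2,\ i=i_1<i_2<\dots<i_r=j\}$, $\mu(i_1,\dots,i_r)=\mu_{i_1i_2}\cdots\mu_{i_{r-1}i_r}$, and $$u^{\mathcal{D}}_{ij}(\mu)=\sum_{(i_1,\dots,i_r)\in I_{ij}}(q-1)^{N(r-2)}\mu(i_1,\dots,i_r)\,(1-g_{i_{r-1}i_r}^N)\in\mathbf{k}[\Gamma].$$ Put $\widetilde{i}=n-i+2$ for $1\le i\le n+1$ and $\tau_{ij}=\prod_{i\le k<l<j}q_{lk}^N$ for $i<j$. Then $\sigma^{\mathcal{D}}(\mu)=(\sigma^{\mathcal{D}}_{ij}(\mu))_{1\le i<j\le n+1}$ with $$\sigma^{\mathcal{D}}_{ij}(\mu)=\tau_{\widetilde{j}\,\widetilde{i}}\,(-1)^{j-i+1}\sum_{(i_1,\dots,i_r)\in I_{ij}}(q-1)^{N(r-2)}\mu(\widetilde{i_r},\dots,\widetilde{i_1}).$$ For $\mu$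 satisfying (R2) for $\mathcal{D}$, $u(\mathcal{D},\mu)$ is the Hopf algebra generated as an algebra by the group $\Gamma$ (with the relations of $\Gamma$) and $x_1,\dots,x_n$, with relations: $gx_ig^{-1}=\chi_i(g)x_i$; $\mathrm{ad}_c(x_i)^{1-a_{ij}}(x_j)=0$ for $i\ne j$, where $\mathrm{ad}_c(x_i)(x_{j_1}\cdots x_{j_s})=x_ix_{j_1}\cdots x_{j_s}-q_{ij_1}\cdots q_{ij_s}x_{j_1}\cdots x_{j_s}x_i$; and $x_{ij}^N=u^{\mathcal{D}}_{ij}(\mu)$ for $1\le i<j\le n+1$, where $x_{i,i+1}=x_i$ and $x_{ij}=x_ix_{i+1,j}-\chi_{i+1,j}(g_i)\,x_{i+1,j}x_i$ for $j-i>1$. Comultiplication: $\Delta(x_i)=g_i\otimes x_i+x_i\otimes1$, $\Delta(g)=g\otimes g$. The Hopf algebra $u(\mathcal{D}^\sigma,\cdot)$ is defined in the same way from the data of $\mathcal{D}^\sigma$, with generators $x_i^\sigma$. *)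

theory Defs
  imports
    "HOL-Algebra.QuotRing"
    "HOL-Algebra.Module"
    "HOL-Library.Poly_Mapping"
    "HOL-Computational_Algebra.Polynomial"
begin

hide_const (open) Multiset.mult Polynomial.smult

section \<open>Algebras over a field\<close>

text \<open>
  The ground field is a type \<open>'k\<close>. A (not necessarily commutative) \<open>'k\<close>-algebra is a record of type
  \<open>('k, 'a) module\<close>, i.e. a ring record with a scalar multiplication. Formal linear combinations of
  elements of \<open>'x\<close> are the elements of \<open>'x \<Rightarrow>\<^sub>0 'k\<close>.
\<close>

definition scal :: "'k \<Rightarrow> ('x \<Rightarrow>\<^sub>0 'k) \<Rightarrow> ('x \<Rightarrow>\<^sub>0 'k::field)" where
  "scal c p = Poly_Mapping.map ((*) c) p"

lemma lookup_scal [simp]: "Poly_Mapping.lookup (scal c p) x = c * Poly_Mapping.lookup p x"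
  unfolding scal_def by transfer (auto simp: when_def)

global_interpretation lincomb: vector_space "scal :: 'k::field \<Rightarrow> ('x \<Rightarrow>\<^sub>0 'k) \<Rightarrow> ('x \<Rightarrow>\<^sub>0 'k)"
  by unfold_locales
    (auto intro!: poly_mapping_eqI simp: lookup_add algebra_simps)

definition alg_hom ::
  "('k, 'a, 'm) module_scheme \<Rightarrow> ('k, 'b, 'n) module_scheme \<Rightarrow> ('a \<Rightarrow> 'b) set" where
  "alg_hom A B = {f \<in> ring_hom A B.
     \<forall>c. \<forall>a\<in>carrier A. f (c \<odot>\<^bsub>A\<^esub> a) = c \<odot>\<^bsub>B\<^esub> f a}"

definition opposite_alg :: "('k, 'a) module \<Rightarrow> ('k, 'a) module" where
  "opposite_alg A = A\<lparr>mult := (\<lambda>a b. b \<otimes>\<^bsub>A\<^esub> a)\<rparr>"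

definition ground_alg :: "('k::field, 'k) module" where
  "ground_alg = \<lparr>carrier = UNIV, mult = (*), one = 1, zero = 0, add = (+), smult = (*)\<rparr>"

text \<open>As for \<^const>\<open>rcoset_mult\<close>, operations on cosets are unions over representatives.\<close>

definition quot_alg :: "('k, 'a) module \<Rightarrow> 'a set \<Rightarrow> ('k, 'a set) module" where
  "quot_alg A I = ring.extend (A Quot I)
     (module.fields (\<lambda>c X. \<Union>a\<in>X. I +>\<^bsub>A\<^esub> (c \<odot>\<^bsub>A\<^esub> a)))"


subsection \<open>Free algebras\<close>

text \<open>Words form the free monoid, so that the product of \<open>'x list \<Rightarrow>\<^sub>0 'k\<close> is that of the free algebra.\<close>

instantiation list :: (type) monoid_add
begin
definition zero_list :: "'a list" where "zero_list = []"
definition plus_list :: "'a list \<Rightarrow> 'a list \<Rightarrow> 'a list" where "plus_list = (@)"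
instance by standard (auto simp: zero_list_def plus_list_def)
end

definition free_alg :: "'x set \<Rightarrow> ('k::field, 'x list \<Rightarrow>\<^sub>0 'k) module" where
  "free_alg L = \<lparr>carrier = {p. \<forall>w\<in>Poly_Mapping.keys p. set w \<subseteq> L},
     mult = (*), one = 1, zero = 0, add = (+), smult = scal\<rparr>"

definition letter :: "'x \<Rightarrow> ('x list \<Rightarrow>\<^sub>0 'k::field)" where
  "letter x = Poly_Mapping.single [x] 1"

text \<open>The homomorphism from the free algebra to \<open>A\<close> with value \<open>f x\<close> on the letter \<open>x\<close>.\<close>

definition free_lift :: "('k::field, 'a) module \<Rightarrow> ('x \<Rightarrow> 'a) \<Rightarrow> ('x list \<Rightarrow>\<^sub>0 'k) \<Rightarrow> 'a" where
  "free_lift A f p = (\<Oplus>\<^bsub>A\<^esub>w\<in>Poly_Mapping.keys p.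
     Poly_Mapping.lookup p w \<odot>\<^bsub>A\<^esub> foldr (\<lambda>x a. f x \<otimes>\<^bsub>A\<^esub> a) w \<one>\<^bsub>A\<^esub>)"


subsection \<open>Tensor products\<close>

text \<open>
  \<open>A \<otimes> B\<close> is the space of formal linear combinations of pairs \<open>(a, b)\<close> modulo the bilinearity
  relations; its elements are cosets.
\<close>

definition bilinear_rels ::
  "('k, 'a, 'm) module_scheme \<Rightarrow> ('k, 'b, 'n) module_scheme \<Rightarrow> ('a \<times> 'b \<Rightarrow>\<^sub>0 'k::field) set" where
  "bilinear_rels A B =
     {Poly_Mapping.single (a \<oplus>\<^bsub>A\<^esub> a', b) 1 - Poly_Mapping.single (a, b) 1 - Poly_Mapping.single (a', b) 1
       | a a' b. a \<in> carrier A \<and> a' \<in> carrier A \<and> b \<in> carrier B} \<union>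
     {Poly_Mapping.single (a, b \<oplus>\<^bsub>B\<^esub> b') 1 - Poly_Mapping.single (a, b) 1 - Poly_Mapping.single (a, b') 1
       | a b b'. a \<in> carrier A \<and> b \<in> carrier B \<and> b' \<in> carrier B} \<union>
     {Poly_Mapping.single (c \<odot>\<^bsub>A\<^esub> a, b) 1 - Poly_Mapping.single (a, b) c
       | c a b. a \<in> carrier A \<and> b \<in> carrier B} \<union>
     {Poly_Mapping.single (a, c \<odot>\<^bsub>B\<^esub> b) 1 - Poly_Mapping.single (a, b) c
       | c a b. a \<in> carrier A \<and> b \<in> carrier B}"

definition tensor_class ::
  "('k, 'a, 'm) module_scheme \<Rightarrow> ('k, 'b, 'n) module_scheme
    \<Rightarrow> ('a \<times> 'b \<Rightarrow>\<^sub>0 'k::field) \<Rightarrow> ('a \<times> 'b \<Rightarrow>\<^sub>0 'k) set" where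
  "tensor_class A B t = {t + r | r. r \<in> lincomb.span (bilinear_rels A B)}"

definition pure_tensor ::
  "('k, 'a, 'm) module_scheme \<Rightarrow> ('k, 'b, 'n) module_scheme
    \<Rightarrow> 'a \<Rightarrow> 'b \<Rightarrow> ('a \<times> 'b \<Rightarrow>\<^sub>0 'k::field) set" where
  "pure_tensor A B a b = tensor_class A B (Poly_Mapping.single (a, b) 1)"

definition tensor_mult_rep ::
  "('k, 'a, 'm) module_scheme \<Rightarrow> ('k, 'b, 'n) module_scheme
    \<Rightarrow> ('a \<times> 'b \<Rightarrow>\<^sub>0 'k::field) \<Rightarrow> ('a \<times> 'b \<Rightarrow>\<^sub>0 'k) \<Rightarrow> ('a \<times> 'b \<Rightarrow>\<^sub>0 'k)" where
  "tensor_mult_rep A B s t =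
     (\<Sum>(a, b)\<in>Poly_Mapping.keys s. \<Sum>(c, d)\<in>Poly_Mapping.keys t.
        Poly_Mapping.single (a \<otimes>\<^bsub>A\<^esub> c, b \<otimes>\<^bsub>B\<^esub> d)
          (Poly_Mapping.lookup s (a, b) * Poly_Mapping.lookup t (c, d)))"

definition tensor_alg ::
  "('k, 'a, 'm) module_scheme \<Rightarrow> ('k, 'b, 'n) module_scheme
    \<Rightarrow> ('k::field, ('a \<times> 'b \<Rightarrow>\<^sub>0 'k) set) module" where
  "tensor_alg A B =
     \<lparr>carrier = tensor_class A B ` {t. Poly_Mapping.keys t \<subseteq> carrier A \<times> carrier B},
      mult = (\<lambda>S T. \<Union>s\<in>S. \<Union>t\<in>T. tensor_class A B (tensor_mult_rep A B s t)),
      one = pure_tensor A B \<one>\<^bsub>A\<^esub> \<one>\<^bsub>B\<^esub>,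
      zero = tensor_class A B 0,
      add = (\<lambda>S T. \<Union>s\<in>S. \<Union>t\<in>T. tensor_class A B (s + t)),
      smult = (\<lambda>c T. \<Union>t\<in>T. tensor_class A B (scal c t))\<rparr>"

text \<open>The map \<open>f \<otimes> g\<close> with target \<open>A' \<otimes> B'\<close>.\<close>

definition tensor_map ::
  "('k, 'c, 'm) module_scheme \<Rightarrow> ('k, 'd, 'n) module_scheme \<Rightarrow> ('a \<Rightarrow> 'c) \<Rightarrow> ('b \<Rightarrow> 'd)
    \<Rightarrow> ('a \<times> 'b \<Rightarrow>\<^sub>0 'k::field) set \<Rightarrow> ('c \<times> 'd \<Rightarrow>\<^sub>0 'k) set" where
  "tensor_map A' B' f g T = (\<Union>t\<in>T. tensor_class A' B'
     (\<Sum>(a, b)\<in>Poly_Mapping.keys t.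
        Poly_Mapping.single (f a, g b) (Poly_Mapping.lookup t (a, b))))"


subsection \<open>Hopf algebras\<close>

record (overloaded) ('k, 'a) hopf = "('k, 'a) module" +
  comult :: "'a \<Rightarrow> ('a \<times> 'a \<Rightarrow>\<^sub>0 'k) set"
  counit :: "'a \<Rightarrow> 'k"
  antipode :: "'a \<Rightarrow> 'a"

definition hopf_iso ::
  "('k::field, 'a, 'm) hopf_scheme \<Rightarrow> ('k, 'b, 'n) hopf_scheme \<Rightarrow> ('a \<Rightarrow> 'b) set" where
  "hopf_iso H K = {f \<in> alg_hom H K. bij_betw f (carrier H) (carrier K) \<and>
     (\<forall>a\<in>carrier H. comult K (f a) = tensor_map K K f f (comult H a)) \<and>
     (\<forall>a\<in>carrier H. counit K (f a) = counit H a) \<and>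
     (\<forall>a\<in>carrier H. antipode K (f a) = f (antipode H a))}"


section \<open>Data of Cartan type A\<close>

text \<open>
  Indices of \<open>g\<close>, \<open>\<chi>\<close> and of families \<open>\<mu>\<close> are natural numbers starting from 1; values outside
  the relevant ranges play no role. The fields \<open>dq\<close> and \<open>dN\<close> are the root of unity and its order; they
  are determined by the remaining fields.
\<close>

record ('g, 'k) datum =
  dgrp :: "'g monoid"
  dn :: nat
  dg :: "nat \<Rightarrow> 'g"
  dchi :: "nat \<Rightarrow> 'g \<Rightarrow> 'k"
  dq :: 'k
  dN :: nat

definition cartan_A :: "nat \<Rightarrow> nat \<Rightarrow> int" where
  "cartan_A i j = (if i = j then 2 else if i = Suc j \<or> j = Suc i then -1 else 0)"

definition character :: "('g, 'm) monoid_scheme \<Rightarrow> ('g \<Rightarrow> 'k::field) \<Rightarrow> bool" where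
  "character G \<chi> \<longleftrightarrow> (\<forall>a\<in>carrier G. \<chi> a \<noteq> 0) \<and>
     (\<forall>a\<in>carrier G. \<forall>b\<in>carrier G. \<chi> (a \<otimes>\<^bsub>G\<^esub> b) = \<chi> a * \<chi> b)"

definition qq :: "('g, 'k) datum \<Rightarrow> nat \<Rightarrow> nat \<Rightarrow> 'k" where
  "qq D i j = dchi D j (dg D i)"

definition cartan_datum :: "('g, 'k::field) datum \<Rightarrow> bool" where
  "cartan_datum D \<longleftrightarrow>
     2 \<le> dn D \<and> comm_group (dgrp D) \<and> finite (carrier (dgrp D)) \<and>
     (\<forall>i\<in>{1..dn D}. dg D i \<in> carrier (dgrp D) \<and> character (dgrp D) (dchi D i)) \<and>
     1 < dN D \<and> odd (dN D) \<and>
     dq D ^ dN D = 1 \<and> (\<forall>m. 0 < m \<and> m < dN D \<longrightarrow> dq D ^ m \<noteq> 1) \<and>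
     (\<forall>i\<in>{1..dn D}. qq D i i = dq D) \<and>
     (\<forall>i\<in>{1..dn D}. \<forall>j\<in>{1..dn D}. i = Suc j \<or> j = Suc i \<longrightarrow> qq D i j * qq D j i = inverse (dq D)) \<and>
     (\<forall>i\<in>{1..dn D}. \<forall>j\<in>{1..dn D}. Suc i < j \<or> Suc j < i \<longrightarrow> qq D i j * qq D j i = 1)"

definition sigma_idx :: "('g, 'k) datum \<Rightarrow> nat \<Rightarrow> nat" where
  "sigma_idx D i = dn D + 1 - i"

definition sigma_datum :: "('g, 'k) datum \<Rightarrow> ('g, 'k) datum" where
  "sigma_datum D = D\<lparr>dg := (\<lambda>i. dg D (sigma_idx D i)), dchi := (\<lambda>i. dchi D (sigma_idx D i))\<rparr>"

definition groot :: "('g, 'k) datum \<Rightarrow> nat \<Rightarrow> nat \<Rightarrow> 'g" where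
  "groot D i j = (\<Otimes>\<^bsub>dgrp D\<^esub>l\<in>{i..<j}. dg D l)"

definition chiroot :: "('g, 'k::field) datum \<Rightarrow> nat \<Rightarrow> nat \<Rightarrow> 'g \<Rightarrow> 'k" where
  "chiroot D i j h = (\<Prod>l\<in>{i..<j}. dchi D l h)"

definition R2 :: "('g, 'k::field) datum \<Rightarrow> (nat \<Rightarrow> nat \<Rightarrow> 'k) \<Rightarrow> bool" where
  "R2 D \<mu> \<longleftrightarrow> (\<forall>i j. 1 \<le> i \<and> i < j \<and> j \<le> dn D + 1 \<longrightarrow>
     (\<exists>h\<in>carrier (dgrp D). chiroot D i j h ^ dN D \<noteq> 1) \<longrightarrow> \<mu> i j = 0)"

definition chains :: "nat \<Rightarrow> nat \<Rightarrow> nat list set" where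
  "chains i j = {is. 2 \<le> length is \<and> hd is = i \<and> last is = j \<and> sorted_wrt (<) is}"

definition mu_chain :: "(nat \<Rightarrow> nat \<Rightarrow> 'k::field) \<Rightarrow> nat list \<Rightarrow> 'k" where
  "mu_chain \<mu> is = (\<Prod>s<length is - 1. \<mu> (is ! s) (is ! Suc s))"

definition tilde :: "('g, 'k) datum \<Rightarrow> nat \<Rightarrow> nat" where
  "tilde D i = dn D + 2 - i"

definition tau :: "('g, 'k::field) datum \<Rightarrow> nat \<Rightarrow> nat \<Rightarrow> 'k" where
  "tau D i j = (\<Prod>(k, l)\<in>{(k, l). i \<le> k \<and> k < l \<and> l < j}. qq D l k ^ dN D)"

definition sigma_par :: "('g, 'k::field) datum \<Rightarrow> (nat \<Rightarrow> nat \<Rightarrow> 'k) \<Rightarrow> nat \<Rightarrow> nat \<Rightarrow> 'k" where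
  "sigma_par D \<mu> i j = tau D (tilde D j) (tilde D i) * (-1) ^ (j - i + 1) *
     (\<Sum>is\<in>chains i j. (dq D - 1) ^ (dN D * (length is - 2)) *
        mu_chain \<mu> (rev (map (tilde D) is)))"


section \<open>The Hopf algebra of a datum and a parameter family\<close>

datatype 'g gen = Grp 'g | X nat

definition gens :: "('g, 'k) datum \<Rightarrow> 'g gen set" where
  "gens D = Grp ` carrier (dgrp D) \<union> X ` {1..dn D}"

text \<open>
  The braided adjoint action, extended linearly from words. It is only ever applied to combinations
  of words in the letters \<open>X j\<close>; the factor 1 for letters \<open>Grp h\<close> is a dummy value.
\<close>

definition braid_factor :: "('g, 'k::field) datum \<Rightarrow> nat \<Rightarrow> 'g gen list \<Rightarrow> 'k" where
  "braid_factor D i w = prod_list (map (\<lambda>l. case l of X j \<Rightarrow> qq D i j | Grp h \<Rightarrow> 1) w)"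

definition ad_c :: "('g, 'k::field) datum \<Rightarrow> nat \<Rightarrow> ('g gen list \<Rightarrow>\<^sub>0 'k) \<Rightarrow> ('g gen list \<Rightarrow>\<^sub>0 'k)" where
  "ad_c D i p = (\<Sum>w\<in>Poly_Mapping.keys p. scal (Poly_Mapping.lookup p w)
     (letter (X i) * Poly_Mapping.single w 1
        - scal (braid_factor D i w) (Poly_Mapping.single w 1 * letter (X i))))"

function xroot :: "('g, 'k::field) datum \<Rightarrow> nat \<Rightarrow> nat \<Rightarrow> ('g gen list \<Rightarrow>\<^sub>0 'k)" where
  "xroot D i j = (if Suc i < j
     then letter (X i) * xroot D (Suc i) j
       - scal (chiroot D (Suc i) j (dg D i)) (xroot D (Suc i) j * letter (X i))
     else letter (X i))"
  by pat_completeness auto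
termination by (relation "Wellfounded.measure (\<lambda>(D, i, j). j - i)") auto

declare xroot.simps [simp del]

text \<open>
  The elements \<open>u\<^sub>i\<^sub>j(\<mu>)\<close> of the group algebra, written in the free algebra with each
  group element as a letter.
\<close>

definition uroot :: "('g, 'k::field) datum \<Rightarrow> (nat \<Rightarrow> nat \<Rightarrow> 'k) \<Rightarrow> nat \<Rightarrow> nat \<Rightarrow> ('g gen list \<Rightarrow>\<^sub>0 'k)" where
  "uroot D \<mu> i j = (\<Sum>is\<in>chains i j.
     scal ((dq D - 1) ^ (dN D * (length is - 2)) * mu_chain \<mu> is)
       (1 - letter (Grp (groot D (is ! (length is - 2)) (is ! (length is - 1)) [^]\<^bsub>dgrp D\<^esub> dN D))))"

definition u_rels :: "('g, 'k::field) datum \<Rightarrow> (nat \<Rightarrow> nat \<Rightarrow> 'k) \<Rightarrow> ('g gen list \<Rightarrow>\<^sub>0 'k) set" where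
  "u_rels D \<mu> =
     {letter (Grp \<one>\<^bsub>dgrp D\<^esub>) - 1} \<union>
     {letter (Grp a) * letter (Grp b) - letter (Grp (a \<otimes>\<^bsub>dgrp D\<^esub> b))
       | a b. a \<in> carrier (dgrp D) \<and> b \<in> carrier (dgrp D)} \<union>
     {letter (Grp a) * letter (X i) * letter (Grp (inv\<^bsub>dgrp D\<^esub> a)) - scal (dchi D i a) (letter (X i))
       | a i. a \<in> carrier (dgrp D) \<and> i \<in> {1..dn D}} \<union>
     {(ad_c D i ^^ nat (1 - cartan_A i j)) (letter (X j))
       | i j. i \<in> {1..dn D} \<and> j \<in> {1..dn D} \<and> i \<noteq> j} \<union>
     {xroot D i j ^ dN D - uroot D \<mu> i j
       | i j. 1 \<le> i \<and> i < j \<and> j \<le> dn D + 1}"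

definition u_ideal :: "('g, 'k::field) datum \<Rightarrow> (nat \<Rightarrow> nat \<Rightarrow> 'k) \<Rightarrow> ('g gen list \<Rightarrow>\<^sub>0 'k) set" where
  "u_ideal D \<mu> = Idl\<^bsub>free_alg (gens D)\<^esub> (u_rels D \<mu>)"

definition u_alg ::
  "('g, 'k::field) datum \<Rightarrow> (nat \<Rightarrow> nat \<Rightarrow> 'k) \<Rightarrow> ('k, ('g gen list \<Rightarrow>\<^sub>0 'k) set) module" where
  "u_alg D \<mu> = quot_alg (free_alg (gens D)) (u_ideal D \<mu>)"

definition u_class ::
  "('g, 'k::field) datum \<Rightarrow> (nat \<Rightarrow> nat \<Rightarrow> 'k) \<Rightarrow> ('g gen list \<Rightarrow>\<^sub>0 'k) \<Rightarrow> ('g gen list \<Rightarrow>\<^sub>0 'k) set" where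
  "u_class D \<mu> p = u_ideal D \<mu> +>\<^bsub>free_alg (gens D)\<^esub> p"

definition u_x :: "('g, 'k::field) datum \<Rightarrow> (nat \<Rightarrow> nat \<Rightarrow> 'k) \<Rightarrow> nat \<Rightarrow> ('g gen list \<Rightarrow>\<^sub>0 'k) set" where
  "u_x D \<mu> i = u_class D \<mu> (letter (X i))"

definition u_g :: "('g, 'k::field) datum \<Rightarrow> (nat \<Rightarrow> nat \<Rightarrow> 'k) \<Rightarrow> 'g \<Rightarrow> ('g gen list \<Rightarrow>\<^sub>0 'k) set" where
  "u_g D \<mu> a = u_class D \<mu> (letter (Grp a))"

text \<open>
  The comultiplication is the algebra map with \<open>\<Delta>(x\<^sub>i) = g\<^sub>i \<otimes> x\<^sub>i + x\<^sub>i \<otimes> 1\<close> and \<open>\<Delta>(g) = g \<otimes> g\<close>.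
  It determines the counit (\<open>g \<mapsto> 1\<close>, \<open>x\<^sub>i \<mapsto> 0\<close>) and the antipode, the anti-multiplicative map with
  \<open>g \<mapsto> g\<^sup>-\<^sup>1\<close>, \<open>x\<^sub>i \<mapsto> -g\<^sub>i\<^sup>-\<^sup>1x\<^sub>i\<close>. All three are induced from the free algebra, evaluating on
  representatives: the unions are those of equal cosets, since the ideal of relations is a Hopf ideal.
\<close>

definition u_comult_gen ::
  "('g, 'k::field) datum \<Rightarrow> (nat \<Rightarrow> nat \<Rightarrow> 'k) \<Rightarrow> 'g gen
    \<Rightarrow> (('g gen list \<Rightarrow>\<^sub>0 'k) set \<times> ('g gen list \<Rightarrow>\<^sub>0 'k) set \<Rightarrow>\<^sub>0 'k) set" where
  "u_comult_gen D \<mu> l = (let U = u_alg D \<mu> in case l of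
      Grp a \<Rightarrow> pure_tensor U U (u_g D \<mu> a) (u_g D \<mu> a)
    | X i \<Rightarrow> pure_tensor U U (u_g D \<mu> (dg D i)) (u_x D \<mu> i)
               \<oplus>\<^bsub>tensor_alg U U\<^esub> pure_tensor U U (u_x D \<mu> i) \<one>\<^bsub>U\<^esub>)"

definition u_counit_gen :: "'g gen \<Rightarrow> 'k::field" where
  "u_counit_gen l = (case l of Grp a \<Rightarrow> 1 | X i \<Rightarrow> 0)"

definition u_antipode_gen ::
  "('g, 'k::field) datum \<Rightarrow> (nat \<Rightarrow> nat \<Rightarrow> 'k) \<Rightarrow> 'g gen \<Rightarrow> ('g gen list \<Rightarrow>\<^sub>0 'k) set" where
  "u_antipode_gen D \<mu> l = (let U = u_alg D \<mu> in case l of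
      Grp a \<Rightarrow> u_g D \<mu> (inv\<^bsub>dgrp D\<^esub> a)
    | X i \<Rightarrow> \<ominus>\<^bsub>U\<^esub> (u_g D \<mu> (inv\<^bsub>dgrp D\<^esub> (dg D i)) \<otimes>\<^bsub>U\<^esub> u_x D \<mu> i))"

definition u_hopf ::
  "('g, 'k::field) datum \<Rightarrow> (nat \<Rightarrow> nat \<Rightarrow> 'k) \<Rightarrow> ('k, ('g gen list \<Rightarrow>\<^sub>0 'k) set) hopf" where
  "u_hopf D \<mu> = (let U = u_alg D \<mu> in module.extend U (hopf.fields
     (\<lambda>A. \<Union>p\<in>A. free_lift (tensor_alg U U) (u_comult_gen D \<mu>) p)
     (\<lambda>A. the_elem (free_lift ground_alg u_counit_gen ` A))
     (\<lambda>A. \<Union>p\<in>A. free_lift (opposite_alg U) (u_antipode_gen D \<mu>) p)))"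

text \<open>\<open>f\<close> sends the generators \<open>x\<^sub>i\<^sup>\<sigma>\<close> and \<open>g\<close> of the Hopf algebra of \<open>D\<^sup>\<sigma>\<close> to \<open>x\<^bsub>\<sigma>(i)\<^esub>\<close> and \<open>g\<close>.\<close>

definition sigma_on_gens ::
  "('g, 'k::field) datum \<Rightarrow> (nat \<Rightarrow> nat \<Rightarrow> 'k)
    \<Rightarrow> (('g gen list \<Rightarrow>\<^sub>0 'k) set \<Rightarrow> ('g gen list \<Rightarrow>\<^sub>0 'k) set) \<Rightarrow> bool" where
  "sigma_on_gens D \<mu> f \<longleftrightarrow>
     (\<forall>i\<in>{1..dn D}. f (u_x (sigma_datum D) (sigma_par D \<mu>) i) = u_x D \<mu> (sigma_idx D i)) \<and>
     (\<forall>a\<in>carrier (dgrp D). f (u_g (sigma_datum D) (sigma_par D \<mu>) a) = u_g D \<mu> a)"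

end

theory Submission
  imports Defs
begin

text \<open>
  The map is induced by the involution of the free algebra that reverses the numbering of the letters
  \<open>X i\<close>; once this involution matches the two ideals of relations, compatibility with all the structure
  is transport along a bijection. The reflected root vectors are the elements \<open>z\<^sub>i\<^sub>j\<close> with
  \<open>z\<^sub>i\<^sub>,\<^sub>j\<^sub>+\<^sub>1 = [x\<^sub>j, z\<^sub>i\<^sub>j]\<close>, and one has to compute \<open>z\<^sub>i\<^sub>j\<^sup>N\<close> in \<open>u(D, \<mu>)\<close>.

  Each pair \<open>(z\<^sub>i\<^sub>l, x\<^sub>l\<^sub>j)\<close> satisfies the quantum Serre relations of type \<open>A\<^sub>2\<close>. In rank two,
  \<open>[v, u]\<^sup>N = p'\<^sup>N ((q - 1)\<^sup>N u\<^sup>N v\<^sup>N - [u, v]\<^sup>N)\<close>, provided \<open>p\<^sup>N = 1\<close> or \<open>v\<^sup>N = 0\<close>, which (R2) ensures. Since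
  \<open>[x\<^sub>l\<^sub>j, z\<^sub>i\<^sub>l]\<close> is a multiple of \<open>[z\<^sub>i\<^sub>,\<^sub>l\<^sub>+\<^sub>1, x\<^sub>l\<^sub>+\<^sub>1\<^sub>,\<^sub>j]\<close>, one telescopes from \<open>x\<^sub>i\<^sub>j\<close> to \<open>z\<^sub>i\<^sub>j\<close> and obtains a recursion
  that says that, up to signs and the factors \<open>\<tau>\<^sub>i\<^sub>j\<close>, the triangular matrices \<open>1 + (q - 1)\<^sup>N (x\<^sub>i\<^sub>j\<^sup>N)\<close> and
  \<open>1 - (q - 1)\<^sup>N (z\<^sub>i\<^sub>j\<^sup>N)\<close> are inverse to each other. For \<open>x\<^sub>i\<^sub>j\<^sup>N = u\<^sub>i\<^sub>j(\<mu>)\<close> the former is \<open>M G\<^sup>-\<^sup>1 M\<^sup>-\<^sup>1 G\<close> with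
  \<open>M = (1 - (q - 1)\<^sup>N \<mu>)\<^sup>-\<^sup>1\<close> and a diagonal matrix \<open>G\<close> over the group, and inverting it gives
  \<open>u\<^sub>i\<^sub>j(\<sigma>(\<mu>))\<close>. The same matrix description shows that \<open>\<sigma>\<close> is an involution, which yields the inclusion
  of ideals in both directions.
\<close>

section \<open>Skew brackets\<close>

text \<open>The recursion mentioned above reads \<open>Z = X - c Z X\<close> for the matrices of
  \<open>N\<close>-th powers, with \<open>c = (q - 1) ^ N\<close> and the scalars of
  \<open>Z\<close> divided out; this is \<open>(1 - c Z) (1 + c X) = 1\<close>. The entries lie in a
  noncommutative ring, so the order of the factors matters.

  Serre relations are passed from letters to root vectors by a rank-three computation that divides
  by \<open>1 + q\<close>; this is nonzero since \<open>q\<close> has odd order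
  \<open>N > 1\<close>. Oddness of \<open>N\<close> is used again for
  \<open>(- w) ^ N = - (w ^ N)\<close> and for the divisibility of \<open>N (N - 1) / 2\<close> by
  \<open>N\<close>.

  (R2) enters twice: where a power of a root vector is nonzero it makes the relevant braiding
  scalars have \<open>N\<close>-th power 1, and it makes \<open>tau\<close> multiplicative on the
  nonzero products of matrix entries.

  The computations are done in a type of class \<open>ring_1\<close>, whereas the Hopf algebra is a
  record of cosets. The operators that replace the cosets send 1 only to an idempotent, which is why
  \<open>e\<close> stands in place of 1 in the matrix identities.\<close>

locale k_algebra =
  fixes sc :: "'k::field \<Rightarrow> 'a::ring_1 \<Rightarrow> 'a" (infixr "*s" 75)
  assumes sc_add_right: "c *s (x + y) = c *s x + c *s y"
    and sc_add_left: "(c + d) *s x = c *s x + d *s x"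
    and sc_sc [simp]: "c *s d *s x = (c * d) *s x"
    and sc_one [simp]: "1 *s x = x"
    and sc_mult_left [simp]: "c *s x * y = c *s (x * y)"
    and sc_mult_right [simp]: "x * (c *s y) = c *s (x * y)"
begin

sublocale vector_space sc
  by unfold_locales (auto simp: sc_add_right sc_add_left)

lemmas sc_simps =
  scale_right_distrib scale_left_distrib scale_right_diff_distrib scale_left_diff_distrib

lemmas k_ac = mult.assoc[where 'a = 'k] mult.commute[where 'a = 'k] mult.left_commute[where 'a = 'k]

lemma sc_power: "(c *s x) ^ n = c ^ n *s x ^ n"
  by (induct n) (auto simp: mult_ac)

definition qbr :: "'k \<Rightarrow> 'a \<Rightarrow> 'a \<Rightarrow> 'a" where
  "qbr p u v = u * v - p *s (v * u)"

lemma qbr_commute_left: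
  assumes "y * u = s *s (u * y)" "y * v = t *s (v * y)"
  shows "y * qbr p u v = (s * t) *s (qbr p u v * y)"
proof -
  have 1: "y * (u * v) = (s * t) *s (u * v * y)"
    using assms by (metis mult.assoc sc_mult_left sc_mult_right sc_sc)
  have 2: "y * (v * u) = (s * t) *s (v * u * y)"
    using assms by (metis mult.assoc mult.commute sc_mult_left sc_mult_right sc_sc)
  show ?thesis
    unfolding qbr_def right_diff_distrib left_diff_distrib sc_mult_right 1 2
    by (simp add: sc_simps mult_ac)
qed

text \<open>A skew Jacobi identity: as \<open>y\<close> and \<open>b\<close> commute up to
  \<open>c\<close>, the order in which \<open>a\<close> is bracketed with them matters only up to
  that scalar. It rearranges brackets of root vectors around a shared letter
  \<open>a\<close>.\<close>

lemma qbr_assoc: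
  assumes "y * b = c *s (b * y)" "c \<noteq> 0"
  shows "qbr (c * p') (qbr p a y) b = c *s qbr (p / c) (qbr p' a b) y"
proof -
  have "a * y * b = c *s (a * b * y)"
    by (simp add: mult.assoc assms)
  moreover have "b * y = (1 / c) *s (y * b)"
    using assms by simp
  then have "b * y * a = (1 / c) *s (y * b * a)"
    by (metis sc_mult_left)
  ultimately show ?thesis using assms(2)
    unfolding qbr_def left_diff_distrib right_diff_distrib sc_mult_left sc_mult_right
    by (simp add: sc_simps mult.assoc[symmetric, where 'a = 'a] k_ac)
qed

text \<open>
  Here \<open>p\<close> and \<open>p'\<close> are the braiding scalars of \<open>u\<close> with \<open>v\<close> and of \<open>v\<close> with \<open>u\<close>. Given \<open>q p p' = 1\<close>, the last
  condition is the cubic Serre relation that is quadratic in \<open>v\<close>, usually stated through \<open>qbr p' v u\<close>.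
\<close>

definition serre :: "'k \<Rightarrow> 'k \<Rightarrow> 'k \<Rightarrow> 'a \<Rightarrow> 'a \<Rightarrow> bool" where
  "serre q p p' u v \<longleftrightarrow> q * p * p' = 1 \<and>
     u * qbr p u v = (q * p) *s (qbr p u v * u) \<and> qbr p u v * v = (q * p) *s (v * qbr p u v)"

lemma serreI_cubic:
  assumes "q * p * p' = 1" and "u * qbr p u v = (q * p) *s (qbr p u v * u)"
    and "v * qbr p' v u = (q * p') *s (qbr p' v u * v)"
  shows "serre q p p' u v"
proof -
  have nz: "q \<noteq> 0" "p \<noteq> 0" "p' \<noteq> 0"
    using assms(1) by auto
  have p': "p' = 1 / (q * p)"
    using assms(1) nz by (simp add: field_simps)
  \<comment> \<open>Both sides are combinations of \<open>u v v\<close>, \<open>v u v\<close> and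
    \<open>v v u\<close>; with \<open>p' = 1 / (q p)\<close> their coefficients are
    proportional.\<close>
  have "qbr p u v * v - (q * p) *s (v * qbr p u v)
      = (q * p\<^sup>2) *s (v * qbr p' v u - (q * p') *s (qbr p' v u * v))"
    unfolding qbr_def p' using nz
    by (simp add: right_diff_distrib left_diff_distrib sc_simps power2_eq_square mult.assoc k_ac)
  then show ?thesis
    using assms by (simp add: serre_def)
qed

lemma serre_sym:
  assumes "serre q p p' u v"
  shows "serre q p' p v u"
proof -
  have *: "q * p * p' = 1" using assms by (simp add: serre_def)
  then have nz: "q \<noteq> 0" "p \<noteq> 0" "p' \<noteq> 0"
    by auto
  have p': "p' = 1 / (q * p)"
    using * nz by (simp add: field_simps)
  have 1: "v * qbr p' v u - (q * p') *s (qbr p' v u * v)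
      = (q * p'\<^sup>2) *s (qbr p u v * v - (q * p) *s (v * qbr p u v))"
    unfolding qbr_def p' using nz
    by (simp add: right_diff_distrib left_diff_distrib sc_simps power2_eq_square mult.assoc k_ac)
  show ?thesis
    by (rule serreI_cubic) (use assms * 1 in \<open>auto simp: serre_def mult_ac\<close>)
qed

text \<open>Picture \<open>y\<close>, \<open>a\<close>, \<open>b\<close> as consecutive vertices of
  a Dynkin diagram: the outer two skew-commute, and each satisfies the Serre relations with
  \<open>a\<close>. Then \<open>qbr p1 a y\<close> acts as one vertex next to \<open>b\<close>. The
  key is that \<open>u = qbr p1 a y\<close> and \<open>v = qbr p2 a b\<close> skew-commute, which
  comes from computing \<open>a * W\<close> through two expressions for \<open>W\<close>.\<close>

lemma serre_bracket:
  assumes "serre q p1 p1' a y" "serre q p2 p2' a b" "y * b = c *s (b * y)"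
    and "c \<noteq> 0" "1 + q \<noteq> 0"
  shows "serre q (c * p2) (p2' / c) (qbr p1 a y) b"
proof -
  define u where "u = qbr p1 a y"
  define v where "v = qbr p2 a b"
  have nz: "q \<noteq> 0" "p1 \<noteq> 0" "p2 \<noteq> 0" and 0: "q * p2 * p2' = 1"
    using assms by (auto simp: serre_def)
  have au: "a * u = (q * p1) *s (u * a)" and uy: "u * y = (q * p1) *s (y * u)"
    and av: "a * v = (q * p2) *s (v * a)" and vb: "v * b = (q * p2) *s (b * v)"
    using assms by (auto simp: serre_def u_def v_def)
  define W where "W = qbr (c * p2) u b"
  have W: "W = c *s (v * y) - p1 *s (y * v)"
    unfolding W_def u_def v_def qbr_assoc[OF assms(3,4)] using assms(4)
    by (simp add: qbr_def[of "p1 / c"] sc_simps)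
  have W': "W = u * b - (c * p2) *s (b * u)"
    by (simp add: W_def qbr_def)
  have ab: "a * b = v + p2 *s (b * a)" and ay: "a * y = u + p1 *s (y * a)"
    by (simp_all add: u_def v_def qbr_def)
  have "a * (u * b) = (q * p1) *s (u * v) + (q * p1 * p2) *s (u * b * a)"
    using au ab by (metis (no_types, lifting) distrib_left mult.assoc sc_add_right sc_mult_left sc_mult_right sc_sc)
  moreover have "a * (b * u) = v * u + (q * p1 * p2) *s (b * u * a)"
  proof -
    have "a * (b * u) = v * u + p2 *s (b * (a * u))"
      by (simp add: mult.assoc[symmetric] ab distrib_right)
    then show ?thesis by (simp add: au mult_ac)
  qed
  ultimately have 1: "a * W = (q * p1 * p2) *s (W * a) + (q * p1) *s (u * v) - (c * p2) *s (v * u)"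
    unfolding W' by (simp add: algebra_simps sc_simps)
  have "a * (v * y) = (q * p2) *s (v * u) + (q * p2 * p1) *s (v * y * a)"
    using av ay by (metis (no_types, lifting) distrib_left mult.assoc sc_add_right sc_mult_left sc_mult_right sc_sc)
  moreover have "a * (y * v) = u * v + (q * p1 * p2) *s (y * v * a)"
  proof -
    have "a * (y * v) = u * v + p1 *s (y * (a * v))"
      by (simp add: mult.assoc[symmetric] ay distrib_right)
    then show ?thesis by (simp add: av mult_ac)
  qed
  ultimately have 2: "a * W = (q * p1 * p2) *s (W * a) + (c * q * p2) *s (v * u) - p1 *s (u * v)"
    unfolding W by (simp add: algebra_simps sc_simps)
  \<comment> \<open>The terms in \<open>W * a\<close> cancel between the two values of
    \<open>a * W\<close>, and what remains has the common factor \<open>1 + q\<close>.\<close>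
  have "(q * p1) *s (u * v) + p1 *s (u * v) = (c * q * p2) *s (v * u) + (c * p2) *s (v * u)"
    using 1 2 by (simp add: algebra_simps)
  then have "((1 + q) * p1) *s (u * v) = ((1 + q) * (c * p2)) *s (v * u)"
    by (simp add: algebra_simps sc_simps)
  then have "(1 / ((1 + q) * p1)) *s ((1 + q) * p1) *s (u * v)
    = (1 / ((1 + q) * p1)) *s ((1 + q) * (c * p2)) *s (v * u)" by (rule arg_cong)
  then have uv: "u * v = (c * p2 / p1) *s (v * u)"
    using nz assms(5) by simp
  have "u * (v * y) = (q * c * p2) *s (v * y * u)"
  proof -
    have "u * (v * y) = (c * p2 / p1) *s (v * (u * y))"
      by (simp add: mult.assoc[symmetric] uv)
    then show ?thesis using nz by (simp add: uy mult_ac)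
  qed
  moreover have "u * (y * v) = (q * c * p2) *s (y * v * u)"
  proof -
    have "u * (y * v) = (q * p1) *s (y * (u * v))"
      by (simp add: mult.assoc[symmetric] uy)
    then show ?thesis using nz by (simp add: uv mult_ac)
  qed
  ultimately have uW: "u * W = (q * (c * p2)) *s (W * u)"
    unfolding W by (simp add: algebra_simps sc_simps)
  have "v * y * b = (q * c * p2) *s (b * (v * y))"
  proof -
    have "v * y * b = c *s (v * b * y)"
      by (simp add: mult.assoc assms(3))
    then show ?thesis by (simp add: vb mult_ac)
  qed
  moreover have "y * v * b = (q * c * p2) *s (b * (y * v))"
  proof -
    have "y * v * b = (q * p2) *s (y * b * v)"
      by (simp add: mult.assoc vb)
    then show ?thesis by (simp add: assms(3) mult_ac)
  qed
  ultimately have Wb: "W * b = (q * (c * p2)) *s (b * W)"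
    unfolding W by (simp add: algebra_simps sc_simps)
  show ?thesis
    unfolding serre_def using uW Wb 0 assms(4) by (simp add: W_def u_def mult.assoc)
qed

end

section \<open>Powers of brackets in rank two at a root of unity\<close>

lemma prod_root_of_unity_factors:
  fixes q :: "'k::field"
  assumes "q ^ N = 1" "\<And>m. 0 < m \<Longrightarrow> m < N \<Longrightarrow> q ^ m \<noteq> 1" "0 < N"
  shows "(\<Prod>k<N. [:- (q ^ Suc k), 1:]) = monom 1 N - 1"
proof -
  have q0: "q \<noteq> 0"
    using assms(1,3) by (auto simp: power_0_left)
  have inj: "inj_on (\<lambda>k. q ^ Suc k) {..<N}"
  proof (rule linorder_inj_onI)
    fix k l assume "k < l" "k \<in> {..<N}" "l \<in> {..<N}"
    then have "q ^ (l - k) \<noteq> 1" and "q ^ Suc l = q ^ Suc k * q ^ (l - k)"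
      using assms(2)[of "l - k"] by (auto simp: power_add[symmetric])
    then show "q ^ Suc k \<noteq> q ^ Suc l"
      using q0 by auto
  qed auto
  define P where "P = (\<Prod>k<N. [:- (q ^ Suc k), 1:])"
  have degP: "degree P = N" "lead_coeff P = 1"
    unfolding P_def by (subst degree_prod_eq_sum_degree, auto simp: lead_coeff_prod)
  \<comment> \<open>Two monic polynomials of degree \<open>N\<close> differ in degree below
    \<open>N\<close>, so vanishing at the \<open>N\<close> distinct powers of \<open>q\<close>
    forces \<open>R = 0\<close>.\<close>
  define R where "R = P - (monom 1 N - 1)"
  have "coeff R i = 0" if "N \<le> i" for i
    using that degP assms(3) by (cases "i = N") (auto simp: R_def coeff_eq_0)
  then have deg: "degree R < N"
    using assms(3) by (metis degree_0 leading_coeff_0_iff not_le)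
  have root: "poly R x = 0" if "x \<in> (\<lambda>k. q ^ Suc k) ` {..<N}" for x
  proof -
    obtain k where k: "k < N" "x = q ^ Suc k" using \<open>x \<in> _\<close> by auto
    have "x ^ N = 1"
      using assms(1) by (metis k(2) power_mult mult.commute power_one)
    moreover have "poly P x = 0"
      using k by (auto simp: P_def poly_prod intro!: prod_zero)
    ultimately show ?thesis
      by (simp add: R_def poly_monom)
  qed
  have "R = 0"
    by (rule poly_eqI_degree[where A = "(\<lambda>k. q ^ Suc k) ` {..<N}"])
      (use root deg card_image[OF inj] assms(3) in auto)
  then show ?thesis
    by (simp add: R_def P_def)
qed

context k_algebra
begin

text \<open>The degree \<open>n\<close> homogenisation of \<open>p\<close>, evaluated at a pair that
  will commute: a factor \<open>[:- c, 1:]\<close> of \<open>p\<close> then becomes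
  \<open>a - c *s b\<close>. This carries factorisations of polynomials over to the ring.\<close>

definition hom_eval :: "nat \<Rightarrow> 'a \<Rightarrow> 'a \<Rightarrow> 'k poly \<Rightarrow> 'a" where
  "hom_eval n a b p = (\<Sum>i\<le>n. coeff p i *s (a ^ i * b ^ (n - i)))"

lemma hom_eval_linear_factor:
  assumes "a * b = b * a" "degree p \<le> n"
  shows "hom_eval (Suc n) a b ([:- c, 1:] * p) = (a - c *s b) * hom_eval n a b p"
proof -
  have comm: "b * a ^ i = a ^ i * b" for i
    by (metis assms(1) power_commuting_commutes)
  have "hom_eval (Suc n) a b ([:- c, 1:] * p)
      = hom_eval (Suc n) a b (pCons 0 p) - c *s hom_eval (Suc n) a b p"
    unfolding hom_eval_def scale_sum_right sum_subtractf[symmetric]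
    by (intro sum.cong) (simp_all add: scale_left_diff_distrib)
  also have "hom_eval (Suc n) a b (pCons 0 p) = a * hom_eval n a b p"
    unfolding hom_eval_def sum.atMost_Suc_shift by (simp add: sum_distrib_left mult.assoc)
  also have "hom_eval (Suc n) a b p = b * hom_eval n a b p"
  proof -
    have "coeff p (Suc n) = 0"
      using assms(2) by (simp add: coeff_eq_0)
    then have "hom_eval (Suc n) a b p = (\<Sum>i\<le>n. coeff p i *s (a ^ i * b ^ (Suc n - i)))"
      by (simp add: hom_eval_def)
    also have "\<dots> = b * hom_eval n a b p"
      unfolding hom_eval_def sum_distrib_left
      by (intro sum.cong) (simp_all add: Suc_diff_le mult.assoc[symmetric] comm)
    finally show ?thesis .
  qed
  finally show ?thesis
    by (simp add: left_diff_distrib)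
qed

text \<open>Pulling \<open>v\<close> to the left through \<open>n + 1\<close> copies of
  \<open>u\<close> creates \<open>w\<close> with a q-integer as coefficient; the factor
  \<open>q - 1\<close> on the left clears its denominator.\<close>

lemma power_mult_rank_two:
  assumes "u * w = (q * p) *s (w * u)" "u * v = w + p *s (v * u)"
  shows "(q - 1) *s (u ^ Suc n * v)
    = p ^ n *s (((q - 1) * p) *s (v * u) + (q ^ Suc n - 1) *s w) * u ^ n"
proof (induct n)
  case 0
  then show ?case by (simp add: assms(2) sc_simps)
next
  case (Suc n)
  have uvu: "u * (v * u) = w * u + p *s (v * u * u)"
    by (simp add: mult.assoc[symmetric] assms(2) distrib_right)
  have "(q - 1) *s (u ^ Suc (Suc n) * v) = u * ((q - 1) *s (u ^ Suc n * v))"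
    by (simp add: mult.assoc)
  also have "\<dots> = p ^ n *s (((q - 1) * p) *s (u * (v * u)) + (q ^ Suc n - 1) *s (u * w)) * u ^ n"
    unfolding Suc by (simp only: sc_mult_right sc_mult_left mult.assoc[symmetric] distrib_left)
  also have "((q - 1) * p) *s (u * (v * u)) + (q ^ Suc n - 1) *s (u * w)
    = p *s (((q - 1) * p) *s (v * u) + (q ^ Suc (Suc n) - 1) *s w) * u"
    unfolding uvu assms(1) by (simp add: algebra_simps sc_simps)
  finally show ?case
    by (simp add: mult.assoc power_commutes k_ac)
qed

text \<open>
  For \<open>w = qbr p u v\<close> and \<open>a = (q - 1) p v u - w\<close>, which commute, moving \<open>u\<close> past \<open>v\<close> turns \<open>(q - 1)\<^sup>N u\<^sup>N v\<^sup>N\<close> into a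
  multiple of the product of the \<open>a + q\<^sup>k w\<close>, \<open>1 \<le> k \<le> N\<close>. As \<open>q\<close> has odd order \<open>N\<close>, this product is \<open>a\<^sup>N + w\<^sup>N\<close>,
  and \<open>qbr p' v u = p' a\<close>.
\<close>

lemma power_rank_two:
  assumes "serre q p p' u v" "odd N" "q ^ N = 1" "\<And>m. 0 < m \<Longrightarrow> m < N \<Longrightarrow> q ^ m \<noteq> 1"
    and "p ^ N = 1 \<or> v ^ N = 0"
  shows "qbr p' v u ^ N = p' ^ N *s ((q - 1) ^ N *s (u ^ N * v ^ N) - qbr p u v ^ N)"
proof -
  define w where "w = qbr p u v"
  define a where "a = ((q - 1) * p) *s (v * u) - w"
  define P where "P n = (\<Prod>k<n. [:- (q ^ Suc k), 1:])" for n
  have N: "0 < N" using assms(2) by (auto intro: Nat.gr0I)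
  have uw: "u * w = (q * p) *s (w * u)" and wv: "w * v = (q * p) *s (v * w)"
    and uv: "u * v = w + p *s (v * u)" and qpp: "q * p * p' = 1"
    using assms(1) by (auto simp: serre_def w_def qbr_def)
  have "v * u * w = (q * p) *s (v * w * u)"
    by (simp add: mult.assoc uw)
  also have "\<dots> = w * (v * u)"
    by (simp add: mult.assoc[symmetric] wv)
  finally have "v * u * w = w * (v * u)" .
  then have comm: "a * - w = - w * a"
    by (simp add: a_def algebra_simps)
  have P_Suc: "P (Suc n) = [:- (q ^ Suc n), 1:] * P n" for n
    by (simp add: P_def mult.commute)
  have P_deg: "degree (P n) \<le> n" for n
    unfolding P_def by (rule order_trans[OF degree_prod_sum_le]) auto
  \<comment> \<open>Step \<open>n\<close> contributes the new linear factor and a scalar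
    \<open>p ^ n\<close>, hence the triangular number in the exponent of \<open>p\<close>.\<close>
  have main: "(q - 1) ^ n *s (u ^ n * v ^ n) = p ^ (\<Sum>{..<n}) *s hom_eval n a (- w) (P n)" for n
  proof (induct n)
    case 0
    then show ?case by (simp add: hom_eval_def P_def)
  next
    case (Suc n)
    have br: "((q - 1) * p) *s (v * u) + (q ^ Suc n - 1) *s w = a - q ^ Suc n *s - w"
      by (simp add: a_def sc_simps)
    have "(q - 1) ^ Suc n *s (u ^ Suc n * v ^ Suc n)
      = (q - 1) ^ n *s ((q - 1) *s (u ^ Suc n * v)) * v ^ n"
      by (simp add: mult.assoc k_ac)
    also have "\<dots> = p ^ n *s ((a - q ^ Suc n *s - w) * ((q - 1) ^ n *s (u ^ n * v ^ n)))"
      unfolding power_mult_rank_two[OF uw uv] br by (simp add: mult.assoc k_ac)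
    also have "\<dots> = p ^ n *s p ^ (\<Sum>{..<n}) *s ((a - q ^ Suc n *s - w) * hom_eval n a (- w) (P n))"
      by (simp only: Suc sc_mult_right)
    also have "\<dots> = p ^ (\<Sum>{..<Suc n}) *s hom_eval (Suc n) a (- w) (P (Suc n))"
      unfolding P_Suc hom_eval_linear_factor[OF comm P_deg]
      by (simp add: power_add k_ac)
    finally show ?case .
  qed
  have "hom_eval N a (- w) (P N) = a ^ N + w ^ N"
  proof -
    have "P N = monom 1 N - 1"
      unfolding P_def by (rule prod_root_of_unity_factors) (use assms N in auto)
    then have "hom_eval N a (- w) (P N) = (\<Sum>i\<le>N. ((if i = N then 1 else 0) - (if i = 0 then 1 else 0)) *s (a ^ i * (- w) ^ (N - i)))"
      unfolding hom_eval_def by (intro sum.cong) auto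
    also have "\<dots> = (\<Sum>i\<le>N. if i = N then a ^ i * (- w) ^ (N - i) else 0)
        - (\<Sum>i\<le>N. if i = 0 then a ^ i * (- w) ^ (N - i) else 0)"
      unfolding sum_subtractf[symmetric] by (intro sum.cong) auto
    also have "\<dots> = a ^ N - (- w) ^ N"
      by simp
    finally show ?thesis
      using assms(2) by simp
  qed
  then have 1: "(q - 1) ^ N *s (u ^ N * v ^ N) = p ^ (\<Sum>{..<N}) *s (a ^ N + w ^ N)"
    using main[of N] by simp
  have 2: "a ^ N = (q - 1) ^ N *s (u ^ N * v ^ N) - w ^ N"
  proof -
    \<comment> \<open>The exponent is \<open>N (N - 1) / 2\<close>, a multiple of \<open>N\<close>
      since \<open>N\<close> is odd. In the other case, \<open>v ^ N = 0\<close>, the invertible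
      power of \<open>p\<close> can be cancelled from the equation.\<close>
    have "p ^ (\<Sum>{..<N}) = 1" if "p ^ N = 1"
    proof -
      obtain m where m: "N = 2 * m + 1" using assms(2) by (auto elim: oddE)
      have "\<Sum>{..<N} = N * m"
        using m by (simp add: lessThan_atLeast0 Sum_Ico_nat)
      then show ?thesis
        using that by (simp add: power_mult)
    qed
    moreover have "a ^ N + w ^ N = 0" if "v ^ N = 0"
    proof -
      have "p ^ (\<Sum>{..<N}) *s (a ^ N + w ^ N) = 0"
        using 1 that by simp
      moreover have "p ^ (\<Sum>{..<N}) \<noteq> 0" using qpp by auto
      ultimately show ?thesis by (metis scale_eq_0_iff)
    qed
    ultimately show ?thesis
      using assms(5) 1 by (auto simp: eq_diff_eq)
  qed
  have "qbr p' v u = p' *s a"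
  proof -
    have "p' * ((q - 1) * p) = 1 - p' * p"
      using qpp by (simp add: algebra_simps)
    then show ?thesis
      unfolding a_def scale_right_diff_distrib sc_sc
      by (simp add: qbr_def uv sc_simps)
  qed
  then have "qbr p' v u ^ N = p' ^ N *s a ^ N"
    by (simp only: sc_power)
  then show ?thesis
    by (simp add: 2 w_def)
qed

end

section \<open>Sums over chains\<close>

lemma chains_less: "cs \<in> chains i j \<Longrightarrow> i < j"
proof -
  assume "cs \<in> chains i j"
  then have *: "2 \<le> length cs" "hd cs = i" "last cs = j" "sorted_wrt (<) cs"
    by (auto simp: chains_def)
  then have "cs ! 0 < cs ! (length cs - 1)"
    using sorted_wrt_nth_less[of "(<)" cs 0 "length cs - 1"] by simp
  moreover have "cs \<noteq> []" using * by auto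
  ultimately show ?thesis using * by (simp add: hd_conv_nth last_conv_nth)
qed

lemma chains_le:
  assumes "cs \<in> chains i j" "x \<in> set cs"
  shows "x \<le> j"
proof -
  have "sorted cs" "last cs = j" "cs \<noteq> []"
    using assms by (auto simp: chains_def strict_sorted_imp_sorted)
  then show ?thesis
    using assms(2) by (metis append_butlast_last_id sorted_wrt_append Un_iff list.set_intros(1)
      order.refl set_ConsD set_append empty_iff list.set(1))
qed

lemma chains_snoc:
  assumes "cs \<in> chains i l" "l < j"
  shows "cs @ [j] \<in> chains i j"
proof -
  have "cs \<noteq> []" using assms by (auto simp: chains_def)
  then show ?thesis
    using assms chains_le[OF assms(1)] by (fastforce simp: chains_def sorted_wrt_append)
qed

lemma chains_eq:
  assumes "i < j"
  shows "chains i j = insert [i, j] (\<Union>l\<in>{i<..<j}. (\<lambda>cs. cs @ [j]) ` chains i l)"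
proof (intro equalityI subsetI)
  fix cs assume "cs \<in> chains i j"
  then have *: "2 \<le> length cs" "hd cs = i" "last cs = j" "sorted_wrt (<) cs"
    by (auto simp: chains_def)
  then have ne: "cs \<noteq> []" "butlast cs \<noteq> []"
    by (auto simp: butlast_conv_take)
  define js where "js = butlast cs"
  have is_eq: "cs = js @ [j]"
    unfolding js_def using * ne by (metis append_butlast_last_id)
  have js: "js \<noteq> []" "hd js = i" "sorted_wrt (<) js" "\<forall>x\<in>set js. x < j"
    using *(2,4) ne(2) unfolding js_def[symmetric] is_eq by (auto simp: sorted_wrt_append)
  show "cs \<in> insert [i, j] (\<Union>l\<in>{i<..<j}. (\<lambda>cs. cs @ [j]) ` chains i l)"
  proof (cases "length js = 1")
    case True
    then have "js = [i]" using js by (cases js) auto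
    then show ?thesis using is_eq by simp
  next
    case False
    then have "2 \<le> length js" using js by (cases js) (auto simp: Suc_le_eq)
    then have c: "js \<in> chains i (last js)" using js by (simp add: chains_def)
    moreover have "last js < j" using js by simp
    ultimately have "last js \<in> {i<..<j}" using chains_less[OF c] by simp
    moreover have "cs \<in> (\<lambda>cs. cs @ [j]) ` chains i (last js)"
      unfolding is_eq by (rule imageI) (rule c)
    ultimately show ?thesis by (meson UN_I insertI2)
  qed
next
  fix cs assume "cs \<in> insert [i, j] (\<Union>l\<in>{i<..<j}. (\<lambda>cs. cs @ [j]) ` chains i l)"
  then show "cs \<in> chains i j"
  proof
    assume "cs = [i, j]"
    then show ?thesis using assms by (simp add: chains_def)
  qed (auto intro: chains_snoc)
qed

lemma finite_chains: "finite (chains i j)"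
proof (induct j rule: less_induct)
  case (less j)
  show ?case
  proof (cases "i < j")
    case True
    show ?thesis unfolding chains_eq[OF True] using less by simp
  next
    case False
    then have "chains i j = {}" using chains_less by blast
    then show ?thesis by simp
  qed
qed

lemma sum_chains:
  assumes "i < j"
  shows "sum F (chains i j) = F [i, j] + (\<Sum>l\<in>{i<..<j}. \<Sum>cs\<in>chains i l. F (cs @ [j]))"
proof -
  have "sum F (chains i j) = F [i, j] + sum F (\<Union>l\<in>{i<..<j}. (\<lambda>cs. cs @ [j]) ` chains i l)"
    unfolding chains_eq[OF assms]
  proof (rule sum.insert)
    show "finite (\<Union>l\<in>{i<..<j}. (\<lambda>cs. cs @ [j]) ` chains i l)"
      by (simp add: finite_chains)
    show "[i, j] \<notin> (\<Union>l\<in>{i<..<j}. (\<lambda>cs. cs @ [j]) ` chains i l)"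
    proof
      assume "[i, j] \<in> (\<Union>l\<in>{i<..<j}. (\<lambda>cs. cs @ [j]) ` chains i l)"
      then obtain l cs where "cs \<in> chains i l" "[i, j] = cs @ [j]" by blast
      then show False using arg_cong[of "[i, j]" "cs @ [j]" length] by (simp add: chains_def)
    qed
  qed
  also have "sum F (\<Union>l\<in>{i<..<j}. (\<lambda>cs. cs @ [j]) ` chains i l)
      = (\<Sum>l\<in>{i<..<j}. sum F ((\<lambda>cs. cs @ [j]) ` chains i l))"
    by (intro sum.UNION_disjoint) (auto simp: finite_chains, auto simp: chains_def)
  also have "\<dots> = (\<Sum>l\<in>{i<..<j}. \<Sum>cs\<in>chains i l. F (cs @ [j]))"
    by (rule sum.cong[OF refl]) (simp add: sum.reindex inj_on_def)
  finally show ?thesis .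
qed

lemma mu_chain_snoc:
  assumes "cs \<in> chains i l"
  shows "mu_chain \<mu> (cs @ [j]) = mu_chain \<mu> cs * \<mu> l j"
proof -
  have *: "2 \<le> length cs" "last cs = l" "cs \<noteq> []"
    using assms by (auto simp: chains_def)
  then obtain m where m: "length cs = Suc m" by (cases "length cs") auto
  have "mu_chain \<mu> (cs @ [j]) = (\<Prod>s<Suc m. \<mu> ((cs @ [j]) ! s) ((cs @ [j]) ! Suc s))"
    by (simp add: mu_chain_def m)
  also have "\<dots> = (\<Prod>s<m. \<mu> (cs ! s) (cs ! Suc s)) * \<mu> (cs ! m) j"
    using m by (simp add: nth_append)
  finally show ?thesis
    using * m by (simp add: mu_chain_def last_conv_nth)
qed

text \<open>A geometric series over paths: for \<open>i < j\<close>,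
  \<open>c * chain_sum c \<mu> i j\<close> is the entry of the inverse of the unitriangular matrix
  \<open>1 - c \<mu>\<close>.\<close>

definition chain_sum :: "'k::field \<Rightarrow> (nat \<Rightarrow> nat \<Rightarrow> 'k) \<Rightarrow> nat \<Rightarrow> nat \<Rightarrow> 'k" where
  "chain_sum c \<mu> i j = (\<Sum>cs\<in>chains i j. c ^ (length cs - 2) * mu_chain \<mu> cs)"

lemma chain_weight_snoc:
  assumes "cs \<in> chains i l"
  shows "c ^ (length (cs @ [j]) - 2) * mu_chain \<mu> (cs @ [j])
    = c * \<mu> l j * (c ^ (length cs - 2) * mu_chain \<mu> cs)"
proof -
  have "length (cs @ [j]) - 2 = Suc (length cs - 2)"
    using assms by (auto simp: chains_def)
  then show ?thesis by (simp add: mu_chain_snoc[OF assms])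
qed

lemma chain_sum_rec:
  assumes "i < j"
  shows "chain_sum c \<mu> i j = \<mu> i j + c * (\<Sum>l\<in>{i<..<j}. chain_sum c \<mu> i l * \<mu> l j)"
proof -
  have "chain_sum c \<mu> i j = \<mu> i j + (\<Sum>l\<in>{i<..<j}. \<Sum>cs\<in>chains i l. c * \<mu> l j * (c ^ (length cs - 2) * mu_chain \<mu> cs))"
    unfolding chain_sum_def sum_chains[OF assms]
    by (intro arg_cong2[where f = "(+)"] sum.cong refl chain_weight_snoc) (simp_all add: mu_chain_def)
  then show ?thesis
    by (simp add: chain_sum_def sum_distrib_left sum_distrib_right mult_ac)
qed

text \<open>The vector depends only on the last step of the chain, so summing over everything before
  that step leaves a \<open>chain_sum\<close>. This puts the elements \<open>uroot\<close> into
  matrix form.\<close>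

lemma (in vector_space) sum_chains_last:
  assumes "i < j"
  shows "(\<Sum>cs\<in>chains i j. scale (c ^ (length cs - 2) * mu_chain \<mu> cs) (f (cs ! (length cs - 2)) (cs ! (length cs - 1))))
    = scale (\<mu> i j) (f i j) + (\<Sum>l\<in>{i<..<j}. scale (c * chain_sum c \<mu> i l * \<mu> l j) (f l j))"
proof -
  have "(\<Sum>cs\<in>chains i l. scale (c ^ (length (cs @ [j]) - 2) * mu_chain \<mu> (cs @ [j]))
        (f ((cs @ [j]) ! (length (cs @ [j]) - 2)) ((cs @ [j]) ! (length (cs @ [j]) - 1))))
      = scale (c * chain_sum c \<mu> i l * \<mu> l j) (f l j)" for l
  proof -
    have "(\<Sum>cs\<in>chains i l. scale (c ^ (length (cs @ [j]) - 2) * mu_chain \<mu> (cs @ [j]))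
        (f ((cs @ [j]) ! (length (cs @ [j]) - 2)) ((cs @ [j]) ! (length (cs @ [j]) - 1))))
      = (\<Sum>cs\<in>chains i l. scale (c * \<mu> l j * (c ^ (length cs - 2) * mu_chain \<mu> cs)) (f l j))"
    proof (intro sum.cong refl)
      fix cs assume cs: "cs \<in> chains i l"
      then have "(cs @ [j]) ! (length (cs @ [j]) - 2) = l"
        by (cases "cs = []") (auto simp: chains_def nth_append last_conv_nth)
      moreover have "(cs @ [j]) ! (length (cs @ [j]) - 1) = j"
        by simp
      ultimately show "scale (c ^ (length (cs @ [j]) - 2) * mu_chain \<mu> (cs @ [j]))
          (f ((cs @ [j]) ! (length (cs @ [j]) - 2)) ((cs @ [j]) ! (length (cs @ [j]) - 1)))
        = scale (c * \<mu> l j * (c ^ (length cs - 2) * mu_chain \<mu> cs)) (f l j)"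
        by (simp only: chain_weight_snoc[OF cs])
    qed
    also have "\<dots> = scale (c * chain_sum c \<mu> i l * \<mu> l j) (f l j)"
      by (simp only: scale_sum_left[symmetric] chain_sum_def sum_distrib_left sum_distrib_right)
        (simp add: mult_ac)
    finally show ?thesis .
  qed
  then show ?thesis
    by (subst sum_chains[OF assms]) (simp add: mu_chain_def)
qed

text \<open>With \<open>S\<close> for \<open>chain_sum c \<mu>\<close>, \<open>chain_sum_rec\<close>
  expresses \<open>(1 + c S) (1 - c \<mu>) = 1\<close>; this is the product in the other order.
  Expanding by the last step and exchanging the double sum reduces it to smaller
  \<open>j\<close>.\<close>

lemma chain_sum_rec_first:
  assumes "i < j"
  shows "chain_sum c \<mu> i j = \<mu> i j + c * (\<Sum>l\<in>{i<..<j}. \<mu> i l * chain_sum c \<mu> l j)"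
  using assms
proof (induct j rule: less_induct)
  case (less j)
  let ?S = "chain_sum c \<mu>"
  have "(\<Sum>l\<in>{i<..<j}. \<mu> i l * ?S l j)
    = (\<Sum>l\<in>{i<..<j}. \<mu> i l * (\<mu> l j + c * (\<Sum>m\<in>{l<..<j}. ?S l m * \<mu> m j)))"
    by (intro sum.cong refl arg_cong2[where f = "(*)"] chain_sum_rec) auto
  also have "\<dots> = (\<Sum>l\<in>{i<..<j}. \<mu> i l * \<mu> l j)
      + c * (\<Sum>l\<in>{i<..<j}. \<Sum>m\<in>{l<..<j}. \<mu> i l * ?S l m * \<mu> m j)"
    by (simp add: algebra_simps sum.distrib sum_distrib_left)
  also have "(\<Sum>l\<in>{i<..<j}. \<Sum>m\<in>{l<..<j}. \<mu> i l * ?S l m * \<mu> m j)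
      = (\<Sum>m\<in>{i<..<j}. \<Sum>l\<in>{i<..<m}. \<mu> i l * ?S l m * \<mu> m j)"
    unfolding sum.Sigma[OF finite_greaterThanLessThan ballI[OF finite_greaterThanLessThan]]
    by (rule sum.reindex_bij_witness[where i = prod.swap and j = prod.swap]) auto
  also have "(\<Sum>l\<in>{i<..<j}. \<mu> i l * \<mu> l j)
      + c * (\<Sum>m\<in>{i<..<j}. \<Sum>l\<in>{i<..<m}. \<mu> i l * ?S l m * \<mu> m j)
      = (\<Sum>m\<in>{i<..<j}. (\<mu> i m + c * (\<Sum>l\<in>{i<..<m}. \<mu> i l * ?S l m)) * \<mu> m j)"
    by (simp add: algebra_simps sum.distrib sum_distrib_left sum_distrib_right)
  also have "\<dots> = (\<Sum>m\<in>{i<..<j}. ?S i m * \<mu> m j)"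
    by (intro sum.cong refl arg_cong2[where f = "(*)"] less(1)[symmetric]) auto
  finally show ?case
    using less by (simp add: chain_sum_rec)
qed

text \<open>For entries of products of upper triangular matrices: only indices between row and
  column contribute, and the ends, where a diagonal entry occurs, are split off.\<close>

lemma sum_interval_ends:
  fixes F :: "nat \<Rightarrow> 'b::comm_monoid_add"
  assumes "i \<le> a" "a < b" "b \<le> j" "\<And>l. l \<in> {i..j} \<Longrightarrow> l < a \<or> b < l \<Longrightarrow> F l = 0"
  shows "sum F {i..j} = F a + (sum F {a<..<b} + F b)"
proof -
  have "sum F {i..j} = sum F {a..b}"
    using assms by (intro sum.mono_neutral_right) auto
  also have "{a..b} = insert a (insert b {a<..<b})"
    using assms by auto
  finally show ?thesis
    using assms by (simp add: add.commute)
qed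

context k_algebra
begin

text \<open>
  With \<open>c \<mu> = 1 - N\<close> and \<open>M = N\<^sup>-\<^sup>1\<close> this says that \<open>1 + c V = M G\<^sup>-\<^sup>1 N G\<close> is inverse to
  \<open>1 - c U = G\<^sup>-\<^sup>1 M G N\<close>, where \<open>G\<close> is the diagonal matrix with \<open>(G\<^sup>-\<^sup>1 A G)\<^sub>i\<^sub>j = A\<^sub>i\<^sub>j \<gamma>\<^sub>i\<^sub>j\<close>.
\<close>

lemma group_matrix_recursion:
  fixes \<mu> :: "nat \<Rightarrow> nat \<Rightarrow> 'k" and \<gamma> :: "nat \<Rightarrow> nat \<Rightarrow> 'a"
  assumes "i < j" "c \<noteq> 0"
    and \<gamma>: "\<And>a b d. i \<le> a \<Longrightarrow> a \<le> b \<Longrightarrow> b \<le> d \<Longrightarrow> d \<le> j \<Longrightarrow> \<gamma> a b * \<gamma> b d = \<gamma> a d"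
    and e: "\<And>a. i \<le> a \<Longrightarrow> a \<le> j \<Longrightarrow> \<gamma> a a = e"
  defines "S \<equiv> chain_sum c \<mu>"
  defines "U \<equiv> \<lambda>a b. S a b *s (e - \<gamma> a b) - (\<Sum>l\<in>{a<..<b}. (c * S a l * \<mu> l b) *s (e - \<gamma> a l))"
    and "V \<equiv> \<lambda>a b. \<mu> a b *s (e - \<gamma> a b) + (\<Sum>l\<in>{a<..<b}. (c * S a l * \<mu> l b) *s (e - \<gamma> l b))"
  shows "U i j = V i j - c *s (\<Sum>l\<in>{i<..<j}. U i l * V l j)"
proof -
  define M where "M a b = (if a = b then 1 else if a < b then c * S a b else 0)" for a b :: nat
  define N where "N a b = (if a = b then 1 else if a < b then - c * \<mu> a b else 0)" for a b :: nat
  have NM: "(\<Sum>l\<in>{i..j}. N a l * M l b) = (if a = b then 1 else 0)" if "a \<in> {i..j}" "b \<in> {i..j}" for a b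
  proof -
    consider "b < a" | "a = b" | "a < b" by linarith
    then show ?thesis
    proof cases
      case 1
      then show ?thesis by (auto simp: M_def N_def intro!: sum.neutral)
    next
      case 2
      have "(\<Sum>l\<in>{i..j}. N a l * M l b) = (\<Sum>l\<in>{i..j}. if l = a then 1 else 0)"
        using 2 by (intro sum.cong) (auto simp: M_def N_def)
      then show ?thesis using 2 that by simp
    next
      case 3
      have "(\<Sum>l\<in>{i..j}. N a l * M l b) = c * S a b + ((\<Sum>l\<in>{a<..<b}. - c * \<mu> a l * (c * S l b)) - c * \<mu> a b)"
        using that 3 by (subst sum_interval_ends[of i a b j]) (auto simp: M_def N_def)
      then show ?thesis
        using 3 by (simp add: S_def chain_sum_rec_first[OF 3] algebra_simps sum_negf sum_distrib_left)
    qed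
  qed
  have MN: "(\<Sum>l\<in>{i..j}. M i l * N l j) = 0"
    using assms(1) by (subst sum_interval_ends[of i i j j])
      (auto simp: M_def N_def S_def chain_sum_rec[OF assms(1)] algebra_simps sum_negf sum_distrib_left)
  \<comment> \<open>\<open>G\<close> is row \<open>i\<close> of \<open>1 - c U\<close> and
    \<open>E\<close> is column \<open>j\<close> of \<open>1 + c V\<close>, both in factored form
    with \<open>e\<close> for 1. The claim is that this row times this column is 0.\<close>
  define G where "G l = (\<Sum>a\<in>{i..j}. (M i a * N a l) *s \<gamma> i a)" for l
  define E where "E l = (\<Sum>b\<in>{i..j}. (M l b * N b j) *s \<gamma> b j)" for l
  have ee: "e * \<gamma> a j = \<gamma> a j" "\<gamma> i a * e = \<gamma> i a" if "a \<in> {i..j}" for a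
    using \<gamma>[of a a j] \<gamma>[of i a a] e[of a] that by auto
  have G_i: "G i = e"
  proof -
    have "G i = (\<Sum>a\<in>{i..j}. if a = i then e else 0)"
      unfolding G_def using e by (intro sum.cong) (auto simp: M_def N_def)
    then show ?thesis using assms(1) by simp
  qed
  have E_j: "E j = e"
  proof -
    have "E j = (\<Sum>a\<in>{i..j}. if a = j then e else 0)"
      unfolding E_def using e by (intro sum.cong) (auto simp: M_def N_def)
    then show ?thesis using assms(1) by simp
  qed
  have G: "G l = - (c *s U i l)" if "i < l" "l \<le> j" for l
  proof -
    have "G l = - (c * \<mu> i l) *s e + ((\<Sum>a\<in>{i<..<l}. - (c * (c * S i a * \<mu> a l)) *s \<gamma> i a) + (c * S i l) *s \<gamma> i l)"
      unfolding G_def using that e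
      by (subst sum_interval_ends[of i i l j]) (auto simp: M_def N_def mult_ac)
    moreover have "c * \<mu> i l = c * S i l - (\<Sum>a\<in>{i<..<l}. c * (c * S i a * \<mu> a l))"
      by (simp add: S_def chain_sum_rec[OF that(1)] algebra_simps sum_distrib_left)
    ultimately show ?thesis
      by (simp add: U_def sc_simps sum_negf sum_subtractf scale_sum_right scale_sum_left)
  qed
  have E: "E l = c *s V l j" if "i \<le> l" "l < j" for l
  proof -
    have "E l = - (c * \<mu> l j) *s \<gamma> l j + ((\<Sum>a\<in>{l<..<j}. - (c * (c * S l a * \<mu> a j)) *s \<gamma> a j) + (c * S l j) *s e)"
      unfolding E_def using that e
      by (subst sum_interval_ends[of i l j j]) (auto simp: M_def N_def mult_ac)
    moreover have "c * S l j = c * \<mu> l j + (\<Sum>a\<in>{l<..<j}. c * (c * S l a * \<mu> a j))"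
      by (simp add: S_def chain_sum_rec[OF that(2)] algebra_simps sum_distrib_left)
    ultimately show ?thesis
      by (simp add: V_def sc_simps sum_negf sum_subtractf scale_sum_right scale_sum_left)
  qed
  \<comment> \<open>Summing over \<open>l\<close> first contracts \<open>N M\<close> to the
    identity. Then \<open>\<gamma> i a * \<gamma> a j = \<gamma> i j\<close> no longer depends on
    \<open>a\<close>, and an off-diagonal entry of \<open>M N\<close> remains.\<close>
  have "(\<Sum>l\<in>{i..j}. G l * E l)
    = (\<Sum>l\<in>{i..j}. \<Sum>a\<in>{i..j}. \<Sum>b\<in>{i..j}. (M i a * N b j * (N a l * M l b)) *s (\<gamma> i a * \<gamma> b j))"
    unfolding G_def E_def sum_product by (simp add: mult_ac)
  also have "\<dots> = (\<Sum>a\<in>{i..j}. \<Sum>b\<in>{i..j}. \<Sum>l\<in>{i..j}. (M i a * N b j * (N a l * M l b)) *s (\<gamma> i a * \<gamma> b j))"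
    by (subst sum.swap) (intro sum.cong refl sum.swap)
  also have "\<dots> = (\<Sum>a\<in>{i..j}. \<Sum>b\<in>{i..j}. if b = a then (M i a * N a j) *s (\<gamma> i a * \<gamma> a j) else 0)"
    by (intro sum.cong refl) (auto simp: scale_sum_left[symmetric] sum_distrib_left[symmetric] NM)
  also have "\<dots> = (\<Sum>a\<in>{i..j}. (M i a * N a j) *s \<gamma> i j)"
    using \<gamma> by (intro sum.cong) auto
  also have "\<dots> = 0"
    by (simp add: scale_sum_left[symmetric] MN)
  finally have "G i * E i + ((\<Sum>l\<in>{i<..<j}. G l * E l) + G j * E j) = 0"
    using assms(1) sum_interval_ends[of i i j j "\<lambda>l. G l * E l"] by simp
  moreover have "G i * E i = E i" "G j * E j = G j"
    unfolding G_i E_j by (auto simp: E_def G_def sum_distrib_left sum_distrib_right ee)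
  then have "G i * E i = c *s V i j" "G j * E j = - (c *s U i j)"
    using assms(1) by (simp_all only: E G order.refl)
  moreover have "(\<Sum>l\<in>{i<..<j}. G l * E l) = c *s (- (c *s (\<Sum>l\<in>{i<..<j}. U i l * V l j)))"
    by (simp add: G E scale_sum_right sum_negf)
  ultimately have "c *s (V i j - c *s (\<Sum>l\<in>{i<..<j}. U i l * V l j) - U i j) = 0"
    by (simp add: sc_simps algebra_simps)
  then show ?thesis
    using assms(2) by simp
qed

end


section \<open>Root vectors\<close>

text \<open>A pair \<open>i < j\<close> stands for the root with letters \<open>x i\<close>, ...,
  \<open>x (j - 1)\<close>, hence half-open intervals and the bound \<open>Suc n\<close>.
  \<open>r\<close> is the braiding matrix. \<open>X\<close> grows by letters at the left end of the
  root and \<open>Z\<close> at the right end.\<close>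

locale root_vectors = k_algebra sc
  for sc :: "'k::field \<Rightarrow> 'a::ring_1 \<Rightarrow> 'a" (infixr "*s" 75) +
  fixes n :: nat and q :: 'k and r :: "nat \<Rightarrow> nat \<Rightarrow> 'k"
    and x :: "nat \<Rightarrow> 'a" and X Z :: "nat \<Rightarrow> nat \<Rightarrow> 'a"
  assumes q_nz: "1 + q \<noteq> 0"
    and near: "1 \<le> i \<Longrightarrow> Suc i \<le> n \<Longrightarrow> serre q (r i (Suc i)) (r (Suc i) i) (x i) (x (Suc i))"
    and far: "i \<in> {1..n} \<Longrightarrow> j \<in> {1..n} \<Longrightarrow> Suc i < j \<or> Suc j < i \<Longrightarrow> x i * x j = r i j *s (x j * x i)"
    and far_r: "i \<in> {1..n} \<Longrightarrow> j \<in> {1..n} \<Longrightarrow> Suc i < j \<or> Suc j < i \<Longrightarrow> r i j * r j i = 1"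
    and X_simple: "i \<in> {1..n} \<Longrightarrow> X i (Suc i) = x i"
    and Z_simple: "i \<in> {1..n} \<Longrightarrow> Z i (Suc i) = x i"
    and X_step: "1 \<le> i \<Longrightarrow> Suc i < j \<Longrightarrow> j \<le> Suc n \<Longrightarrow>
      X i j = qbr (\<Prod>b\<in>{Suc i..<j}. r i b) (x i) (X (Suc i) j)"
    and Z_step: "1 \<le> i \<Longrightarrow> i < j \<Longrightarrow> j \<le> n \<Longrightarrow>
      Z i (Suc j) = qbr (\<Prod>b\<in>{i..<j}. r j b) (x j) (Z i j)"
begin

lemma X_commute:
  assumes "1 \<le> i" "i < j" "j \<le> Suc n" "\<And>l. l \<in> {i..<j} \<Longrightarrow> y * x l = s l *s (x l * y)"
  shows "y * X i j = (\<Prod>l\<in>{i..<j}. s l) *s (X i j * y)"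
proof -
  have "1 \<le> i \<longrightarrow> (\<forall>l\<in>{i..<j}. y * x l = s l *s (x l * y))
      \<longrightarrow> y * X i j = (\<Prod>l\<in>{i..<j}. s l) *s (X i j * y)"
    using \<open>i < j\<close> assms(3)
  proof (induct i rule: strict_inc_induct)
    case (base i)
    then show ?case by (auto simp: X_simple)
  next
    case (step i)
    show ?case
    proof (intro impI)
      assume i: "1 \<le> i" and *: "\<forall>l\<in>{i..<j}. y * x l = s l *s (x l * y)"
      have "X i j = qbr (\<Prod>b\<in>{Suc i..<j}. r i b) (x i) (X (Suc i) j)"
        using step i by (intro X_step) auto
      moreover have "y * X (Suc i) j = (\<Prod>l\<in>{Suc i..<j}. s l) *s (X (Suc i) j * y)"
        using step * by auto
      ultimately show "y * X i j = (\<Prod>l\<in>{i..<j}. s l) *s (X i j * y)"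
        using qbr_commute_left[of y "x i" "s i" "X (Suc i) j"] * step(1)
        by (auto simp: prod.atLeast_Suc_lessThan)
    qed
  qed
  then show ?thesis using assms by auto
qed

lemma Z_commute:
  assumes "1 \<le> i" "i < j" "j \<le> Suc n" "\<And>l. l \<in> {i..<j} \<Longrightarrow> y * x l = s l *s (x l * y)"
  shows "y * Z i j = (\<Prod>l\<in>{i..<j}. s l) *s (Z i j * y)"
proof -
  have "Suc i \<le> j" using assms by simp
  then have "j \<le> Suc n \<longrightarrow> (\<forall>l\<in>{i..<j}. y * x l = s l *s (x l * y))
      \<longrightarrow> y * Z i j = (\<Prod>l\<in>{i..<j}. s l) *s (Z i j * y)"
  proof (induct j rule: dec_induct)
    case base
    then show ?case using assms by (auto simp: Z_simple)
  next
    case (step j)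
    show ?case
    proof (intro impI)
      assume j: "Suc j \<le> Suc n" and *: "\<forall>l\<in>{i..<Suc j}. y * x l = s l *s (x l * y)"
      have "Z i (Suc j) = qbr (\<Prod>b\<in>{i..<j}. r j b) (x j) (Z i j)"
        using step j assms by (intro Z_step) auto
      moreover have "y * Z i j = (\<Prod>l\<in>{i..<j}. s l) *s (Z i j * y)"
        using step * j by auto
      ultimately show "y * Z i (Suc j) = (\<Prod>l\<in>{i..<Suc j}. s l) *s (Z i (Suc j) * y)"
        using qbr_commute_left[of y "x j" "s j" "Z i j" "prod s {i..<j}"] * step(1)
        by (simp add: mult.commute)
    qed
  qed
  then show ?thesis using assms by auto
qed

lemma X_x_far:
  assumes "1 \<le> l" "Suc l < i" "i < j" "j \<le> Suc n"
  shows "X i j * x l = (\<Prod>b\<in>{i..<j}. r b l) *s (x l * X i j)"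
proof -
  have "x l * X i j = (\<Prod>b\<in>{i..<j}. r l b) *s (X i j * x l)"
    using assms by (intro X_commute far) auto
  moreover have "(\<Prod>b\<in>{i..<j}. r b l) * (\<Prod>b\<in>{i..<j}. r l b) = 1"
    unfolding prod.distrib[symmetric] using assms by (intro prod.neutral) (auto intro!: far_r)
  ultimately show ?thesis by simp
qed

lemma Z_x_far:
  assumes "1 \<le> i" "i < j" "j < l" "l \<le> n"
  shows "Z i j * x l = (\<Prod>b\<in>{i..<j}. r b l) *s (x l * Z i j)"
proof -
  have "x l * Z i j = (\<Prod>b\<in>{i..<j}. r l b) *s (Z i j * x l)"
    using assms by (intro Z_commute far) auto
  moreover have "(\<Prod>b\<in>{i..<j}. r b l) * (\<Prod>b\<in>{i..<j}. r l b) = 1"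
    unfolding prod.distrib[symmetric] using assms by (intro prod.neutral) (auto intro!: far_r)
  ultimately show ?thesis by simp
qed

text \<open>The braiding scalar of the root vector of \<open>(i, j)\<close> with that of
  \<open>(k, l)\<close>.\<close>

definition rr :: "nat \<Rightarrow> nat \<Rightarrow> nat \<Rightarrow> nat \<Rightarrow> 'k" where
  "rr i j k l = (\<Prod>a\<in>{i..<j}. \<Prod>b\<in>{k..<l}. r a b)"

text \<open>The missing letter \<open>x l\<close> separates the two roots, so every letter of one
  skew-commutes with every letter of the other.\<close>

lemma X_Z_far:
  assumes "1 \<le> i" "i < l" "Suc l < j" "j \<le> Suc n"
  shows "X (Suc l) j * Z i l = rr (Suc l) j i l *s (Z i l * X (Suc l) j)"
  unfolding rr_def
  by (subst prod.swap, rule Z_commute) (use assms in \<open>auto intro!: X_x_far\<close>)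

lemma far_inverse:
  assumes "A \<subseteq> {1..n}" "l \<in> {1..n}" "\<And>b. b \<in> A \<Longrightarrow> Suc b < l \<or> Suc l < b"
  shows "(\<Prod>b\<in>A. r l b) = 1 / (\<Prod>b\<in>A. r b l)" "(\<Prod>b\<in>A. r b l) \<noteq> 0"
proof -
  have *: "(\<Prod>b\<in>A. r l b) * (\<Prod>b\<in>A. r b l) = 1"
    unfolding prod.distrib[symmetric] using assms by (intro prod.neutral) (auto intro!: far_r)
  show nz: "(\<Prod>b\<in>A. r b l) \<noteq> 0"
    using * by (metis mult_zero_right zero_neq_one)
  show "(\<Prod>b\<in>A. r l b) = 1 / (\<Prod>b\<in>A. r b l)"
    using * nz by (simp only: eq_divide_eq) simp
qed

text \<open>The root grows to the left: \<open>serre_bracket\<close> is applied with middle vertex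
  \<open>x (Suc l)\<close>, between \<open>X (Suc (Suc l)) j\<close> and \<open>x l\<close>.
  \<open>serre_x_Z\<close> is its mirror image.\<close>

lemma serre_x_X:
  assumes "1 \<le> l" "Suc l < j" "j \<le> Suc n"
  shows "serre q (\<Prod>b\<in>{Suc l..<j}. r l b) (\<Prod>b\<in>{Suc l..<j}. r b l) (x l) (X (Suc l) j)"
proof -
  \<comment> \<open>The downward induction has to start at \<open>j - 2\<close>, where
    \<open>X (Suc l) j\<close> is a single letter.\<close>
  have "l < j - 1" using assms by simp
  then show ?thesis using assms
  proof (induct l rule: strict_inc_induct)
    case (base l)
    then have "j = Suc (Suc l)" by simp
    then show ?case using near[of l] base by (auto simp: X_simple)
  next
    case (step l)
    have l: "1 \<le> l" "Suc (Suc l) < j" "j \<le> Suc n" using step by auto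
    define c where "c = (\<Prod>b\<in>{Suc (Suc l)..<j}. r b l)"
    have IH: "serre q (\<Prod>b\<in>{Suc (Suc l)..<j}. r (Suc l) b) (\<Prod>b\<in>{Suc (Suc l)..<j}. r b (Suc l))
        (x (Suc l)) (X (Suc (Suc l)) j)"
      using step by auto
    have c: "(\<Prod>b\<in>{Suc (Suc l)..<j}. r l b) = 1 / c"
      unfolding c_def by (rule far_inverse) (use l in auto)
    have c0: "c \<noteq> 0"
      unfolding c_def by (rule far_inverse) (use l in auto)
    have comm: "X (Suc (Suc l)) j * x l = c *s (x l * X (Suc (Suc l)) j)"
      unfolding c_def using l by (intro X_x_far) auto
    have "serre q (c * r (Suc l) l) (r l (Suc l) / c) (X (Suc l) j) (x l)"
      unfolding X_step[of "Suc l" j, simplified, OF l(2,3)]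
      by (rule serre_bracket[OF IH _ comm c0 q_nz]) (use near[of l] l in \<open>auto intro!: serre_sym\<close>)
    then show ?case
      using serre_sym l(2) c unfolding c_def
      by (fastforce simp: prod.atLeast_Suc_lessThan[of "Suc l"] mult.commute)
  qed
qed

lemma serre_x_Z:
  assumes "1 \<le> i" "i < l" "l \<le> n"
  shows "serre q (\<Prod>b\<in>{i..<l}. r l b) (\<Prod>b\<in>{i..<l}. r b l) (x l) (Z i l)"
proof -
  have "Suc i \<le> l" using assms by simp
  then show ?thesis using assms
  proof (induct l rule: dec_induct)
    case base
    then show ?case using near[of i] by (auto simp: Z_simple intro: serre_sym)
  next
    case (step l)
    have l: "1 \<le> i" "i < l" "Suc l \<le> n" using step by auto
    define c where "c = (\<Prod>b\<in>{i..<l}. r b (Suc l))"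
    have IH: "serre q (\<Prod>b\<in>{i..<l}. r l b) (\<Prod>b\<in>{i..<l}. r b l) (x l) (Z i l)"
      using step by auto
    have c: "(\<Prod>b\<in>{i..<l}. r (Suc l) b) = 1 / c"
      unfolding c_def by (rule far_inverse) (use l in auto)
    have c0: "c \<noteq> 0"
      unfolding c_def by (rule far_inverse) (use l in auto)
    have comm: "Z i l * x (Suc l) = c *s (x (Suc l) * Z i l)"
      unfolding c_def using l by (intro Z_x_far) auto
    have "serre q (c * r l (Suc l)) (r (Suc l) l / c) (Z i (Suc l)) (x (Suc l))"
      unfolding Z_step[OF l(1,2) Suc_leD[OF l(3)]]
      by (rule serre_bracket[OF IH _ comm c0 q_nz]) (use near[of l] l in auto)
    then show ?case
      using serre_sym l(2) c unfolding c_def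
      by (fastforce simp: mult.commute)
  qed
qed

text \<open>Here the middle vertex is \<open>x l\<close>, between \<open>X (Suc l) j\<close> and
  \<open>Z i l\<close>. When \<open>j = Suc l\<close> the factor \<open>X l j\<close> is the letter
  itself.\<close>

lemma serre_Z_X:
  assumes "1 \<le> i" "i < l" "l < j" "j \<le> Suc n"
  shows "serre q (rr i l l j) (rr l j i l) (Z i l) (X l j)"
proof (cases "j = Suc l")
  case True
  then show ?thesis
    using serre_x_Z[of i l] assms serre_sym by (auto simp: X_simple rr_def)
next
  case False
  then have j: "Suc l < j" using assms by simp
  define c where "c = rr (Suc l) j i l"
  have c: "c * rr i l (Suc l) j = 1"
    unfolding c_def rr_def
    by (subst (2) prod.swap) (use assms in \<open>auto simp: prod.distrib[symmetric] intro!: prod.neutral far_r\<close>)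
  then have "c \<noteq> 0" by auto
  have l: "1 \<le> l" using assms by simp
  have "serre q (c * (\<Prod>b\<in>{i..<l}. r l b)) ((\<Prod>b\<in>{i..<l}. r b l) / c) (X l j) (Z i l)"
    unfolding X_step[OF l j assms(4)]
    by (rule serre_bracket) (use assms j \<open>c \<noteq> 0\<close> q_nz in \<open>auto simp: c_def intro!: serre_x_X serre_x_Z X_Z_far\<close>)
  moreover have "rr l j i l = c * (\<Prod>b\<in>{i..<l}. r l b)"
    using assms(3) by (simp add: c_def rr_def prod.atLeast_Suc_lessThan mult.commute)
  moreover have "rr i l l j = (\<Prod>b\<in>{i..<l}. r b l) / c"
    using assms(3) c \<open>c \<noteq> 0\<close>
    by (simp add: rr_def prod.atLeast_Suc_lessThan prod.distrib field_simps)
  ultimately show ?thesis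
    by (simp add: serre_sym)
qed

text \<open>
  Interpolation between \<open>X i j\<close> and \<open>Z i j\<close>: reversing the order in the bracket \<open>W i l j\<close> gives a scalar
  multiple of \<open>W i (Suc l) j\<close>.
\<close>

definition W :: "nat \<Rightarrow> nat \<Rightarrow> nat \<Rightarrow> 'a" where
  "W i l j = (if l < j then qbr (rr i l l j) (Z i l) (X l j) else Z i j)"

lemma W_first: "1 \<le> i \<Longrightarrow> i < j \<Longrightarrow> j \<le> Suc n \<Longrightarrow> W i (Suc i) j = X i j"
  by (cases "j = Suc i") (auto simp: W_def rr_def X_step X_simple Z_simple)

lemma W_last: "W i j j = Z i j"
  by (simp add: W_def)

text \<open>\<open>X l j\<close> and \<open>Z i (Suc l)\<close> are both brackets with first entry
  \<open>x l\<close>, so \<open>qbr_assoc\<close> moves \<open>x l\<close> from the right factor to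
  the left one. For \<open>j = Suc l\<close> nothing is left on the right, and the claim is
  \<open>Z_step\<close>.\<close>

lemma qbr_X_Z:
  assumes "1 \<le> i" "i < l" "l < j" "j \<le> Suc n"
  shows "qbr (rr l j i l) (X l j) (Z i l) = rr (Suc l) j i l *s W i (Suc l) j"
proof (cases "j = Suc l")
  case True
  then show ?thesis
    using assms by (simp add: W_def rr_def X_simple Z_step)
next
  case False
  then have j: "Suc l < j" using assms by simp
  define c where "c = rr (Suc l) j i l"
  have c: "c * rr i l (Suc l) j = 1"
    unfolding c_def rr_def
    by (subst (2) prod.swap) (use assms in \<open>auto simp: prod.distrib[symmetric] intro!: prod.neutral far_r\<close>)
  then have c0: "c \<noteq> 0" by auto
  have "rr l j i l = c * (\<Prod>b\<in>{i..<l}. r l b)"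
    using assms(3) by (simp add: c_def rr_def prod.atLeast_Suc_lessThan mult.commute)
  moreover have "rr i (Suc l) (Suc l) j = (\<Prod>b\<in>{Suc l..<j}. r l b) / c"
    using assms(2) c c0 by (simp add: rr_def field_simps)
  moreover have "X l j = qbr (\<Prod>b\<in>{Suc l..<j}. r l b) (x l) (X (Suc l) j)"
    "Z i (Suc l) = qbr (\<Prod>b\<in>{i..<l}. r l b) (x l) (Z i l)"
    using assms j by (auto intro!: X_step Z_step)
  ultimately show ?thesis
    using qbr_assoc[OF X_Z_far[OF assms(1,2) j assms(4), folded c_def] c0] j
    by (simp add: W_def c_def)
qed

text \<open>The scalar accumulated on the way from \<open>W i (Suc i) j\<close> to
  \<open>W i l j\<close> is \<open>twist N i l\<close>: passing \<open>l\<close> costs a sign and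
  the \<open>N\<close>-th power of the braiding of \<open>x l\<close> with the root
  \<open>(i, l)\<close>. For a datum it becomes the prefactor of \<open>sigma_par\<close>.\<close>

definition twist :: "nat \<Rightarrow> nat \<Rightarrow> nat \<Rightarrow> 'k" where
  "twist N i j = (-1) ^ (j - i - 1) * (\<Prod>l\<in>{i<..<j}. \<Prod>b\<in>{i..<l}. r l b ^ N)"

section \<open>Powers of root vectors\<close>

context
  fixes N :: nat
  assumes odd_N: "odd N" and q_N: "q ^ N = 1" "\<And>m. 0 < m \<Longrightarrow> m < N \<Longrightarrow> q ^ m \<noteq> 1"
    and r_nz: "\<And>i j. i \<in> {1..n} \<Longrightarrow> j \<in> {1..n} \<Longrightarrow> r i j \<noteq> 0"
    and X_power: "\<And>i j a. 1 \<le> i \<Longrightarrow> i < j \<Longrightarrow> j \<le> Suc n \<Longrightarrow> a \<in> {1..n} \<Longrightarrow>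
      (\<Prod>b\<in>{i..<j}. r a b) ^ N = 1 \<or> X i j ^ N = 0"
begin

text \<open>\<open>power_rank_two\<close> for the Serre pair \<open>Z i l\<close>,
  \<open>X l j\<close>. Its alternative on \<open>p\<close> and \<open>v\<close> follows from
  \<open>X_power\<close>, used for each letter of \<open>Z i l\<close>; the scalar from
  \<open>qbr_X_Z\<close> then cancels.\<close>

lemma W_power_step:
  assumes "1 \<le> i" "i < l" "l < j" "j \<le> Suc n"
  shows "W i (Suc l) j ^ N
    = (\<Prod>b\<in>{i..<l}. r l b ^ N) *s ((q - 1) ^ N *s (Z i l ^ N * X l j ^ N) - W i l j ^ N)"
proof -
  define c where "c = rr (Suc l) j i l"
  have c0: "c \<noteq> 0"
    unfolding c_def rr_def using assms by (auto simp: r_nz)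
  have "rr i l l j ^ N = 1 \<or> X l j ^ N = 0"
  proof (cases "X l j ^ N = 0")
    case False
    then have "(\<Prod>b\<in>{l..<j}. r a b) ^ N = 1" if "a \<in> {1..n}" for a
      using X_power[of l j a] assms that by auto
    then show ?thesis
      unfolding rr_def prod_power_distrib[symmetric]
      using assms by (auto simp: prod_power_distrib intro!: prod.neutral)
  qed simp
  then have *: "qbr (rr l j i l) (X l j) (Z i l) ^ N
      = rr l j i l ^ N *s ((q - 1) ^ N *s (Z i l ^ N * X l j ^ N) - qbr (rr i l l j) (Z i l) (X l j) ^ N)"
    by (intro power_rank_two serre_Z_X assms odd_N q_N)
  have W: "qbr (rr i l l j) (Z i l) (X l j) = W i l j"
    using assms by (simp add: W_def)
  have rr: "rr l j i l = c * (\<Prod>b\<in>{i..<l}. r l b)"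
    using assms(3) by (simp add: c_def rr_def prod.atLeast_Suc_lessThan mult.commute)
  have "c ^ N *s W i (Suc l) j ^ N = c ^ N *s (\<Prod>b\<in>{i..<l}. r l b ^ N)
    *s ((q - 1) ^ N *s (Z i l ^ N * X l j ^ N) - W i l j ^ N)"
    using * unfolding qbr_X_Z[OF assms] W c_def[symmetric]
    by (simp add: sc_power rr power_mult_distrib prod_power_distrib)
  then show ?thesis
    using c0 by (metis power_not_zero scale_left_imp_eq)
qed

lemma twist_nz:
  assumes "1 \<le> i" "j \<le> Suc n"
  shows "twist N i j \<noteq> 0"
  using assms by (auto simp: twist_def r_nz)

text \<open>Telescoping \<open>W_power_step\<close> over \<open>l\<close>: dividing by
  \<open>twist\<close> turns each step into subtraction of one summand, from
  \<open>W i (Suc i) j = X i j\<close> to \<open>W i j j = Z i j\<close>.\<close>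

lemma Z_power_recursion:
  assumes "1 \<le> i" "i < j" "j \<le> Suc n"
  shows "(1 / twist N i j) *s Z i j ^ N
    = X i j ^ N - (q - 1) ^ N *s (\<Sum>l\<in>{i<..<j}. ((1 / twist N i l) *s Z i l ^ N) * X l j ^ N)"
proof -
  have "l \<le> j \<longrightarrow> (1 / twist N i l) *s W i l j ^ N
    = X i j ^ N - (q - 1) ^ N *s (\<Sum>m\<in>{i<..<l}. ((1 / twist N i m) *s Z i m ^ N) * X m j ^ N)"
    if "Suc i \<le> l" for l
    using that
  proof (induct l rule: dec_induct)
    case base
    have "{i<..<Suc i} = {}" by auto
    then show ?case using assms by (simp add: W_first twist_def)
  next
    case (step l)
    show ?case
    proof
      assume l: "Suc l \<le> j"
      have ins: "{i<..<Suc l} = insert l {i<..<l}"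
        using step by auto
      have twist: "twist N i (Suc l) = - twist N i l * (\<Prod>b\<in>{i..<l}. r l b ^ N)"
      proof -
        have "Suc l - i - 1 = Suc (l - i - 1)" using step by simp
        then show ?thesis by (simp add: twist_def ins)
      qed
      have "twist N i (Suc l) \<noteq> 0" "twist N i l \<noteq> 0" using assms l twist_nz[of i "Suc l"] twist_nz[of i l] by auto
      then have "(1 / twist N i (Suc l)) *s W i (Suc l) j ^ N
        = (1 / twist N i l) *s W i l j ^ N - (q - 1) ^ N *s ((1 / twist N i l) *s Z i l ^ N * X l j ^ N)"
      proof -
        have "(1 / twist N i (Suc l)) *s W i (Suc l) j ^ N
          = (- (1 / twist N i l)) *s ((q - 1) ^ N *s (Z i l ^ N * X l j ^ N) - W i l j ^ N)"
          using W_power_step[of i l j] step assms l \<open>twist N i (Suc l) \<noteq> 0\<close> by (simp add: twist)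
        then show ?thesis by (simp add: sc_simps mult.commute)
      qed
      then show "(1 / twist N i (Suc l)) *s W i (Suc l) j ^ N
        = X i j ^ N - (q - 1) ^ N *s (\<Sum>m\<in>{i<..<Suc l}. ((1 / twist N i m) *s Z i m ^ N) * X m j ^ N)"
        using step l by (simp add: ins sc_simps)
    qed
  qed
  from this[of j] show ?thesis
    using assms by (simp add: W_last)
qed

end

end

section \<open>Reflection of data and parameters\<close>

lemma chiroot_split: "i \<le> l \<Longrightarrow> l \<le> j \<Longrightarrow> chiroot D i j h = chiroot D i l h * chiroot D l j h"
  unfolding chiroot_def by (simp add: prod.atLeastLessThan_concat)

lemma chiroot_dg: "chiroot D i j (dg D a) = (\<Prod>b\<in>{i..<j}. qq D a b)"
  by (simp add: chiroot_def qq_def)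

lemma tau_eq: "tau D i j = (\<Prod>l\<in>{i..<j}. \<Prod>k\<in>{i..<l}. qq D l k ^ dN D)"
proof -
  have "(\<Prod>l\<in>{i..<j}. \<Prod>k\<in>{i..<l}. qq D l k ^ dN D) = (\<Prod>(l, k)\<in>(SIGMA l:{i..<j}. {i..<l}). qq D l k ^ dN D)"
    by (rule prod.Sigma) auto
  also have "\<dots> = tau D i j"
    unfolding tau_def by (rule prod.reindex_bij_witness[where i = prod.swap and j = prod.swap]) auto
  finally show ?thesis by simp
qed

text \<open>The last factor collects the pairs that straddle the cut at \<open>l\<close>.\<close>

lemma tau_split:
  assumes "i \<le> l" "l \<le> j"
  shows "tau D i j = tau D i l * tau D l j * (\<Prod>k\<in>{i..<l}. \<Prod>m\<in>{l..<j}. qq D m k ^ dN D)"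
proof -
  have "tau D i j = tau D i l * (\<Prod>m\<in>{l..<j}. \<Prod>k\<in>{i..<m}. qq D m k ^ dN D)"
    unfolding tau_eq using assms by (simp add: prod.atLeastLessThan_concat)
  also have "(\<Prod>m\<in>{l..<j}. \<Prod>k\<in>{i..<m}. qq D m k ^ dN D)
      = (\<Prod>m\<in>{l..<j}. (\<Prod>k\<in>{i..<l}. qq D m k ^ dN D) * (\<Prod>k\<in>{l..<m}. qq D m k ^ dN D))"
    using assms by (intro prod.cong refl) (simp add: prod.atLeastLessThan_concat)
  also have "\<dots> = tau D l j * (\<Prod>k\<in>{i..<l}. \<Prod>m\<in>{l..<j}. qq D m k ^ dN D)"
    by (subst prod.swap) (simp add: tau_eq prod.distrib mult.commute)
  finally show ?thesis by (simp add: mult.assoc)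
qed

lemma sum_chains_reflect:
  assumes "a \<le> m" "b \<le> m"
  shows "(\<Sum>cs\<in>chains a b. F (rev (map (\<lambda>i. m - i) cs))) = sum F (chains (m - b) (m - a))"
proof -
  define R where "R = (\<lambda>cs. rev (map (\<lambda>i. m - i) cs))"
  have R: "R cs \<in> chains (m - b) (m - a)" "R (R cs) = cs" if "cs \<in> chains a b" "b \<le> m" for a b cs
  proof -
    have cs: "2 \<le> length cs" "hd cs = a" "last cs = b" "sorted_wrt (<) cs" "cs \<noteq> []"
      using that(1) by (auto simp: chains_def)
    have le: "x \<le> m" if "x \<in> set cs" for x
      using chains_le[OF \<open>cs \<in> _\<close> that] \<open>b \<le> m\<close> by simp
    have "sorted_wrt (\<lambda>x y. m - y < m - x) cs"
      using cs(4) by (rule sorted_wrt_mono_rel[rotated]) (use le in fastforce)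
    then have "sorted_wrt (<) (R cs)"
      by (simp add: R_def sorted_wrt_rev sorted_wrt_map)
    then show "R cs \<in> chains (m - b) (m - a)"
      using cs by (simp add: chains_def R_def hd_rev last_map last_rev hd_map)
    have "map ((\<lambda>i. m - i) \<circ> (\<lambda>i. m - i)) cs = map id cs"
      using le by (intro map_cong) auto
    then show "R (R cs) = cs"
      by (simp add: R_def rev_map[symmetric])
  qed
  have "sum (\<lambda>cs. F (R cs)) (chains a b) = sum F (chains (m - b) (m - a))"
    by (rule sum.reindex_bij_witness[where i = R and j = R])
      (use R assms R[of _ "m - b" "m - a"] in \<open>auto\<close>)
  then show ?thesis by (simp add: R_def)
qed

lemma sum_reflect_interval:
  assumes "i < j" "j \<le> m"
  shows "(\<Sum>d\<in>{m - j<..<m - i}. F d) = (\<Sum>l\<in>{i<..<j}. F (m - l :: nat))"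
  by (rule sum.reindex_bij_witness[where i = "\<lambda>l. m - l" and j = "\<lambda>l. m - l"]) (use assms in auto)

lemma sigma_par_eq:
  assumes "1 \<le> a" "a < b" "b \<le> dn D + 1"
  shows "sigma_par D \<mu> a b = tau D (tilde D b) (tilde D a) * (-1) ^ (b - a + 1) *
    chain_sum ((dq D - 1) ^ dN D) \<mu> (tilde D b) (tilde D a)"
proof -
  have "(\<Sum>cs\<in>chains a b. (dq D - 1) ^ (dN D * (length cs - 2)) * mu_chain \<mu> (rev (map (tilde D) cs)))
     = (\<Sum>cs\<in>chains a b. (\<lambda>cs. ((dq D - 1) ^ dN D) ^ (length cs - 2) * mu_chain \<mu> cs) (rev (map (\<lambda>i. dn D + 2 - i) cs)))"
    by (simp add: power_mult tilde_def[abs_def])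
  also have "\<dots> = chain_sum ((dq D - 1) ^ dN D) \<mu> (tilde D b) (tilde D a)"
    unfolding chain_sum_def tilde_def using assms by (intro sum_chains_reflect) auto
  finally show ?thesis by (simp add: sigma_par_def)
qed

text \<open>
  Up to junk values outside the index range, \<open>(D', \<mu>')\<close> is \<open>(D\<^sup>\<sigma>, \<sigma>\<^sup>D(\<mu>))\<close>. Unlike the latter, this relation
  is symmetric.
\<close>

definition reflects :: "('g, 'k::field) datum \<Rightarrow> (nat \<Rightarrow> nat \<Rightarrow> 'k) \<Rightarrow> ('g, 'k) datum \<Rightarrow> (nat \<Rightarrow> nat \<Rightarrow> 'k) \<Rightarrow> bool" where
  "reflects D \<mu> D' \<mu>' \<longleftrightarrow> dgrp D' = dgrp D \<and> dn D' = dn D \<and> dq D' = dq D \<and> dN D' = dN D \<and>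
    (\<forall>i\<in>{1..dn D}. dg D' i = dg D (sigma_idx D i) \<and> dchi D' i = dchi D (sigma_idx D i)) \<and>
    (\<forall>i j. 1 \<le> i \<and> i < j \<and> j \<le> dn D + 1 \<longrightarrow> \<mu>' i j = sigma_par D \<mu> i j)"

lemma reflects_sigma: "reflects D \<mu> (sigma_datum D) (sigma_par D \<mu>)"
  by (simp add: reflects_def sigma_datum_def)

text \<open>Only the first pair is assumed to be a Cartan datum with (R2). The same is derived for
  the second pair, after which the roles can be exchanged.\<close>

locale reflected_data =
  fixes D :: "('g, 'k::field) datum" and \<mu> :: "nat \<Rightarrow> nat \<Rightarrow> 'k"
    and D' :: "('g, 'k) datum" and \<mu>' :: "nat \<Rightarrow> nat \<Rightarrow> 'k"
  assumes datum: "cartan_datum D" and R2: "R2 D \<mu>" and rel: "reflects D \<mu> D' \<mu>'"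
begin

abbreviation "n \<equiv> dn D"
abbreviation "q \<equiv> dq D"
abbreviation "N \<equiv> dN D"
abbreviation "c \<equiv> (q - 1) ^ N"
abbreviation "S \<equiv> chain_sum c \<mu>"
abbreviation "S' \<equiv> chain_sum c \<mu>'"

lemma D'_simps [simp]: "dgrp D' = dgrp D" "dn D' = n" "dq D' = q" "dN D' = N"
  using rel by (auto simp: reflects_def)

lemma D'_gen: "i \<in> {1..n} \<Longrightarrow> dg D' i = dg D (n + 1 - i)" "i \<in> {1..n} \<Longrightarrow> dchi D' i = dchi D (n + 1 - i)"
  using rel by (auto simp: reflects_def sigma_idx_def)

lemma qq': "i \<in> {1..n} \<Longrightarrow> j \<in> {1..n} \<Longrightarrow> qq D' i j = qq D (n + 1 - i) (n + 1 - j)"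
  by (simp add: qq_def D'_gen)

lemma tilde' [simp]: "tilde D' = tilde D" "sigma_idx D' = sigma_idx D"
  by (auto simp: tilde_def sigma_idx_def)

lemma dg_closed: "i \<in> {1..n} \<Longrightarrow> dg D i \<in> carrier (dgrp D)"
  and dchi_character: "i \<in> {1..n} \<Longrightarrow> character (dgrp D) (dchi D i)"
  using datum by (auto simp: cartan_datum_def)

lemma qq_nz: "i \<in> {1..n} \<Longrightarrow> j \<in> {1..n} \<Longrightarrow> qq D i j \<noteq> 0"
  using dg_closed dchi_character by (auto simp: character_def qq_def)

lemma odd_N: "odd N" and q_N: "q ^ N = 1" and q_order: "0 < m \<Longrightarrow> m < N \<Longrightarrow> q ^ m \<noteq> 1" and N_gt: "1 < N"
  using datum by (auto simp: cartan_datum_def)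

lemma q_nz: "q \<noteq> 0"
  using q_N N_gt by (auto simp: power_0_left)

lemma q_plus_one: "1 + q \<noteq> 0"
proof
  assume "1 + q = 0"
  then have "q = -1" by (simp add: add_eq_0_iff)
  moreover have "2 < N" using odd_N N_gt by (cases "N = 2") auto
  ultimately show False using q_order[of 2] by simp
qed

lemma c_nz: "c \<noteq> 0"
  using q_order[of 1] N_gt by simp

lemma qq_diag: "i \<in> {1..n} \<Longrightarrow> qq D i i = q"
  and qq_near: "i \<in> {1..n} \<Longrightarrow> j \<in> {1..n} \<Longrightarrow> i = Suc j \<or> j = Suc i \<Longrightarrow> qq D i j * qq D j i = inverse q"
  and qq_far: "i \<in> {1..n} \<Longrightarrow> j \<in> {1..n} \<Longrightarrow> Suc i < j \<or> Suc j < i \<Longrightarrow> qq D i j * qq D j i = 1"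
  using datum unfolding cartan_datum_def by blast+

text \<open>In each of the three cases \<open>qq D i j * qq D j i\<close> is a power of
  \<open>q\<close>.\<close>

lemma qq_power: "i \<in> {1..n} \<Longrightarrow> j \<in> {1..n} \<Longrightarrow> qq D i j ^ N * qq D j i ^ N = 1"
proof -
  assume ij: "i \<in> {1..n}" "j \<in> {1..n}"
  consider "i = j" | "i = Suc j \<or> j = Suc i" | "Suc i < j \<or> Suc j < i" by linarith
  then have "(qq D i j * qq D j i) ^ N = 1"
  proof cases
    case 1
    then show ?thesis using q_N qq_diag[OF ij(1)] by (simp add: power_mult_distrib)
  next
    case 2
    then show ?thesis using q_N qq_near[OF ij] by (simp add: power_inverse)
  next
    case 3
    then show ?thesis using qq_far[OF ij] by simp
  qed
  then show ?thesis by (simp add: power_mult_distrib)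
qed

definition triv :: "nat \<Rightarrow> nat \<Rightarrow> bool" where
  "triv i j \<longleftrightarrow> (\<forall>h\<in>carrier (dgrp D). chiroot D i j h ^ N = 1)"

lemma triv_trans: "triv i l \<Longrightarrow> triv l j \<Longrightarrow> i \<le> l \<Longrightarrow> l \<le> j \<Longrightarrow> triv i j"
  by (simp add: triv_def chiroot_split[of i l j] power_mult_distrib)

lemma mu_zero: "1 \<le> i \<Longrightarrow> i < j \<Longrightarrow> j \<le> n + 1 \<Longrightarrow> \<not> triv i j \<Longrightarrow> \<mu> i j = 0"
  using R2 by (auto simp: R2_def triv_def)

text \<open>By \<open>triv_trans\<close>, a nontrivial root cannot be cut into trivial ones, so each
  product along a chain contains a factor that (R2) kills.\<close>

lemma S_zero: "1 \<le> i \<Longrightarrow> i < j \<Longrightarrow> j \<le> n + 1 \<Longrightarrow> \<not> triv i j \<Longrightarrow> S i j = 0"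
proof (induct j rule: less_induct)
  case (less j)
  have "S i l * \<mu> l j = 0" if "l \<in> {i<..<j}" for l
    using less that mu_zero[of l j] triv_trans[of i l j] by fastforce
  then have "(\<Sum>l\<in>{i<..<j}. S i l * \<mu> l j) = 0"
    by (intro sum.neutral) auto
  then show ?case
    using less mu_zero by (simp add: chain_sum_rec)
qed

lemma triv_qq: "triv i j \<Longrightarrow> a \<in> {1..n} \<Longrightarrow> (\<Prod>b\<in>{i..<j}. qq D a b) ^ N = 1"
  using dg_closed by (auto simp: triv_def chiroot_dg[symmetric])

text \<open>Where \<open>\<mu> l j\<close> is nonzero, (R2) makes the product over \<open>m\<close>
  of \<open>qq D k m ^ N\<close> equal to 1, and \<open>qq_power\<close> transfers this to
  \<open>qq D m k\<close>. Thus the straddling factor of \<open>tau_split\<close> is 1, and twisting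
  entries by \<open>tau\<close> respects these matrix products.\<close>

lemma tau_mult:
  assumes "1 \<le> i" "i < l" "l < j" "j \<le> n + 1"
  shows "tau D i j * (S i l * \<mu> l j) = tau D i l * tau D l j * (S i l * \<mu> l j)"
proof (cases "\<mu> l j = 0")
  case False
  then have "triv l j" using mu_zero[of l j] assms by auto
  have "(\<Prod>m\<in>{l..<j}. qq D m k ^ N) = 1" if k: "k \<in> {i..<l}" for k
  proof -
    have "(\<Prod>m\<in>{l..<j}. qq D k m ^ N) * (\<Prod>m\<in>{l..<j}. qq D m k ^ N) = 1"
      unfolding prod.distrib[symmetric] using assms k by (intro prod.neutral) (auto intro!: qq_power)
    moreover have "(\<Prod>m\<in>{l..<j}. qq D k m ^ N) = 1"
      using triv_qq[OF \<open>triv l j\<close>, of k] k assms by (simp add: prod_power_distrib)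
    ultimately show ?thesis by simp
  qed
  then show ?thesis
    using assms by (simp add: tau_split[of i l j])
qed simp

lemma mu'_eq:
  assumes "1 \<le> i" "i < j" "j \<le> n + 1"
  shows "\<mu>' (tilde D j) (tilde D i) = (-1) ^ (j - i + 1) * tau D i j * S i j"
proof -
  have "\<mu>' (tilde D j) (tilde D i) = sigma_par D \<mu> (tilde D j) (tilde D i)"
  proof -
    have "1 \<le> tilde D j \<and> tilde D j < tilde D i \<and> tilde D i \<le> n + 1"
      using assms by (auto simp: tilde_def)
    then show ?thesis using rel unfolding reflects_def by blast
  qed
  also have "\<dots> = (-1) ^ (j - i + 1) * tau D i j * S i j"
    using assms by (subst sigma_par_eq) (auto simp: tilde_def)
  finally show ?thesis .
qed

lemma mu'_product:
  assumes "1 \<le> i" "i < l" "l < j" "j \<le> n + 1"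
    and "S' (tilde D j) (tilde D l) = (-1) ^ (j - l + 1) * tau D l j * \<mu> l j"
  shows "S' (tilde D j) (tilde D l) * \<mu>' (tilde D l) (tilde D i)
    = - ((-1) ^ (j - i + 1) * tau D i j * (S i l * \<mu> l j))"
proof -
  have "(-1) ^ (j - l + 1) * (-1) ^ (l - i + 1) = - ((-1) ^ (j - i + 1) :: 'k)"
  proof -
    \<comment> \<open>The surplus 1 gives the minus sign with which the sum in the recursion for
      \<open>S'\<close> cancels the sum in the recursion for \<open>S\<close>.\<close>
    have "j - l + 1 + (l - i + 1) = Suc (j - i + 1)" using assms by simp
    then show ?thesis by (metis power_Suc power_add mult_minus1)
  qed
  then have "S' (tilde D j) (tilde D l) * \<mu>' (tilde D l) (tilde D i)
      = - ((-1) ^ (j - i + 1) * (tau D i l * tau D l j * (S i l * \<mu> l j)))"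
    using assms by (simp add: mu'_eq mult_ac)
  then show ?thesis
    by (simp only: tau_mult[OF assms(1-4)] mult.assoc)
qed

text \<open>By \<open>mu'_eq\<close>, reflection turns \<open>S\<close> into \<open>\<mu>'\<close>
  up to sign and \<open>tau\<close>. Conversely it turns \<open>\<mu>\<close> into
  \<open>S'\<close>, since inverting a unitriangular matrix twice gives it back. The two together
  make the reflection an involution.\<close>

lemma S'_eq:
  assumes "1 \<le> i" "i < j" "j \<le> n + 1"
  shows "S' (tilde D j) (tilde D i) = (-1) ^ (j - i + 1) * tau D i j * \<mu> i j"
  using assms
proof (induct "j - i" arbitrary: i rule: less_induct)
  case less
  have "S' (tilde D j) (tilde D i)
    = \<mu>' (tilde D j) (tilde D i) + c * (\<Sum>d\<in>{tilde D j<..<tilde D i}. S' (tilde D j) d * \<mu>' d (tilde D i))"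
    using less by (intro chain_sum_rec) (auto simp: tilde_def)
  also have "(\<Sum>d\<in>{tilde D j<..<tilde D i}. S' (tilde D j) d * \<mu>' d (tilde D i))
    = (\<Sum>l\<in>{i<..<j}. S' (tilde D j) (tilde D l) * \<mu>' (tilde D l) (tilde D i))"
    unfolding tilde_def using less by (intro sum_reflect_interval) auto
  also have "\<dots> = (\<Sum>l\<in>{i<..<j}. - ((-1) ^ (j - i + 1) * tau D i j * (S i l * \<mu> l j)))"
    using less by (intro sum.cong refl mu'_product) auto
  also have "\<mu>' (tilde D j) (tilde D i) = (-1) ^ (j - i + 1) * tau D i j * S i j"
    using less by (intro mu'_eq) auto
  also have "S i j = \<mu> i j + c * (\<Sum>l\<in>{i<..<j}. S i l * \<mu> l j)"
    using less by (intro chain_sum_rec) auto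
  finally show ?case
    by (simp add: sum_negf sum_distrib_left algebra_simps)
qed

text \<open>Reflection exchanges the two indices of each factor, and \<open>qq_power\<close> says
  that the exchanged factors are inverse to each other.\<close>

lemma tau_reflect:
  assumes "1 \<le> i" "i < j" "j \<le> n + 1"
  shows "tau D' (tilde D j) (tilde D i) * tau D i j = 1"
proof -
  have "tau D' (tilde D j) (tilde D i) = (\<Prod>(k, l)\<in>{(k, l). i \<le> k \<and> k < l \<and> l < j}. qq D k l ^ N)"
    unfolding tau_def
    by (rule prod.reindex_bij_witness[where i = "\<lambda>(k, l). (n + 1 - l, n + 1 - k)"
          and j = "\<lambda>(k, l). (n + 1 - l, n + 1 - k)"])
      (use assms in \<open>auto simp: tilde_def intro!: arg_cong2[where f = "(^)"] qq'[simplified, symmetric]\<close>)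
  then show ?thesis
    unfolding tau_def using assms
    by (auto simp: prod.distrib[symmetric] intro!: prod.neutral qq_power)
qed

lemma reflects_sym: "reflects D' \<mu>' D \<mu>"
proof -
  have "\<mu> i j = sigma_par D' \<mu>' i j" if "1 \<le> i" "i < j" "j \<le> n + 1" for i j
  proof -
    have "sigma_par D' \<mu>' i j = tau D' (tilde D j) (tilde D i) * (-1) ^ (j - i + 1) * S' (tilde D j) (tilde D i)"
      using that by (subst sigma_par_eq) auto
    also have "\<dots> = (tau D' (tilde D j) (tilde D i) * tau D i j) * ((-1) ^ (j - i + 1) * (-1) ^ (j - i + 1)) * \<mu> i j"
      using that by (simp add: S'_eq mult_ac)
    finally show ?thesis
      using that by (simp add: tau_reflect flip: power_mult_distrib)
  qed
  moreover have "dg D i = dg D' (sigma_idx D i)" "dchi D i = dchi D' (sigma_idx D i)" if "i \<in> {1..n}" for i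
  proof -
    have "n + 1 - i \<in> {1..n}" "n + 1 - (n + 1 - i) = i" using that by auto
    then show "dg D i = dg D' (sigma_idx D i)" "dchi D i = dchi D' (sigma_idx D i)"
      using D'_gen[of "n + 1 - i"] by (simp_all add: sigma_idx_def)
  qed
  ultimately show ?thesis
    by (simp add: reflects_def)
qed

lemma chiroot':
  assumes "1 \<le> i" "i \<le> j" "j \<le> n + 1"
  shows "chiroot D' (tilde D j) (tilde D i) h = chiroot D i j h"
  unfolding chiroot_def
  by (rule prod.reindex_bij_witness[where i = "\<lambda>l. n + 1 - l" and j = "\<lambda>l. n + 1 - l"])
    (use assms in \<open>auto simp: tilde_def intro!: fun_cong[OF D'_gen(2)[simplified, symmetric]]\<close>)

lemma groot':
  assumes "1 \<le> i" "i \<le> j" "j \<le> n + 1"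
  shows "groot D' (tilde D j) (tilde D i) = groot D i j"
proof -
  interpret comm_group "dgrp D" using datum by (simp add: cartan_datum_def)
  have "inj_on (\<lambda>l. n + 1 - l) {i..<j}" using assms by (auto simp: inj_on_def)
  moreover have "(\<lambda>l. n + 1 - l) ` {i..<j} = {tilde D j..<tilde D i}"
  proof (intro equalityI subsetI)
    fix k assume "k \<in> {tilde D j..<tilde D i}"
    then have "k = n + 1 - (n + 1 - k)" "n + 1 - k \<in> {i..<j}" using assms by (auto simp: tilde_def)
    then show "k \<in> (\<lambda>l. n + 1 - l) ` {i..<j}" by blast
  qed (use assms in \<open>auto simp: tilde_def\<close>)
  moreover have "dg D' x \<in> carrier (dgrp D)" if "x \<in> {tilde D j..<tilde D i}" for x
  proof -
    have "x \<in> {1..n}" "n + 1 - x \<in> {1..n}" using that assms by (auto simp: tilde_def)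
    then show ?thesis using dg_closed[of "n + 1 - x"] by (simp only: D'_gen)
  qed
  ultimately have "groot D' (tilde D j) (tilde D i) = (\<Otimes>\<^bsub>dgrp D\<^esub>l\<in>{i..<j}. dg D' (n + 1 - l))"
    using finprod_reindex[of "dg D'" "\<lambda>l. n + 1 - l" "{i..<j}"]
    by (auto simp: groot_def Pi_def)
  also have "\<dots> = groot D i j"
    unfolding groot_def
  proof (rule finprod_cong'[OF refl])
    show "dg D \<in> {i..<j} \<rightarrow> carrier (dgrp D)" using assms dg_closed by auto
    fix l assume "l \<in> {i..<j}"
    then have "n + 1 - l \<in> {1..n}" "n + 1 - (n + 1 - l) = l" using assms by auto
    then show "dg D' (n + 1 - l) = dg D l" by (simp only: D'_gen)
  qed
  finally show ?thesis .
qed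

lemma R2': "R2 D' \<mu>'"
  unfolding R2_def
proof (intro allI impI)
  fix a b assume ab: "1 \<le> a \<and> a < b \<and> b \<le> dn D' + 1"
    and *: "\<exists>h\<in>carrier (dgrp D'). chiroot D' a b h ^ dN D' \<noteq> 1"
  have 1: "1 \<le> tilde D b" "tilde D b < tilde D a" "tilde D a \<le> n + 1" "tilde D (tilde D a) = a" "tilde D (tilde D b) = b"
    using ab by (auto simp: tilde_def)
  have "\<not> triv (tilde D b) (tilde D a)"
    using * chiroot'[of "tilde D b" "tilde D a"] 1 by (auto simp: triv_def)
  then show "\<mu>' a b = 0"
    using mu'_eq[OF 1(1-3)] S_zero[OF 1(1-3)] 1 by simp
qed

lemma cartan_datum': "cartan_datum D'"
proof -
  have *: "n + 1 - i \<in> {1..n}" if "i \<in> {1..n}" for i using that by auto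
  have "qq D' i i = q" if "i \<in> {1..n}" for i
    using that qq_diag[OF *[OF that]] by (simp add: qq')
  moreover have "qq D' i j * qq D' j i = inverse q" if "i \<in> {1..n}" "j \<in> {1..n}" "i = Suc j \<or> j = Suc i" for i j
  proof -
    have "n + 1 - i = Suc (n + 1 - j) \<or> n + 1 - j = Suc (n + 1 - i)" using that by auto
    then show ?thesis
      using qq_near[OF *[OF that(1)] *[OF that(2)]] that(1,2) by (simp add: qq')
  qed
  moreover have "qq D' i j * qq D' j i = 1" if "i \<in> {1..n}" "j \<in> {1..n}" "Suc i < j \<or> Suc j < i" for i j
  proof -
    have "Suc (n + 1 - i) < n + 1 - j \<or> Suc (n + 1 - j) < n + 1 - i" using that by auto
    then show ?thesis
      using qq_far[OF *[OF that(1)] *[OF that(2)]] that(1,2) by (simp add: qq')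
  qed
  ultimately show ?thesis
    using datum * dg_closed dchi_character unfolding cartan_datum_def by (simp add: D'_gen)
qed

lemma groot_closed: "1 \<le> i \<Longrightarrow> j \<le> n + 1 \<Longrightarrow> groot D i j \<in> carrier (dgrp D)"
proof -
  assume ij: "1 \<le> i" "j \<le> n + 1"
  interpret comm_group "dgrp D" using datum by (simp add: cartan_datum_def)
  show ?thesis using ij dg_closed unfolding groot_def by (intro finprod_closed) auto
qed

lemma groot_refl: "groot D i i [^]\<^bsub>dgrp D\<^esub> N = \<one>\<^bsub>dgrp D\<^esub>"
proof -
  interpret comm_group "dgrp D" using datum by (simp add: cartan_datum_def)
  show ?thesis by (simp add: groot_def)
qed

lemma groot_trans:
  assumes "1 \<le> i" "i \<le> l" "l \<le> j" "j \<le> n + 1"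
  shows "groot D i l [^]\<^bsub>dgrp D\<^esub> N \<otimes>\<^bsub>dgrp D\<^esub> groot D l j [^]\<^bsub>dgrp D\<^esub> N = groot D i j [^]\<^bsub>dgrp D\<^esub> N"
proof -
  interpret comm_group "dgrp D" using datum by (simp add: cartan_datum_def)
  have "{i..<j} = {i..<l} \<union> {l..<j}" using assms by auto
  then have "groot D i j = groot D i l \<otimes>\<^bsub>dgrp D\<^esub> groot D l j"
    unfolding groot_def using assms dg_closed
    by (simp only:) (intro finprod_Un_disjoint, auto)
  then show ?thesis
    using assms groot_closed[of i l] groot_closed[of l j] by (simp add: nat_pow_distrib)
qed

end

section \<open>The power formula for the reflected root vectors\<close>

locale root_vector_rep = reflected_data D \<mu> D' \<mu>' + root_vectors sc "dn D" "dq D" "qq D" x X Z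
  for sc :: "'k::field \<Rightarrow> 'a::ring_1 \<Rightarrow> 'a" (infixr "*s" 75)
    and D :: "('g, 'k) datum" and \<mu> :: "nat \<Rightarrow> nat \<Rightarrow> 'k"
    and D' :: "('g, 'k) datum" and \<mu>' :: "nat \<Rightarrow> nat \<Rightarrow> 'k"
    and x :: "nat \<Rightarrow> 'a" and X Z :: "nat \<Rightarrow> nat \<Rightarrow> 'a" +
  fixes h :: "'g \<Rightarrow> 'a"
  assumes h_mult: "a \<in> carrier (dgrp D) \<Longrightarrow> b \<in> carrier (dgrp D) \<Longrightarrow> h a * h b = h (a \<otimes>\<^bsub>dgrp D\<^esub> b)"
    and X_root: "1 \<le> i \<Longrightarrow> i < j \<Longrightarrow> j \<le> dn D + 1 \<Longrightarrow> X i j ^ dN D =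
      (\<Sum>cs\<in>chains i j. ((dq D - 1) ^ (dN D * (length cs - 2)) * mu_chain \<mu> cs) *s
        (h \<one>\<^bsub>dgrp D\<^esub> - h (groot D (cs ! (length cs - 2)) (cs ! (length cs - 1)) [^]\<^bsub>dgrp D\<^esub> dN D)))"
begin

text \<open>The image of the unit under a possibly non-unital representation; by
  \<open>h_mult\<close> it is an idempotent that acts as identity on the values of \<open>h\<close>
  on the group.\<close>

definition e :: 'a where
  "e = h \<one>\<^bsub>dgrp D\<^esub>"

definition gam :: "nat \<Rightarrow> nat \<Rightarrow> 'a" where
  "gam i j = h (groot D i j [^]\<^bsub>dgrp D\<^esub> N)"

text \<open>The \<open>u\<close> element of the reflected datum, rewritten in the indices of
  \<open>D\<close> and divided by \<open>twist\<close>. The last step of a reflected chain is a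
  first step here, hence \<open>gam i l\<close>; the minus sign is that of
  \<open>mu'_product\<close>.\<close>

definition U :: "nat \<Rightarrow> nat \<Rightarrow> 'a" where
  "U i j = S i j *s (e - gam i j) - (\<Sum>l\<in>{i<..<j}. (c * S i l * \<mu> l j) *s (e - gam i l))"

definition V :: "nat \<Rightarrow> nat \<Rightarrow> 'a" where
  "V i j = \<mu> i j *s (e - gam i j) + (\<Sum>l\<in>{i<..<j}. (c * S i l * \<mu> l j) *s (e - gam l j))"

lemma X_power_eq: "1 \<le> i \<Longrightarrow> i < j \<Longrightarrow> j \<le> n + 1 \<Longrightarrow> X i j ^ N = V i j"
  using sum_chains_last[of i j c \<mu> "\<lambda>a b. e - gam a b"]
  by (simp add: X_root V_def e_def gam_def power_mult)

text \<open>If the \<open>N\<close>-th power of the character of the root is nontrivial, each term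
  of \<open>V i j\<close> has a vanishing coefficient by (R2).\<close>

lemma X_power_trivial:
  assumes "1 \<le> i" "i < j" "j \<le> Suc n" "a \<in> {1..n}"
  shows "(\<Prod>b\<in>{i..<j}. qq D a b) ^ N = 1 \<or> X i j ^ N = 0"
proof (cases "triv i j")
  case True
  then show ?thesis using triv_qq assms by auto
next
  case False
  have "S i l * \<mu> l j = 0" if "l \<in> {i<..<j}" for l
    using False that assms mu_zero[of l j] S_zero[of i l] triv_trans[of i l j] by fastforce
  then have "V i j = 0"
    using False mu_zero[of i j] assms by (auto simp: V_def mult.assoc intro!: sum.neutral)
  then show ?thesis
    using X_power_eq[of i j] assms by simp
qed

lemma gam_mult:
  assumes "1 \<le> a" "a \<le> b" "b \<le> d" "d \<le> n + 1"
  shows "gam a b * gam b d = gam a d"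
proof -
  interpret comm_group "dgrp D" using datum by (simp add: cartan_datum_def)
  show ?thesis
    using assms groot_closed[of a b] groot_closed[of b d]
    by (simp add: gam_def h_mult groot_trans)
qed

text \<open>\<open>Z_power_recursion\<close> and \<open>group_matrix_recursion\<close> are the same
  recursion, so induction on \<open>j\<close> identifies their solutions.\<close>

lemma Z_power_eq:
  assumes "1 \<le> i" "i < j" "j \<le> n + 1"
  shows "(1 / twist N i j) *s Z i j ^ N = U i j"
  using assms(2,3)
proof (induct j rule: less_induct)
  case (less j)
  have "(1 / twist N i j) *s Z i j ^ N
    = X i j ^ N - c *s (\<Sum>l\<in>{i<..<j}. ((1 / twist N i l) *s Z i l ^ N) * X l j ^ N)"
    by (rule Z_power_recursion)
      (use less assms odd_N q_N q_order qq_nz X_power_trivial in auto)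
  also have "\<dots> = V i j - c *s (\<Sum>l\<in>{i<..<j}. U i l * V l j)"
    using less assms by (simp add: X_power_eq)
  also have "\<dots> = U i j"
    unfolding U_def V_def
    by (rule group_matrix_recursion[symmetric])
      (use less assms c_nz gam_mult in \<open>auto simp: e_def gam_def groot_refl\<close>)
  finally show ?case .
qed

theorem Z_power:
  assumes "1 \<le> a" "a < b" "b \<le> n + 1"
  shows "Z (tilde D b) (tilde D a) ^ N =
    (\<Sum>cs\<in>chains a b. ((q - 1) ^ (N * (length cs - 2)) * mu_chain \<mu>' cs) *s
      (e - h (groot D' (cs ! (length cs - 2)) (cs ! (length cs - 1)) [^]\<^bsub>dgrp D\<^esub> N)))"
proof -
  define i where "i = tilde D b"
  define j where "j = tilde D a"
  have ij: "1 \<le> i" "i < j" "j \<le> n + 1" "a = tilde D j" "b = tilde D i"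
    using assms by (auto simp: i_def j_def tilde_def)
  define f where "f a b = e - h (groot D' a b [^]\<^bsub>dgrp D\<^esub> N)" for a b
  have f: "f (tilde D l) (tilde D i) = e - gam i l" if "i \<le> l" "l \<le> j" for l
    using that ij by (simp add: f_def gam_def groot')
  define s where "s = (-1) ^ (j - i + 1) * tau D i j"
  have "(\<Sum>cs\<in>chains a b. ((q - 1) ^ (N * (length cs - 2)) * mu_chain \<mu>' cs) *s
      f (cs ! (length cs - 2)) (cs ! (length cs - 1)))
    = \<mu>' a b *s f a b + (\<Sum>l\<in>{a<..<b}. (c * S' a l * \<mu>' l b) *s f l b)"
    using sum_chains_last[of a b c \<mu>' f] assms by (simp add: power_mult)
  also have "\<mu>' a b = s * S i j"
    using mu'_eq[of i j] ij by (simp add: s_def)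
  also have "f a b = e - gam i j"
    using f[of j] ij by simp
  also have "(\<Sum>l\<in>{a<..<b}. (c * S' a l * \<mu>' l b) *s f l b)
    = (\<Sum>l\<in>{i<..<j}. (c * S' a (tilde D l) * \<mu>' (tilde D l) b) *s f (tilde D l) b)"
    unfolding ij(4,5) unfolding tilde_def by (rule sum_reflect_interval) (use ij in auto)
  also have "\<dots> = (\<Sum>l\<in>{i<..<j}. - s *s ((c * S i l * \<mu> l j) *s (e - gam i l)))"
  proof (rule sum.cong[OF refl])
    fix l assume l: "l \<in> {i<..<j}"
    then have "S' a (tilde D l) * \<mu>' (tilde D l) b = - (s * (S i l * \<mu> l j))"
      unfolding ij(4,5) s_def using ij by (intro mu'_product S'_eq) auto
    then have "c * S' a (tilde D l) * \<mu>' (tilde D l) b = - s * (c * S i l * \<mu> l j)"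
      by (simp only: mult.assoc) (simp add: mult.left_commute)
    moreover have "f (tilde D l) b = e - gam i l"
      using f[of l] l ij by simp
    ultimately show "(c * S' a (tilde D l) * \<mu>' (tilde D l) b) *s f (tilde D l) b
        = - s *s ((c * S i l * \<mu> l j) *s (e - gam i l))"
      by (simp only: sc_sc)
  qed
  also have "(s * S i j) *s (e - gam i j) + \<dots> = s *s U i j"
    by (simp add: U_def scale_right_diff_distrib scale_sum_right sum_negf sum_subtractf)
  \<comment> \<open>The factor of \<open>tau\<close> at \<open>l = i\<close> is an empty product,
    and \<open>j - i + 1\<close> and \<open>j - i - 1\<close> have the same parity.\<close>
  also have "s = twist N i j"
  proof -
    have "tau D i j = (\<Prod>l\<in>{i<..<j}. \<Prod>k\<in>{i..<l}. qq D l k ^ N)"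
      unfolding tau_eq using ij(2) by (simp add: prod.atLeast_Suc_lessThan atLeastSucLessThan_greaterThanLessThan)
    moreover have "j - i + 1 = Suc (Suc (j - i - 1))" using ij(2) by simp
    ultimately show ?thesis by (simp add: s_def twist_def)
  qed
  also have "twist N i j *s U i j = Z i j ^ N"
    using twist_nz[of N i j] ij odd_N q_N q_order qq_nz X_power_trivial
    by (simp add: Z_power_eq[OF ij(1-3), symmetric])
  finally show ?thesis by (simp add: f_def i_def j_def)
qed

end

section \<open>Computing modulo an ideal of the free algebra\<close>

text \<open>The underlying space is nonzero, so its endomorphisms satisfy
  \<open>0 \<noteq> 1\<close> whatever ideal is divided out, even if the quotient is zero.\<close>

typedef (overloaded) ('x, 'k) lin_end =
  "{f :: ('x \<Rightarrow>\<^sub>0 'k::field) \<Rightarrow> ('x \<Rightarrow>\<^sub>0 'k). Vector_Spaces.linear scal scal f}"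
  by (rule exI[of _ id]) (simp add: lincomb.linear_id)

setup_lifting type_definition_lin_end

instantiation lin_end :: (type, field) ring_1
begin

lift_definition zero_lin_end :: "('a, 'b) lin_end" is "\<lambda>_. 0"
  by (unfold_locales) auto

lift_definition one_lin_end :: "('a, 'b) lin_end" is "\<lambda>p. p"
  by (unfold_locales) auto

lift_definition plus_lin_end :: "('a, 'b) lin_end \<Rightarrow> ('a, 'b) lin_end \<Rightarrow> ('a, 'b) lin_end" is "\<lambda>f g p. f p + g p"
  by (simp add: Vector_Spaces.linear_iff lincomb.scale_right_distrib)

lift_definition minus_lin_end :: "('a, 'b) lin_end \<Rightarrow> ('a, 'b) lin_end \<Rightarrow> ('a, 'b) lin_end" is "\<lambda>f g p. f p - g p"
  by (simp add: Vector_Spaces.linear_iff lincomb.scale_right_diff_distrib)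

lift_definition uminus_lin_end :: "('a, 'b) lin_end \<Rightarrow> ('a, 'b) lin_end" is "\<lambda>f p. - f p"
  by (simp add: Vector_Spaces.linear_iff)

lift_definition times_lin_end :: "('a, 'b) lin_end \<Rightarrow> ('a, 'b) lin_end \<Rightarrow> ('a, 'b) lin_end" is "\<lambda>f g p. f (g p)"
  by (simp add: Vector_Spaces.linear_iff)

instance
proof
  fix a b c :: "('a, 'b) lin_end"
  show "a + b + c = a + (b + c)" by transfer (simp add: add.assoc)
  show "a + b = b + a" by transfer (simp add: add.commute)
  show "0 + a = a" by transfer simp
  show "- a + a = 0" by transfer simp
  show "a - b = a + - b" by transfer simp
  show "a * b * c = a * (b * c)" by transfer simp
  show "1 * a = a" by transfer simp
  show "a * 1 = a" by transfer simp
  show "(a + b) * c = a * c + b * c" by transfer simp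
  show "a * (b + c) = a * b + a * c" by transfer (simp add: Vector_Spaces.linear_iff)
  show "(0 :: ('a, 'b) lin_end) \<noteq> 1"
    by transfer (metis lookup_single_eq lookup_zero zero_neq_one)
qed

end

lift_definition scal_end :: "'k::field \<Rightarrow> ('x, 'k) lin_end \<Rightarrow> ('x, 'k) lin_end" is "\<lambda>c f p. scal c (f p)"
  by (simp add: Vector_Spaces.linear_iff lincomb.scale_right_distrib mult.commute)

global_interpretation lin_end: k_algebra scal_end
proof
  fix c d :: "'k::field" and x y :: "('x, 'k) lin_end"
  show "scal_end c (x + y) = scal_end c x + scal_end c y"
    by transfer (simp add: lincomb.scale_right_distrib)
  show "scal_end (c + d) x = scal_end c x + scal_end d x"
    by transfer (simp add: lincomb.scale_left_distrib)
  show "scal_end c (scal_end d x) = scal_end (c * d) x" by transfer simp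
  show "scal_end 1 x = x" by transfer simp
  show "scal_end c x * y = scal_end c (x * y)" by transfer simp
  show "x * scal_end c y = scal_end c (x * y)" by transfer (simp add: Vector_Spaces.linear_iff)
qed

lemma poly_mapping_single_induct [case_names zero single plus]:
  assumes "P 0" "\<And>w c. P (Poly_Mapping.single w c)" "\<And>p q. P p \<Longrightarrow> P q \<Longrightarrow> P (p + q)"
  shows "P p"
proof (induct p rule: Poly_Mapping.update_induct)
  case const
  then show ?case by (rule assms(1))
next
  case (update p k v)
  then have "Poly_Mapping.update k v p = p + Poly_Mapping.single k v"
    by (intro poly_mapping_eqI) (auto simp: lookup_update lookup_add lookup_single when_def in_keys_iff)
  then show ?case using update assms(2,3) by simp
qed

lemma poly_mapping_eq_sum_single: "p = (\<Sum>w\<in>Poly_Mapping.keys p. Poly_Mapping.single w (Poly_Mapping.lookup p w))"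
  by (rule poly_mapping_eqI) (auto simp: lookup_sum lookup_single when_def in_keys_iff)

lemma scal_single [simp]: "scal c (Poly_Mapping.single w d) = Poly_Mapping.single w (c * d)"
  by (rule poly_mapping_eqI) (simp add: lookup_single when_def)

lemma single_eq_scal: "Poly_Mapping.single w c = scal c (Poly_Mapping.single w 1)"
  by simp

lemma scal_mult:
  fixes p q :: "'x list \<Rightarrow>\<^sub>0 'k::field"
  shows scal_mult_left: "scal c p * q = scal c (p * q)" and scal_mult_right: "p * scal c q = scal c (p * q)"
proof -
  have s: "scal c r = Poly_Mapping.single 0 c * r" for r :: "'x list \<Rightarrow>\<^sub>0 'k"
    by (simp add: scal_def mult_map_scale_conv_mult)
  have "p * Poly_Mapping.single 0 c = Poly_Mapping.single 0 c * p"
    by (induct p rule: poly_mapping_single_induct) (simp_all add: mult_single distrib_left distrib_right mult.commute)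
  then show "scal c p * q = scal c (p * q)" "p * scal c q = scal c (p * q)"
    unfolding s by (simp_all add: mult.assoc[symmetric])
qed

definition lin_ext :: "('x \<Rightarrow> ('y \<Rightarrow>\<^sub>0 'k::field)) \<Rightarrow> ('x \<Rightarrow>\<^sub>0 'k) \<Rightarrow> ('y \<Rightarrow>\<^sub>0 'k)" where
  "lin_ext g p = (\<Sum>w\<in>Poly_Mapping.keys p. scal (Poly_Mapping.lookup p w) (g w))"

lemma lin_ext_superset:
  assumes "finite A" "Poly_Mapping.keys p \<subseteq> A"
  shows "lin_ext g p = (\<Sum>w\<in>A. scal (Poly_Mapping.lookup p w) (g w))"
  unfolding lin_ext_def
  by (rule sum.mono_neutral_left) (use assms in \<open>auto simp: in_keys_iff\<close>)

lemma lin_ext_single [simp]: "lin_ext g (Poly_Mapping.single w c) = scal c (g w)"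
  by (simp add: lin_ext_superset[of "{w}"])

lemma lin_ext_linear: "Vector_Spaces.linear scal scal (lin_ext g)"
proof -
  have "lin_ext g (p + q) = lin_ext g p + lin_ext g q" for p q
  proof -
    have "Poly_Mapping.keys (p + q) \<subseteq> Poly_Mapping.keys p \<union> Poly_Mapping.keys q"
      by (rule keys_add)
    then show ?thesis
      by (simp add: lin_ext_superset[of "Poly_Mapping.keys p \<union> Poly_Mapping.keys q"]
          lookup_add lincomb.scale_left_distrib sum.distrib)
  qed
  moreover have "lin_ext g (scal c p) = scal c (lin_ext g p)" for c p
  proof -
    have "Poly_Mapping.keys (scal c p) \<subseteq> Poly_Mapping.keys p"
      by (auto simp: in_keys_iff)
    then show ?thesis
      by (simp add: lin_ext_superset[of "Poly_Mapping.keys p"] lincomb.scale_sum_right)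
  qed
  ultimately show ?thesis
    by (simp add: Vector_Spaces.linear_iff lincomb.vector_space_axioms)
qed

lemma linear_simps:
  assumes "Vector_Spaces.linear (scal :: 'k::field \<Rightarrow> _) (scal :: 'k \<Rightarrow> _) f"
  shows "f (p + q) = f p + f q" "f (p - q) = f p - f q" "f (- p) = - f p" "f 0 = 0"
    "f (scal c p) = scal c (f p)" "f (sum g A) = (\<Sum>x\<in>A. f (g x))"
proof -
  interpret Vector_Spaces.linear scal scal f by (rule assms)
  show "f (p + q) = f p + f q" "f (p - q) = f p - f q" "f (- p) = - f p" "f 0 = 0"
    "f (scal c p) = scal c (f p)" "f (sum g A) = (\<Sum>x\<in>A. f (g x))"
    by (fact add diff neg zero scale sum)+
qed

lemmas lin_ext_simps = linear_simps[OF lin_ext_linear]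

text \<open>
  An ideal \<open>J\<close> is the kernel of the (non-unital) representation \<open>a \<mapsto> (b \<mapsto> \<pi>(a b))\<close>, where \<open>\<pi>\<close> is a linear
  projection along \<open>J\<close>. This allows computing modulo \<open>J\<close> in a type of class \<^class>\<open>ring_1\<close>.
\<close>

lemma ideal_representation:
  fixes J :: "('x list \<Rightarrow>\<^sub>0 'k::field) set"
  assumes J: "lincomb.subspace J" "\<And>a b. a \<in> J \<Longrightarrow> b * a \<in> J" "\<And>a b. a \<in> J \<Longrightarrow> a * b \<in> J"
  shows "\<exists>L :: ('x list \<Rightarrow>\<^sub>0 'k) \<Rightarrow> ('x list, 'k) lin_end.
    (\<forall>a b. L (a + b) = L a + L b) \<and> (\<forall>a b. L (a - b) = L a - L b) \<and> (\<forall>c a. L (scal c a) = scal_end c (L a)) \<and>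
    (\<forall>a b. L (a * b) = L a * L b) \<and> (\<forall>a. L a = 0 \<longleftrightarrow> a \<in> J)"
proof -
  interpret vector_space_pair "scal :: 'k \<Rightarrow> ('x list \<Rightarrow>\<^sub>0 'k) \<Rightarrow> _" "scal :: 'k \<Rightarrow> ('x list \<Rightarrow>\<^sub>0 'k) \<Rightarrow> _"
    by unfold_locales
  obtain g where g: "g ` UNIV \<subseteq> J" "Vector_Spaces.linear scal scal g" "\<forall>v\<in>J. g v = v"
    using linear_exists_left_inverse_on[OF lincomb.linear_id J(1)] by auto
  define \<pi> where "\<pi> p = p - g p" for p
  have lin: "Vector_Spaces.linear scal scal \<pi>"
    unfolding \<pi>_def using g(2) by (simp add: Vector_Spaces.linear_iff lincomb.scale_right_diff_distrib)
  have ker: "\<pi> p = 0 \<longleftrightarrow> p \<in> J" for p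
    using g(1,3) by (auto simp: \<pi>_def)
  note \<pi>_simps = linear_simps[OF lin]
  \<comment> \<open>This is multiplicativity of \<open>L\<close>: replacing \<open>b\<close> by
    \<open>\<pi> b\<close> changes \<open>a * b\<close> by an element of \<open>J\<close>.\<close>
  have \<pi>_mult: "\<pi> (a * \<pi> b) = \<pi> (a * b)" for a b
  proof -
    have "b - \<pi> b \<in> J" using g(1) by (auto simp: \<pi>_def)
    then have "\<pi> (a * (b - \<pi> b)) = 0" using J(2) ker by blast
    then show ?thesis by (simp add: right_diff_distrib \<pi>_simps)
  qed
  have linL: "Vector_Spaces.linear scal scal (\<lambda>b. \<pi> (a * b))" for a
    by (simp add: Vector_Spaces.linear_iff lincomb.vector_space_axioms \<pi>_simps distrib_left scal_mult_right)
  define L where "L a = Abs_lin_end (\<lambda>b. \<pi> (a * b))" for a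
  have Rep_L: "Rep_lin_end (L a) = (\<lambda>b. \<pi> (a * b))" for a
    unfolding L_def by (rule Abs_lin_end_inverse) (simp add: linL)
  show ?thesis
  proof (intro exI[of _ L] conjI allI)
    fix a b c
    show "L (a + b) = L a + L b" "L (a - b) = L a - L b" "L (scal c a) = scal_end c (L a)" "L (a * b) = L a * L b"
      by (simp_all add: Rep_lin_end_inject[symmetric] Rep_L plus_lin_end.rep_eq minus_lin_end.rep_eq
          scal_end.rep_eq times_lin_end.rep_eq fun_eq_iff distrib_right left_diff_distrib \<pi>_simps scal_mult_left
          \<pi>_mult mult.assoc)
    show "L a = 0 \<longleftrightarrow> a \<in> J"
    proof
      assume "L a = 0"
      then have "\<pi> (a * 1) = 0"
        by (metis Rep_L zero_lin_end.rep_eq)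
      then show "a \<in> J" by (simp add: ker)
    next
      assume "a \<in> J"
      then show "L a = 0"
        by (simp add: Rep_lin_end_inject[symmetric] Rep_L zero_lin_end.rep_eq fun_eq_iff ker J(3))
    qed
  qed
qed

section \<open>Free algebras on a set of letters\<close>

lemma free_alg_simps [simp]:
  "mult (free_alg L) = (*)" "one (free_alg L) = 1" "zero (free_alg L) = 0" "add (free_alg L) = (+)"
  "module.smult (free_alg L) = scal"
  by (simp_all add: free_alg_def)

lemma free_alg_carrier: "p \<in> carrier (free_alg L) \<longleftrightarrow> (\<forall>w\<in>Poly_Mapping.keys p. set w \<subseteq> L)"
  by (simp add: free_alg_def)

lemma single_closed [simp]: "set w \<subseteq> L \<Longrightarrow> Poly_Mapping.single w c \<in> carrier (free_alg L)"
  by (simp add: free_alg_carrier)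

lemma letter_closed [simp]: "x \<in> L \<Longrightarrow> letter x \<in> carrier (free_alg L)"
  by (simp add: letter_def)

text \<open>Killing the words with a letter outside \<open>L\<close> is multiplicative on the whole
  type, and membership in the carrier becomes a fixed-point equation.\<close>

definition restrict_words :: "'x set \<Rightarrow> ('x list \<Rightarrow>\<^sub>0 'k::field) \<Rightarrow> ('x list \<Rightarrow>\<^sub>0 'k)" where
  "restrict_words L = lin_ext (\<lambda>w. if set w \<subseteq> L then Poly_Mapping.single w 1 else 0)"

lemmas restrict_words_simps [simp] = lin_ext_simps[where g = "\<lambda>w. if set w \<subseteq> L then Poly_Mapping.single w 1 else 0" for L, folded restrict_words_def]

lemma restrict_words_single [simp]:
  "restrict_words L (Poly_Mapping.single w c) = (if set w \<subseteq> L then Poly_Mapping.single w c else 0)"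
  by (simp add: restrict_words_def)

lemma list_plus [simp]: "(w :: 'x list) + v = w @ v" "(0 :: 'x list) = []"
  by (simp_all add: plus_list_def zero_list_def)

lemma restrict_words_mult: "restrict_words L (p * q) = restrict_words L p * restrict_words L q"
proof (induct p rule: poly_mapping_single_induct)
  case (single w c)
  show ?case
    by (induct q rule: poly_mapping_single_induct) (auto simp: mult_single distrib_left)
qed (simp_all add: distrib_right)

lemma restrict_words_closed: "restrict_words L p \<in> carrier (free_alg L)"
  by (auto simp: free_alg_carrier restrict_words_def lin_ext_def dest!: subsetD[OF keys_sum] split: if_splits)

lemma restrict_words_id: "p \<in> carrier (free_alg L) \<Longrightarrow> restrict_words L p = p"
  unfolding restrict_words_def lin_ext_def free_alg_carrier
  by (subst (3) poly_mapping_eq_sum_single) (rule sum.cong, auto)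

lemma free_alg_closedI: "restrict_words L p = p \<Longrightarrow> p \<in> carrier (free_alg L)"
  using restrict_words_closed[of L p] by simp

lemma free_alg_closed:
  assumes "p \<in> carrier (free_alg L)" "q \<in> carrier (free_alg L)"
  shows "p + q \<in> carrier (free_alg L)" "p - q \<in> carrier (free_alg L)" "p * q \<in> carrier (free_alg L)"
  using assms by (auto intro!: free_alg_closedI simp: restrict_words_mult restrict_words_id)

lemma free_alg_closed_unary:
  assumes "p \<in> carrier (free_alg L)"
  shows "- p \<in> carrier (free_alg L)" "scal c p \<in> carrier (free_alg L)"
  using assms by (auto intro!: free_alg_closedI simp: restrict_words_id)

lemma zero_one_closed [simp]: "0 \<in> carrier (free_alg L)" "1 \<in> carrier (free_alg L)"
  by (simp_all add: free_alg_carrier)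

lemma sum_closed: "(\<And>a. a \<in> A \<Longrightarrow> f a \<in> carrier (free_alg L)) \<Longrightarrow> sum f A \<in> carrier (free_alg L)"
  by (induct A rule: infinite_finite_induct) (auto intro: free_alg_closed)

lemma power_closed: "p \<in> carrier (free_alg L) \<Longrightarrow> p ^ n \<in> carrier (free_alg L)"
  by (induct n) (auto intro: free_alg_closed)

lemma free_alg_ring: "ring (free_alg L)"
proof (rule ringI)
  show "abelian_group (free_alg L)"
  proof (rule abelian_groupI)
    fix p assume "p \<in> carrier (free_alg L)"
    then show "\<exists>q\<in>carrier (free_alg L). q \<oplus>\<^bsub>free_alg L\<^esub> p = \<zero>\<^bsub>free_alg L\<^esub>"
      by (intro bexI[of _ "- p"]) (auto intro: free_alg_closed_unary)
  qed (auto intro: free_alg_closed simp: algebra_simps)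
  show "monoid (free_alg L)"
    by (rule monoidI) (auto intro: free_alg_closed simp: mult.assoc)
qed (auto simp: algebra_simps)

lemma free_alg_a_inv: "p \<in> carrier (free_alg L) \<Longrightarrow> \<ominus>\<^bsub>free_alg L\<^esub> p = - p"
proof -
  interpret ring "free_alg L" by (rule free_alg_ring)
  assume "p \<in> carrier (free_alg L)"
  then show ?thesis by (intro minus_equality) (auto intro: free_alg_closed_unary)
qed

lemma single_Nil: "Poly_Mapping.single [] 1 = 1"
  by (metis list_plus(2) single_one)

lemma scal_eq_mult: "scal c p = Poly_Mapping.single [] c * p" for p :: "'x list \<Rightarrow>\<^sub>0 'k::field"
proof -
  have "scal c 1 = (Poly_Mapping.single [] c :: 'x list \<Rightarrow>\<^sub>0 'k)"
    by (simp add: single_Nil[symmetric])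
  then show ?thesis using scal_mult_left[of c 1 p] by simp
qed

lemma ideal_free_algD:
  assumes "ideal I (free_alg L)"
  shows "I \<subseteq> carrier (free_alg L)" "0 \<in> I" "p \<in> I \<Longrightarrow> q \<in> I \<Longrightarrow> p + q \<in> I"
    "p \<in> I \<Longrightarrow> scal c p \<in> I" "p \<in> I \<Longrightarrow> - p \<in> I"
    "p \<in> I \<Longrightarrow> q \<in> carrier (free_alg L) \<Longrightarrow> q * p \<in> I" "p \<in> I \<Longrightarrow> q \<in> carrier (free_alg L) \<Longrightarrow> p * q \<in> I"
proof -
  interpret ideal I "free_alg L" by (rule assms)
  show sub: "I \<subseteq> carrier (free_alg L)" by (rule a_subset)
  have add: "additive_subgroup I (free_alg L)" by (rule is_additive_subgroup)
  show "0 \<in> I" "p \<in> I \<Longrightarrow> q \<in> I \<Longrightarrow> p + q \<in> I"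
    using additive_subgroup.zero_closed[OF add] additive_subgroup.a_closed[OF add, of p q] by simp_all
  show mult: "p \<in> I \<Longrightarrow> q \<in> carrier (free_alg L) \<Longrightarrow> q * p \<in> I" "p \<in> I \<Longrightarrow> q \<in> carrier (free_alg L) \<Longrightarrow> p * q \<in> I" for p q
    using I_l_closed I_r_closed by simp_all
  show scal: "p \<in> I \<Longrightarrow> scal c p \<in> I" for c
    unfolding scal_eq_mult[of c] by (rule mult) simp_all
  show "p \<in> I \<Longrightarrow> - p \<in> I" using scal[of "- 1"] by simp
qed

lemma ideal_free_algI:
  assumes "I \<subseteq> carrier (free_alg L)" "0 \<in> I" "\<And>p q. p \<in> I \<Longrightarrow> q \<in> I \<Longrightarrow> p + q \<in> I"
    "\<And>p. p \<in> I \<Longrightarrow> - p \<in> I"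
    "\<And>p q. p \<in> I \<Longrightarrow> q \<in> carrier (free_alg L) \<Longrightarrow> q * p \<in> I" "\<And>p q. p \<in> I \<Longrightarrow> q \<in> carrier (free_alg L) \<Longrightarrow> p * q \<in> I"
  shows "ideal I (free_alg L)"
proof -
  interpret ring "free_alg L" by (rule free_alg_ring)
  show ?thesis
  proof (rule idealI)
    show "subgroup I (add_monoid (free_alg L))"
    proof (rule group.subgroupI)
      show "Group.group (add_monoid (free_alg L))" by (rule a_group)
      fix p assume "p \<in> I"
      then show "inv\<^bsub>add_monoid (free_alg L)\<^esub> p \<in> I"
        using assms free_alg_a_inv[of p L] by (auto simp: a_inv_def)
    qed (use assms in auto)
  qed (use assms free_alg_ring in auto)
qed

text \<open>\<open>I\<close> is an ideal only among words in \<open>A\<close>. Its preimage under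
  \<open>restrict_words\<close> is an ideal for all words and meets the carrier exactly in
  \<open>I\<close>.\<close>

lemma ideal_free_alg_representation:
  fixes I :: "('x list \<Rightarrow>\<^sub>0 'k::field) set"
  assumes "ideal I (free_alg A)"
  shows "\<exists>L :: ('x list \<Rightarrow>\<^sub>0 'k) \<Rightarrow> ('x list, 'k) lin_end.
    (\<forall>a b. L (a + b) = L a + L b) \<and> (\<forall>a b. L (a - b) = L a - L b) \<and> (\<forall>c a. L (scal c a) = scal_end c (L a)) \<and>
    (\<forall>a b. L (a * b) = L a * L b) \<and> (\<forall>a\<in>carrier (free_alg A). L a = 0 \<longleftrightarrow> a \<in> I)"
proof -
  note I = ideal_free_algD[OF assms]
  define J where "J = {p. restrict_words A p \<in> I}"
  have J1: "lincomb.subspace J"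
    by (auto simp: J_def lincomb.subspace_def intro: I)
  have J2: "a \<in> J \<Longrightarrow> b * a \<in> J" and J3: "a \<in> J \<Longrightarrow> a * b \<in> J" for a b
    using I(6,7) restrict_words_closed[of A b] by (auto simp: J_def restrict_words_mult)
  show ?thesis
    using ideal_representation[OF J1 J2 J3] by (rule ex_forward) (auto simp: J_def restrict_words_id)
qed

section \<open>The reflection on the free algebra\<close>

text \<open>Indices out of range stay fixed, so that this is an involution of the whole type of
  letters.\<close>

definition flip_gen :: "nat \<Rightarrow> 'g gen \<Rightarrow> 'g gen" where
  "flip_gen n l = (case l of Grp a \<Rightarrow> Grp a | X i \<Rightarrow> X (if i \<in> {1..n} then n + 1 - i else i))"

lemma flip_gen_simps [simp]: "flip_gen n (Grp a) = Grp a" "i \<in> {1..n} \<Longrightarrow> flip_gen n (X i) = X (n + 1 - i)"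
  "flip_gen n (flip_gen n l) = l"
  by (auto simp: flip_gen_def split: gen.splits)

definition flip :: "nat \<Rightarrow> ('g gen list \<Rightarrow>\<^sub>0 'k::field) \<Rightarrow> ('g gen list \<Rightarrow>\<^sub>0 'k)" where
  "flip n = lin_ext (\<lambda>w. Poly_Mapping.single (map (flip_gen n) w) 1)"

lemmas flip_linear = lin_ext_linear[where g = "\<lambda>w. Poly_Mapping.single (map (flip_gen n) w) 1" for n, folded flip_def]

lemmas flip_simps [simp] = linear_simps[OF flip_linear]

lemma flip_single [simp]: "flip n (Poly_Mapping.single w c) = Poly_Mapping.single (map (flip_gen n) w) c"
  by (simp add: flip_def)

lemma flip_flip [simp]: "flip n (flip n p) = p"
  by (induct p rule: poly_mapping_single_induct) (simp_all add: comp_def)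

lemma flip_mult [simp]: "flip n (p * q) = flip n p * flip n q"
proof (induct p rule: poly_mapping_single_induct)
  case (single w c)
  show ?case
    by (induct q rule: poly_mapping_single_induct) (auto simp: mult_single distrib_left)
qed (simp_all add: distrib_right)

lemma flip_one [simp]: "flip n 1 = 1"
  by (simp add: single_one[symmetric] del: single_one)

lemma flip_power [simp]: "flip n (p ^ m) = flip n p ^ m"
  by (induct m) simp_all

lemma flip_letter [simp]: "flip n (letter x) = letter (flip_gen n x)"
  by (simp add: letter_def)

lemma keys_flip:
  fixes p :: "'g gen list \<Rightarrow>\<^sub>0 'k::field"
  shows "Poly_Mapping.keys (flip n p) = map (flip_gen n) ` Poly_Mapping.keys p"
proof -
  have sub: "Poly_Mapping.keys (flip n p) \<subseteq> map (flip_gen n) ` Poly_Mapping.keys p" for p :: "'g gen list \<Rightarrow>\<^sub>0 'k"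
    by (auto simp: flip_def lin_ext_def dest!: subsetD[OF keys_sum] split: if_splits)
  have "Poly_Mapping.keys p = map (flip_gen n) ` map (flip_gen n) ` Poly_Mapping.keys p"
    by (simp add: image_image comp_def)
  moreover have "map (flip_gen n) ` Poly_Mapping.keys (flip n (flip n p)) \<subseteq> map (flip_gen n) ` map (flip_gen n) ` Poly_Mapping.keys (flip n p)"
    using sub[of "flip n p"] by blast
  ultimately show ?thesis
    using sub[of p] by (auto simp: image_image comp_def)
qed

lemma lookup_flip: "Poly_Mapping.lookup (flip n p) (map (flip_gen n) w) = Poly_Mapping.lookup p w"
proof (induct p rule: poly_mapping_single_induct)
  case (single v c)
  have "map (flip_gen n) v = map (flip_gen n) w \<longleftrightarrow> v = w"
    by (metis (mono_tags, lifting) flip_gen_simps(3) injI inj_map_eq_map)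
  then show ?case by (simp add: lookup_single when_def)
qed (simp_all add: lookup_add)

lemma flip_gen_gens: "l \<in> gens D \<Longrightarrow> flip_gen (dn D) l \<in> gens D"
proof -
  assume "l \<in> gens D"
  then consider a where "l = Grp a" "a \<in> carrier (dgrp D)" | i where "l = X i" "i \<in> {1..dn D}"
    by (auto simp: gens_def)
  then show ?thesis
  proof cases
    case (2 i)
    then have "dn D + 1 - i \<in> {1..dn D}" by auto
    then show ?thesis unfolding 2(1) flip_gen_simps(2)[OF 2(2)] by (auto simp: gens_def)
  qed (simp add: gens_def)
qed

lemma flip_closed: "p \<in> carrier (free_alg (gens D)) \<Longrightarrow> flip (dn D) p \<in> carrier (free_alg (gens D))"
  using flip_gen_gens[of _ D] by (fastforce simp: free_alg_carrier keys_flip)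

section \<open>The relations under reflection\<close>

lemma u_rels_mem:
  "letter (Grp \<one>\<^bsub>dgrp D\<^esub>) - 1 \<in> u_rels D \<mu>"
  "a \<in> carrier (dgrp D) \<Longrightarrow> b \<in> carrier (dgrp D) \<Longrightarrow>
    letter (Grp a) * letter (Grp b) - letter (Grp (a \<otimes>\<^bsub>dgrp D\<^esub> b)) \<in> u_rels D \<mu>"
  "a \<in> carrier (dgrp D) \<Longrightarrow> i \<in> {1..dn D} \<Longrightarrow>
    letter (Grp a) * letter (X i) * letter (Grp (inv\<^bsub>dgrp D\<^esub> a)) - scal (dchi D i a) (letter (X i)) \<in> u_rels D \<mu>"
  "i \<in> {1..dn D} \<Longrightarrow> j \<in> {1..dn D} \<Longrightarrow> i \<noteq> j \<Longrightarrow>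
    (ad_c D i ^^ nat (1 - cartan_A i j)) (letter (X j)) \<in> u_rels D \<mu>"
  "1 \<le> i \<Longrightarrow> i < j \<Longrightarrow> j \<le> dn D + 1 \<Longrightarrow> xroot D i j ^ dN D - uroot D \<mu> i j \<in> u_rels D \<mu>"
  unfolding u_rels_def by blast+

lemma ad_c_eq: "ad_c D i = lin_ext (\<lambda>w. letter (X i) * Poly_Mapping.single w 1
    - scal (braid_factor D i w) (Poly_Mapping.single w 1 * letter (X i)))"
  by (simp add: ad_c_def lin_ext_def fun_eq_iff)

lemmas ad_c_linear = linear_simps[OF lin_ext_linear, where g1 = "\<lambda>w. letter (X i) * Poly_Mapping.single w 1
    - scal (braid_factor D i w) (Poly_Mapping.single w 1 * letter (X i))" for D i, folded ad_c_eq]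

lemma ad_c_letter: "ad_c D i (letter (X j)) = letter (X i) * letter (X j) - scal (qq D i j) (letter (X j) * letter (X i))"
  by (simp add: ad_c_eq letter_def braid_factor_def)

lemma ad_c_letter2:
  "ad_c D i (letter (X j) * letter (X k)) = letter (X i) * (letter (X j) * letter (X k))
    - scal (qq D i j * qq D i k) (letter (X j) * letter (X k) * letter (X i))"
  by (simp add: ad_c_eq letter_def braid_factor_def mult_single)

lemma serre_rel_far:
  assumes "i \<noteq> j" "\<not> (i = Suc j \<or> j = Suc i)"
  shows "(ad_c D i ^^ nat (1 - cartan_A i j)) (letter (X j))
    = letter (X i) * letter (X j) - scal (qq D i j) (letter (X j) * letter (X i))"
  using assms by (auto simp: cartan_A_def ad_c_letter)

lemma serre_rel_near:
  assumes "i = Suc j \<or> j = Suc i"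
  shows "(ad_c D i ^^ nat (1 - cartan_A i j)) (letter (X j))
    = letter (X i) * (letter (X i) * letter (X j) - scal (qq D i j) (letter (X j) * letter (X i)))
      - scal (qq D i i * qq D i j) ((letter (X i) * letter (X j) - scal (qq D i j) (letter (X j) * letter (X i))) * letter (X i))"
proof -
  have "nat (1 - cartan_A i j) = Suc (Suc 0)"
    using assms by (auto simp: cartan_A_def)
  then have "(ad_c D i ^^ nat (1 - cartan_A i j)) (letter (X j)) = ad_c D i (ad_c D i (letter (X j)))"
    by simp
  then show ?thesis
    by (simp add: ad_c_letter ad_c_linear ad_c_letter2 algebra_simps scal_mult_left scal_mult_right
        lincomb.scale_right_diff_distrib)
qed

context reflected_data
begin

lemma flip_serre:
  assumes "i \<in> {1..n}" "j \<in> {1..n}" "i \<noteq> j"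
  shows "flip n ((ad_c D' i ^^ nat (1 - cartan_A i j)) (letter (X j)))
    = (ad_c D (n + 1 - i) ^^ nat (1 - cartan_A (n + 1 - i) (n + 1 - j))) (letter (X (n + 1 - j)))"
proof (cases "i = Suc j \<or> j = Suc i")
  case True
  then have "n + 1 - i = Suc (n + 1 - j) \<or> n + 1 - j = Suc (n + 1 - i)" using assms by auto
  then show ?thesis
    unfolding serre_rel_near[OF True] using assms by (simp add: serre_rel_near qq')
next
  case False
  then have "n + 1 - i \<noteq> n + 1 - j" "\<not> (n + 1 - i = Suc (n + 1 - j) \<or> n + 1 - j = Suc (n + 1 - i))"
    using assms by auto
  then show ?thesis
    unfolding serre_rel_far[OF assms(3) False] using assms by (simp add: serre_rel_far qq')
qed

lemma xroot_closed:
  assumes "1 \<le> i" "i < j" "j \<le> n + 1"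
  shows "xroot D i j \<in> carrier (free_alg (gens D))"
proof -
  have "1 \<le> i \<longrightarrow> xroot D i j \<in> carrier (free_alg (gens D))"
    using assms(2)
  proof (induct i rule: strict_inc_induct)
    case (base i)
    then show ?case using assms(3) by (subst xroot.simps) (auto simp: gens_def)
  next
    case (step i)
    then show ?case
      using assms(3) by (subst xroot.simps) (auto simp: gens_def intro!: free_alg_closed free_alg_closed_unary)
  qed
  then show ?thesis using assms by simp
qed

lemma uroot_closed:
  assumes "1 \<le> i" "j \<le> n + 1"
  shows "uroot D \<mu> i j \<in> carrier (free_alg (gens D))"
  unfolding uroot_def
proof (rule sum_closed, rule free_alg_closed_unary(2), rule free_alg_closed(2))
  fix cs assume cs: "cs \<in> chains i j"
  interpret comm_group "dgrp D" using datum by (simp add: cartan_datum_def)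
  have "sorted cs" "cs \<noteq> []" "hd cs = i" "last cs = j" "2 \<le> length cs"
    using cs by (auto simp: chains_def strict_sorted_imp_sorted)
  then have "i \<le> cs ! k" if "k < length cs" for k
    using that sorted_nth_mono[of cs 0 k] by (simp add: hd_conv_nth)
  moreover have "cs ! (length cs - 1) = j"
    using \<open>cs \<noteq> []\<close> \<open>last cs = j\<close> by (simp add: last_conv_nth)
  ultimately have "groot D (cs ! (length cs - 2)) (cs ! (length cs - 1)) \<in> carrier (dgrp D)"
    using assms \<open>2 \<le> length cs\<close> by (intro groot_closed) (auto intro: order_trans)
  then show "letter (Grp (groot D (cs ! (length cs - 2)) (cs ! (length cs - 1)) [^]\<^bsub>dgrp D\<^esub> N)) \<in> carrier (free_alg (gens D))"
    by (auto simp: gens_def)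
qed simp

lemma u_rels_closed: "u_rels D \<mu> \<subseteq> carrier (free_alg (gens D))"
proof -
  interpret comm_group "dgrp D" using datum by (simp add: cartan_datum_def)
  have G: "a \<in> carrier (dgrp D) \<Longrightarrow> letter (Grp a) \<in> carrier (free_alg (gens D))"
    and X: "i \<in> {1..n} \<Longrightarrow> letter (X i) \<in> carrier (free_alg (gens D))" for a i
    by (auto simp: gens_def)
  have S: "(ad_c D i ^^ nat (1 - cartan_A i j)) (letter (X j)) \<in> carrier (free_alg (gens D))"
    if "i \<in> {1..n}" "j \<in> {1..n}" "i \<noteq> j" for i j
  proof (cases "i = Suc j \<or> j = Suc i")
    case True
    show ?thesis unfolding serre_rel_near[OF True] by (intro free_alg_closed free_alg_closed_unary X that)
  next
    case False
    show ?thesis unfolding serre_rel_far[OF that(3) False] by (intro free_alg_closed free_alg_closed_unary X that)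
  qed
  show ?thesis
    unfolding u_rels_def Un_subset_iff
    by (intro conjI) (auto intro!: free_alg_closed free_alg_closed_unary G X S power_closed xroot_closed uroot_closed)
qed

lemma u_ideal: "ideal (u_ideal D \<mu>) (free_alg (gens D))" "u_rels D \<mu> \<subseteq> u_ideal D \<mu>"
  unfolding u_ideal_def
  using ring.genideal_ideal[OF free_alg_ring u_rels_closed] ring.genideal_self[OF free_alg_ring u_rels_closed] .

lemma flip_uroot: "flip m (uroot D \<mu> i j) = uroot D \<mu> i j"
  by (simp add: uroot_def)

lemma gens': "gens D' = gens D"
  by (simp add: gens_def)

end

lemma reflected_data_sym: "reflected_data D \<mu> D' \<mu>' \<Longrightarrow> reflected_data D' \<mu>' D \<mu>"
  unfolding reflected_data_def[of D']
  using reflected_data.cartan_datum' reflected_data.R2' reflected_data.reflects_sym by blast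

context reflected_data
begin

text \<open>The other relations are carried to relations of the same kind; this one needs the power
  formula. It is checked under \<open>L\<close>, where vanishing of an element of the carrier means
  membership in the ideal.\<close>

lemma root_relation:
  assumes "1 \<le> a" "a < b" "b \<le> n + 1"
  shows "flip n (xroot D' a b ^ N - uroot D' \<mu>' a b) \<in> u_ideal D \<mu>"
proof -
  have R: "reflected_data D' \<mu>' D \<mu>"
    by (rule reflected_data_sym) (rule reflected_data_axioms)
  obtain L :: "('g gen list \<Rightarrow>\<^sub>0 'k) \<Rightarrow> ('g gen list, 'k) lin_end"
    where L': "\<forall>a b. L (a + b) = L a + L b" "\<forall>a b. L (a - b) = L a - L b" "\<forall>c a. L (scal c a) = scal_end c (L a)"
    "\<forall>a b. L (a * b) = L a * L b" and
    L0: "\<forall>a\<in>carrier (free_alg (gens D)). L a = 0 \<longleftrightarrow> a \<in> u_ideal D \<mu>"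
    using ideal_free_alg_representation[OF u_ideal(1)] by (elim exE conjE)
  note L = L'[rule_format]
  have L_zero: "L 0 = 0" using L(3)[of 0 0] by simp
  have L_sum: "L (sum f A) = (\<Sum>x\<in>A. L (f x))" for f and A :: "nat list set"
    by (induct A rule: infinite_finite_induct) (simp_all add: L L_zero)
  \<comment> \<open>Positivity of \<open>m\<close> matters because \<open>L 1\<close> need not be
    1.\<close>
  have L_power: "L (p ^ m) = L p ^ m" if "0 < m" for p m
    using that
  proof (induct m rule: nat_induct_non_zero)
    case (Suc m) then show ?case by (simp add: L)
  qed simp
  have rel: "L p = 0" if "p \<in> u_rels D \<mu>" for p
    using L0[rule_format, OF subsetD[OF u_rels_closed that]] subsetD[OF u_ideal(2) that] by simp
  define x where "x i = L (letter (X i))" for i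
  define h where "h g = L (letter (Grp g))" for g
  have h_one: "L 1 = h \<one>\<^bsub>dgrp D\<^esub>"
    using rel[OF u_rels_mem(1)] by (simp add: h_def L)
  have L_uroot: "L (uroot D0 \<nu> i j) = (\<Sum>cs\<in>chains i j. scal_end ((dq D0 - 1) ^ (dN D0 * (length cs - 2)) * mu_chain \<nu> cs)
        (h \<one>\<^bsub>dgrp D\<^esub> - h (groot D0 (cs ! (length cs - 2)) (cs ! (length cs - 1)) [^]\<^bsub>dgrp D0\<^esub> dN D0)))"
    for D0 :: "('g, 'k) datum" and \<nu> i j
    by (simp add: uroot_def L_sum L h_one h_def)
  have serre: "L ((ad_c D i ^^ nat (1 - cartan_A i j)) (letter (X j))) = 0" if "i \<in> {1..n}" "j \<in> {1..n}" "i \<noteq> j" for i j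
    by (rule rel[OF u_rels_mem(4)[OF that]])
  have N0: "0 < N" using N_gt by simp
  \<comment> \<open>As \<open>tilde\<close> reverses the order, the first letter of a reflected root
    becomes, after \<open>flip\<close>, the last letter of the root \<open>(i, j)\<close>. So the
    recursion for \<open>xroot D'\<close> turns into the one for \<open>Z\<close>.\<close>
  interpret root_vector_rep scal_end D \<mu> D' \<mu>' x "\<lambda>i j. L (xroot D i j)"
    "\<lambda>i j. L (flip n (xroot D' (tilde D j) (tilde D i)))" h
  proof
    fix i j
    show "1 + q \<noteq> 0" by (rule q_plus_one)
    show "h a * h b = h (a \<otimes>\<^bsub>dgrp D\<^esub> b)" if "a \<in> carrier (dgrp D)" "b \<in> carrier (dgrp D)" for a b
      using rel[OF u_rels_mem(2)[OF that]] by (simp add: h_def L)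
    show "x i * x j = scal_end (qq D i j) (x j * x i)" if "i \<in> {1..n}" "j \<in> {1..n}" "Suc i < j \<or> Suc j < i"
      using serre[OF that(1,2)] that(3) serre_rel_far[of i j D] by (auto simp: L x_def)
    show "qq D i j * qq D j i = 1" if "i \<in> {1..n}" "j \<in> {1..n}" "Suc i < j \<or> Suc j < i"
      using that by (rule qq_far)
    show "lin_end.serre q (qq D i (Suc i)) (qq D (Suc i) i) (x i) (x (Suc i))" if "1 \<le> i" "Suc i \<le> n"
    proof (rule lin_end.serreI_cubic)
      have i: "i \<in> {1..n}" "Suc i \<in> {1..n}" using that by auto
      show "q * qq D i (Suc i) * qq D (Suc i) i = 1"
        using qq_near[OF i] q_nz by (simp add: mult.assoc)
      show "x i * lin_end.qbr (qq D i (Suc i)) (x i) (x (Suc i))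
        = scal_end (q * qq D i (Suc i)) (lin_end.qbr (qq D i (Suc i)) (x i) (x (Suc i)) * x i)"
        using serre[OF i] serre_rel_near[of i "Suc i" D] qq_diag[OF i(1)]
        by (simp add: L x_def lin_end.qbr_def)
      show "x (Suc i) * lin_end.qbr (qq D (Suc i) i) (x (Suc i)) (x i)
        = scal_end (q * qq D (Suc i) i) (lin_end.qbr (qq D (Suc i) i) (x (Suc i)) (x i) * x (Suc i))"
        using serre[OF i(2,1)] serre_rel_near[of "Suc i" i D] qq_diag[OF i(2)]
        by (simp add: L x_def lin_end.qbr_def)
    qed
    show "L (xroot D i (Suc i)) = x i" if "i \<in> {1..n}"
      by (simp add: xroot.simps x_def)
    show "L (flip n (xroot D' (tilde D (Suc i)) (tilde D i))) = x i" if "i \<in> {1..n}"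
    proof -
      have "\<not> Suc (tilde D (Suc i)) < tilde D i" "tilde D (Suc i) \<in> {1..n}" "n + 1 - tilde D (Suc i) = i"
        using that by (auto simp: tilde_def)
      then show ?thesis
        by (subst xroot.simps) (simp add: x_def del: One_nat_def)
    qed
    show "L (xroot D i j) = lin_end.qbr (\<Prod>b\<in>{Suc i..<j}. qq D i b) (x i) (L (xroot D (Suc i) j))"
      if "1 \<le> i" "Suc i < j" "j \<le> Suc n"
      using that by (subst xroot.simps) (simp add: L x_def lin_end.qbr_def chiroot_dg)
    show "L (flip n (xroot D' (tilde D (Suc j)) (tilde D i)))
      = lin_end.qbr (\<Prod>b\<in>{i..<j}. qq D j b) (x j) (L (flip n (xroot D' (tilde D j) (tilde D i))))"
      if "1 \<le> i" "i < j" "j \<le> n"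
    proof -
      have 1: "Suc (tilde D (Suc j)) = tilde D j" "tilde D j < tilde D i" "tilde D (Suc j) \<in> {1..n}"
        "n + 1 - tilde D (Suc j) = j"
        using that by (auto simp: tilde_def)
      have 2: "chiroot D' (tilde D j) (tilde D i) (dg D' (tilde D (Suc j))) = (\<Prod>b\<in>{i..<j}. qq D j b)"
        using that by (simp only: D'_gen(1)[OF 1(3)] 1(4)) (simp add: chiroot' chiroot_dg)
      show ?thesis
        using 1 by (subst xroot.simps) (simp only: 1(1,2) if_True flip_simps flip_mult flip_letter
          flip_gen_simps(2)[OF 1(3)] 1(4) 2 L x_def lin_end.qbr_def)
    qed
    show "L (xroot D i j) ^ N = (\<Sum>cs\<in>chains i j. scal_end ((q - 1) ^ (N * (length cs - 2)) * mu_chain \<mu> cs)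
        (h \<one>\<^bsub>dgrp D\<^esub> - h (groot D (cs ! (length cs - 2)) (cs ! (length cs - 1)) [^]\<^bsub>dgrp D\<^esub> N)))"
      if "1 \<le> i" "i < j" "j \<le> n + 1"
    proof -
      have "L (xroot D i j ^ N - uroot D \<mu> i j) = 0"
        by (rule rel[OF u_rels_mem(5)[OF that]])
      then show ?thesis
        by (simp add: L L_power[OF N0] L_uroot)
    qed
  qed
  have "tilde D (tilde D b) = b" "tilde D (tilde D a) = a"
    using assms by (auto simp: tilde_def)
  then have "L (flip n (xroot D' a b)) ^ N = L (uroot D' \<mu>' a b)"
    using Z_power[OF assms] by (simp add: L_uroot e_def)
  then have "L (flip n (xroot D' a b ^ N - uroot D' \<mu>' a b)) = 0"
    by (simp add: reflected_data.flip_uroot[OF R] L L_power[OF N0])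
  moreover have "flip n (xroot D' a b ^ N - uroot D' \<mu>' a b) \<in> carrier (free_alg (gens D))"
    using reflected_data.xroot_closed[OF R, of a b] reflected_data.uroot_closed[OF R, of a b] assms
    by (auto simp: gens' intro!: flip_closed free_alg_closed power_closed)
  ultimately show ?thesis using L0 by blast
qed

end

context reflected_data
begin

lemma flip_rels:
  assumes "p \<in> u_rels D' \<mu>'"
  shows "flip n p \<in> u_ideal D \<mu>"
proof -
  have idx: "n + 1 - i \<in> {1..n}" if "i \<in> {1..n}" for i using that by auto
  consider "p = letter (Grp \<one>\<^bsub>dgrp D'\<^esub>) - 1"
    | a b where "p = letter (Grp a) * letter (Grp b) - letter (Grp (a \<otimes>\<^bsub>dgrp D'\<^esub> b))"
        "a \<in> carrier (dgrp D')" "b \<in> carrier (dgrp D')"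
    | a i where "p = letter (Grp a) * letter (X i) * letter (Grp (inv\<^bsub>dgrp D'\<^esub> a)) - scal (dchi D' i a) (letter (X i))"
        "a \<in> carrier (dgrp D')" "i \<in> {1..dn D'}"
    | i j where "p = (ad_c D' i ^^ nat (1 - cartan_A i j)) (letter (X j))" "i \<in> {1..dn D'}" "j \<in> {1..dn D'}" "i \<noteq> j"
    | i j where "p = xroot D' i j ^ dN D' - uroot D' \<mu>' i j" "1 \<le> i" "i < j" "j \<le> dn D' + 1"
    using assms unfolding u_rels_def by blast
  then show ?thesis
  proof cases
    case 1
    then show ?thesis using subsetD[OF u_ideal(2) u_rels_mem(1)] by simp
  next
    case (2 a b)
    then show ?thesis using subsetD[OF u_ideal(2) u_rels_mem(2)[of a D b \<mu>]] by simp
  next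
    case (3 a i)
    then show ?thesis
      using subsetD[OF u_ideal(2) u_rels_mem(3)[of a D "n + 1 - i" \<mu>]] idx[of i] by (simp add: D'_gen)
  next
    case (4 i j)
    then have "n + 1 - i \<noteq> n + 1 - j" by auto
    then show ?thesis
      using 4 subsetD[OF u_ideal(2) u_rels_mem(4)[of "n + 1 - i" D "n + 1 - j" \<mu>]] idx[of i] idx[of j] flip_serre[of i j]
      by (simp del: One_nat_def)
  next
    case (5 i j)
    then show ?thesis using root_relation[of i j] by simp
  qed
qed

lemma flip_ideal_subset: "flip n ` u_ideal D' \<mu>' \<subseteq> u_ideal D \<mu>"
proof -
  note I = ideal_free_algD[OF u_ideal(1)]
  define K where "K = {p \<in> carrier (free_alg (gens D)). flip n p \<in> u_ideal D \<mu>}"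
  have R: "reflected_data D' \<mu>' D \<mu>"
    by (rule reflected_data_sym) (rule reflected_data_axioms)
  have "ideal K (free_alg (gens D))"
    by (rule ideal_free_algI) (auto simp: K_def free_alg_closed free_alg_closed_unary I flip_closed)
  moreover have "u_rels D' \<mu>' \<subseteq> K"
    using flip_rels reflected_data.u_rels_closed[OF R] by (auto simp: K_def gens')
  ultimately have "u_ideal D' \<mu>' \<subseteq> K"
    unfolding u_ideal_def gens' by (rule ring.genideal_minimal[OF free_alg_ring])
  then show ?thesis by (auto simp: K_def)
qed

lemma flip_ideal: "flip n ` u_ideal D' \<mu>' = u_ideal D \<mu>"
proof
  have R: "reflected_data D' \<mu>' D \<mu>"
    by (rule reflected_data_sym) (rule reflected_data_axioms)
  have "flip n ` u_ideal D \<mu> \<subseteq> u_ideal D' \<mu>'"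
    using reflected_data.flip_ideal_subset[OF R] by simp
  then have "flip n ` flip n ` u_ideal D \<mu> \<subseteq> flip n ` u_ideal D' \<mu>'"
    by (rule image_mono)
  then show "u_ideal D \<mu> \<subseteq> flip n ` u_ideal D' \<mu>'"
    by (simp add: image_image)
qed (rule flip_ideal_subset)

end

section \<open>Quotients of free algebras\<close>

locale free_alg_quotient =
  fixes L :: "'x set" and I :: "('x list \<Rightarrow>\<^sub>0 'k::field) set"
  assumes ideal: "ideal I (free_alg L)"
begin

abbreviation "A \<equiv> free_alg L :: ('k, 'x list \<Rightarrow>\<^sub>0 'k) module"
abbreviation "Q \<equiv> quot_alg A I"

definition cls :: "('x list \<Rightarrow>\<^sub>0 'k) \<Rightarrow> ('x list \<Rightarrow>\<^sub>0 'k) set" where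
  "cls p = I +>\<^bsub>A\<^esub> p"

lemmas I = ideal_free_algD[OF ideal]

lemma I_carrier: "i \<in> I \<Longrightarrow> i \<in> carrier A"
  using I(1) by auto

lemma I_diff: "p \<in> I \<Longrightarrow> q \<in> I \<Longrightarrow> p - q \<in> I"
  using I(3)[of p "- q"] I(5) by simp

lemma mem_cls: "q \<in> cls p \<longleftrightarrow> q - p \<in> I"
proof -
  have "q \<in> cls p \<longleftrightarrow> (\<exists>i\<in>I. q = i + p)"
    by (simp add: cls_def a_r_coset_def')
  then show ?thesis by (metis add_diff_cancel diff_add_cancel)
qed

lemma cls_self: "p \<in> cls p"
  by (simp add: mem_cls I(2))

lemma cls_eq: "cls p = cls q \<longleftrightarrow> p - q \<in> I"
proof
  assume "cls p = cls q"
  then show "p - q \<in> I" using cls_self[of p] mem_cls[of p q] by simp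
next
  assume *: "p - q \<in> I"
  have "r - p \<in> I \<longleftrightarrow> r - q \<in> I" for r
    using I(3)[OF _ *, of "r - p"] I_diff[OF _ *, of "r - q"] by auto
  then show "cls p = cls q" by (auto simp: mem_cls)
qed

lemma cls_carrier: "p \<in> carrier A \<Longrightarrow> q \<in> cls p \<Longrightarrow> q \<in> carrier A"
  using I_carrier[of "q - p"] free_alg_closed(1)[of "q - p" L p] by (simp add: mem_cls)

lemma Q_carrier: "carrier Q = cls ` carrier A"
  by (auto simp: quot_alg_def ring.defs FactRing_def A_RCOSETS_def' cls_def module.defs)

lemma Q_one: "\<one>\<^bsub>Q\<^esub> = cls 1"
  by (simp add: quot_alg_def ring.defs FactRing_def cls_def module.defs)

lemma Q_zero: "\<zero>\<^bsub>Q\<^esub> = cls 0"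
  by (auto simp: quot_alg_def ring.defs FactRing_def mem_cls module.defs)

lemma Q_mult_sets: "S \<otimes>\<^bsub>Q\<^esub> T = (\<Union>s\<in>S. \<Union>t\<in>T. cls (s * t))"
  by (simp add: quot_alg_def ring.defs FactRing_def rcoset_mult_def cls_def module.defs)

lemma Q_add_sets: "S \<oplus>\<^bsub>Q\<^esub> T = (\<Union>s\<in>S. \<Union>t\<in>T. {s + t})"
  by (simp add: quot_alg_def ring.defs FactRing_def set_add_def' module.defs)

lemma Q_smult_sets: "c \<odot>\<^bsub>Q\<^esub> S = (\<Union>s\<in>S. cls (scal c s))"
  by (simp add: quot_alg_def ring.defs FactRing_def cls_def module.defs)

lemma Q_add: "cls p \<oplus>\<^bsub>Q\<^esub> cls q = cls (p + q)"
proof (intro equalityI subsetI)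
  fix r assume "r \<in> cls p \<oplus>\<^bsub>Q\<^esub> cls q"
  then obtain s t where "s - p \<in> I" "t - q \<in> I" "r = s + t"
    by (auto simp: Q_add_sets mem_cls)
  then show "r \<in> cls (p + q)"
    using I(3)[of "s - p" "t - q"] by (simp add: mem_cls algebra_simps)
next
  fix r assume "r \<in> cls (p + q)"
  then have "r - q \<in> cls p" "r = (r - q) + q"
    by (simp_all add: mem_cls algebra_simps)
  then show "r \<in> cls p \<oplus>\<^bsub>Q\<^esub> cls q"
    unfolding Q_add_sets using cls_self[of q] by blast
qed

lemma Q_smult: "c \<odot>\<^bsub>Q\<^esub> cls p = cls (scal c p)"
proof -
  have "cls (scal c s) = cls (scal c p)" if "s \<in> cls p" for s
    using that I(4)[of "s - p" c] by (simp add: cls_eq mem_cls lincomb.scale_right_diff_distrib)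
  then have "(\<Union>s\<in>cls p. cls (scal c s)) = (\<Union>s\<in>cls p. cls (scal c p))"
    by (intro SUP_cong refl)
  then show ?thesis
    unfolding Q_smult_sets using cls_self[of p] by blast
qed

lemma Q_mult:
  assumes "p \<in> carrier A" "q \<in> carrier A"
  shows "cls p \<otimes>\<^bsub>Q\<^esub> cls q = cls (p * q)"
proof -
  have "cls (s * t) = cls (p * q)" if "s \<in> cls p" "t \<in> cls q" for s t
  proof -
    have "s * t - p * q = (s - p) * t + p * (t - q)"
      by (simp add: algebra_simps)
    moreover have "(s - p) * t \<in> I" "p * (t - q) \<in> I"
      using that assms cls_carrier[OF assms(2) that(2)] by (auto simp: mem_cls intro: I)
    ultimately show ?thesis by (simp add: cls_eq I(3))
  qed
  then have "(\<Union>s\<in>cls p. \<Union>t\<in>cls q. cls (s * t)) = (\<Union>s\<in>cls p. \<Union>t\<in>cls q. cls (p * q))"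
    by (intro SUP_cong refl)
  then show ?thesis
    unfolding Q_mult_sets using cls_self[of p] cls_self[of q] by blast
qed

lemma cls_closed [simp]: "p \<in> carrier A \<Longrightarrow> cls p \<in> carrier Q"
  by (simp add: Q_carrier)

lemma Q_ring: "ring Q"
proof (rule ringI)
  show "abelian_group Q"
  proof (rule abelian_groupI)
    fix S assume "S \<in> carrier Q"
    then obtain p where "p \<in> carrier A" "S = cls p" by (auto simp: Q_carrier)
    then show "\<exists>T\<in>carrier Q. T \<oplus>\<^bsub>Q\<^esub> S = \<zero>\<^bsub>Q\<^esub>"
      by (intro bexI[of _ "cls (- p)"]) (auto simp: Q_add Q_zero free_alg_closed_unary)
  qed (auto simp: Q_carrier Q_add Q_zero algebra_simps free_alg_closed)
  show "monoid Q"
    by (rule monoidI) (auto simp: Q_carrier Q_mult Q_one mult.assoc free_alg_closed)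
qed (auto simp: Q_carrier Q_mult Q_add free_alg_closed algebra_simps)

lemma Q_a_inv: "p \<in> carrier A \<Longrightarrow> \<ominus>\<^bsub>Q\<^esub> cls p = cls (- p)"
proof -
  interpret ring Q by (rule Q_ring)
  assume "p \<in> carrier A"
  then show ?thesis by (intro minus_equality) (auto simp: Q_add Q_zero free_alg_closed_unary)
qed

end

section \<open>Algebras, tensor products and induced maps\<close>

locale alg = ring A for A :: "('k::field, 'a) module" (structure) +
  assumes smult_closed [simp]: "a \<in> carrier A \<Longrightarrow> c \<odot> a \<in> carrier A"
    and smult_add_right: "a \<in> carrier A \<Longrightarrow> b \<in> carrier A \<Longrightarrow> c \<odot> (a \<oplus> b) = c \<odot> a \<oplus> c \<odot> b"
    and smult_mult_left: "a \<in> carrier A \<Longrightarrow> b \<in> carrier A \<Longrightarrow> (c \<odot> a) \<otimes> b = c \<odot> (a \<otimes> b)"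
    and smult_mult_right: "a \<in> carrier A \<Longrightarrow> b \<in> carrier A \<Longrightarrow> a \<otimes> (c \<odot> b) = c \<odot> (a \<otimes> b)"

lemma (in free_alg_quotient) Q_alg: "alg Q"
  unfolding alg_def alg_axioms_def
  using Q_ring
  by (auto simp: Q_carrier Q_mult Q_add Q_smult free_alg_closed_unary lincomb.scale_right_distrib scal_mult_left scal_mult_right
      intro!: imageI free_alg_closed)

lemma lin_ext_cong: "(\<And>w. w \<in> Poly_Mapping.keys p \<Longrightarrow> g w = g' w) \<Longrightarrow> lin_ext g p = lin_ext g' p"
  unfolding lin_ext_def by (rule sum.cong) auto

lemma lin_ext_lin_ext: "lin_ext g (lin_ext h p) = lin_ext (\<lambda>w. lin_ext g (h w)) p"
  unfolding lin_ext_def[of h] lin_ext_def[of "\<lambda>w. lin_ext g (h w)"] by (simp add: lin_ext_simps)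

lemma lin_ext_add: "lin_ext (\<lambda>w. g w + g' w) p = lin_ext g p + lin_ext g' p"
  by (simp add: lin_ext_def lincomb.scale_right_distrib sum.distrib)

lemma lin_ext_swap: "lin_ext (\<lambda>v. lin_ext (g v) t) s = lin_ext (\<lambda>w. lin_ext (\<lambda>v. g v w) s) t"
  unfolding lin_ext_def lincomb.scale_sum_right
  by (subst sum.swap) (simp add: mult.commute)

lemma linear_span_subset:
  assumes "Vector_Spaces.linear (scal :: 'k::field \<Rightarrow> _) (scal :: 'k \<Rightarrow> _) f" "f ` B \<subseteq> lincomb.span C"
  shows "f ` lincomb.span B \<subseteq> lincomb.span C"
proof -
  have "lincomb.span B \<subseteq> {x. f x \<in> lincomb.span C}"
    by (rule lincomb.span_minimal)
      (use assms(2) in \<open>auto simp: lincomb.subspace_def linear_simps[OF assms(1)]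
        intro: lincomb.span_zero lincomb.span_add lincomb.span_scale\<close>)
  then show ?thesis by auto
qed

lemma span_lin_ext:
  assumes "\<And>w. w \<in> Poly_Mapping.keys p \<Longrightarrow> g w \<in> lincomb.span C"
  shows "lin_ext g p \<in> lincomb.span C"
  unfolding lin_ext_def by (intro lincomb.span_sum lincomb.span_scale assms)

lemma keys_lin_ext:
  assumes "\<And>w. w \<in> Poly_Mapping.keys p \<Longrightarrow> Poly_Mapping.keys (g w) \<subseteq> C"
  shows "Poly_Mapping.keys (lin_ext g p) \<subseteq> C"
proof
  fix v assume "v \<in> Poly_Mapping.keys (lin_ext g p)"
  then obtain w where "w \<in> Poly_Mapping.keys p" "v \<in> Poly_Mapping.keys (scal (Poly_Mapping.lookup p w) (g w))"
    unfolding lin_ext_def using keys_sum by fastforce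
  then show "v \<in> C"
    using assms[of w] by (auto simp: in_keys_iff)
qed

lemma tensor_mult_rep_eq:
  "tensor_mult_rep A B s t = lin_ext (\<lambda>(a, b). lin_ext (\<lambda>(c, d). Poly_Mapping.single (a \<otimes>\<^bsub>A\<^esub> c, b \<otimes>\<^bsub>B\<^esub> d) 1) t) s"
  unfolding tensor_mult_rep_def lin_ext_def
  by (intro sum.cong refl) (auto simp: lincomb.scale_sum_right split_def intro!: sum.cong)

lemma tensor_mult_rep_linear:
  "tensor_mult_rep A B (s + s') t = tensor_mult_rep A B s t + tensor_mult_rep A B s' t"
  "tensor_mult_rep A B s (t + t') = tensor_mult_rep A B s t + tensor_mult_rep A B s t'"
  by (simp_all add: tensor_mult_rep_eq lin_ext_simps split_def lin_ext_add)

section \<open>The tensor square of an algebra\<close>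

context alg
begin

abbreviation "R \<equiv> lincomb.span (bilinear_rels A A)"
abbreviation "tc \<equiv> tensor_class A A"
abbreviation "T \<equiv> tensor_alg A A"
abbreviation "mrep \<equiv> tensor_mult_rep A A"

definition C2 :: "('a \<times> 'a \<Rightarrow>\<^sub>0 'k) set" where
  "C2 = {t. Poly_Mapping.keys t \<subseteq> carrier A \<times> carrier A}"

lemma C2_subspace: "lincomb.subspace C2"
  by (auto simp: lincomb.subspace_def C2_def in_keys_iff dest!: subsetD[OF keys_add])

lemmas C2_closed = lincomb.subspace_add[OF C2_subspace] lincomb.subspace_scale[OF C2_subspace]
  lincomb.subspace_0[OF C2_subspace] lincomb.subspace_diff[OF C2_subspace] lincomb.subspace_neg[OF C2_subspace]

lemma C2_single: "a \<in> carrier A \<Longrightarrow> b \<in> carrier A \<Longrightarrow> Poly_Mapping.single (a, b) c \<in> C2"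
  by (auto simp: C2_def)

lemma R_C2: "R \<subseteq> C2"
  by (rule lincomb.span_minimal[OF _ C2_subspace])
    (auto simp: bilinear_rels_def intro!: C2_closed C2_single)

lemma C2_mrep:
  assumes "s \<in> C2" "t \<in> C2"
  shows "mrep s t \<in> C2"
proof -
  have "Poly_Mapping.keys (lin_ext (\<lambda>(c, d). Poly_Mapping.single (a \<otimes> c, b \<otimes> d) 1) t) \<subseteq> carrier A \<times> carrier A"
    if "a \<in> carrier A" "b \<in> carrier A" for a b
    by (rule keys_lin_ext) (use that assms in \<open>auto simp: C2_def\<close>)
  then show ?thesis
    unfolding C2_def tensor_mult_rep_eq mem_Collect_eq
    by (intro keys_lin_ext) (use assms in \<open>auto simp: C2_def\<close>)
qed

lemma mem_tc: "s \<in> tc t \<longleftrightarrow> s - t \<in> R"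
proof -
  have "s \<in> tc t \<longleftrightarrow> (\<exists>r\<in>R. s = t + r)"
    by (auto simp: tensor_class_def)
  then show ?thesis by (metis add_diff_cancel_left' add.commute diff_add_cancel)
qed

lemma tc_self: "t \<in> tc t"
  by (simp add: mem_tc lincomb.span_zero)

lemma tc_eq: "tc s = tc t \<longleftrightarrow> s - t \<in> R"
proof
  assume "tc s = tc t"
  then show "s - t \<in> R" using tc_self[of s] mem_tc[of s t] by simp
next
  assume *: "s - t \<in> R"
  have "r - s \<in> R \<longleftrightarrow> r - t \<in> R" for r
    using lincomb.span_add[OF _ *, of "r - s"] lincomb.span_diff[OF _ *, of "r - t"] by auto
  then show "tc s = tc t" by (auto simp: mem_tc)
qed

lemma tc_C2: "t \<in> C2 \<Longrightarrow> s \<in> tc t \<Longrightarrow> s \<in> C2"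
  using R_C2 C2_closed(1)[of "s - t" t] by (auto simp: mem_tc)

lemma T_carrier: "carrier T = tc ` C2"
  by (simp add: tensor_alg_def C2_def)

lemma T_add: "tc s \<oplus>\<^bsub>T\<^esub> tc t = tc (s + t)"
proof -
  have "tc (s' + t') = tc (s + t)" if "s' \<in> tc s" "t' \<in> tc t" for s' t'
    using that lincomb.span_add[of "s' - s" _ "t' - t"] by (simp add: tc_eq mem_tc algebra_simps)
  then have "(\<Union>s'\<in>tc s. \<Union>t'\<in>tc t. tc (s' + t')) = (\<Union>s'\<in>tc s. \<Union>t'\<in>tc t. tc (s + t))"
    by (intro SUP_cong refl)
  then show ?thesis
    unfolding tensor_alg_def using tc_self[of s] tc_self[of t] by auto
qed

lemma T_smult: "c \<odot>\<^bsub>T\<^esub> tc t = tc (scal c t)"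
proof -
  have "tc (scal c t') = tc (scal c t)" if "t' \<in> tc t" for t'
    using that lincomb.span_scale[of "t' - t" _ c]
    by (simp add: tc_eq mem_tc lincomb.scale_right_diff_distrib)
  then have "(\<Union>t'\<in>tc t. tc (scal c t')) = (\<Union>t'\<in>tc t. tc (scal c t))"
    by (intro SUP_cong refl)
  then show ?thesis
    unfolding tensor_alg_def using tc_self[of t] by auto
qed

lemma bilinear_relsI:
  assumes "a \<in> carrier A" "b \<in> carrier A"
  shows "a' \<in> carrier A \<Longrightarrow> Poly_Mapping.single (a \<oplus> a', b) 1 - Poly_Mapping.single (a, b) 1 - Poly_Mapping.single (a', b) 1 \<in> R"
    "b' \<in> carrier A \<Longrightarrow> Poly_Mapping.single (a, b \<oplus> b') 1 - Poly_Mapping.single (a, b) 1 - Poly_Mapping.single (a, b') 1 \<in> R"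
    "Poly_Mapping.single (c \<odot> a, b) 1 - Poly_Mapping.single (a, b) c \<in> R"
    "Poly_Mapping.single (a, c \<odot> b) 1 - Poly_Mapping.single (a, b) c \<in> R"
  using assms by (intro lincomb.span_base; unfold bilinear_rels_def; blast)+

text \<open>Used with multiplications by fixed elements, to see that the relations absorb products,
  and with a homomorphism \<open>f = g\<close>, to induce the map on tensor squares.\<close>

lemma tensor_rep_map_rels:
  assumes f: "\<And>a. a \<in> carrier B \<Longrightarrow> f a \<in> carrier A" "\<And>a b. a \<in> carrier B \<Longrightarrow> b \<in> carrier B \<Longrightarrow> f (a \<oplus>\<^bsub>B\<^esub> b) = f a \<oplus> f b"
      "\<And>c a. a \<in> carrier B \<Longrightarrow> f (c \<odot>\<^bsub>B\<^esub> a) = c \<odot> f a"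
    and g: "\<And>a. a \<in> carrier B \<Longrightarrow> g a \<in> carrier A" "\<And>a b. a \<in> carrier B \<Longrightarrow> b \<in> carrier B \<Longrightarrow> g (a \<oplus>\<^bsub>B\<^esub> b) = g a \<oplus> g b"
      "\<And>c a. a \<in> carrier B \<Longrightarrow> g (c \<odot>\<^bsub>B\<^esub> a) = c \<odot> g a"
    and r: "r \<in> lincomb.span (bilinear_rels B B)"
  shows "lin_ext (\<lambda>(a, b). Poly_Mapping.single (f a, g b) 1) r \<in> R"
proof -
  have "lin_ext (\<lambda>(a, b). Poly_Mapping.single (f a, g b) 1) ` bilinear_rels B B \<subseteq> R"
    unfolding bilinear_rels_def[of B B]
    by (auto simp: lin_ext_simps f g intro!: bilinear_relsI)
  then show ?thesis
    using linear_span_subset[OF lin_ext_linear] r by blast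
qed

text \<open>Multiplication by a single pair is a pair of linear maps; general \<open>t\<close>
  follows by linearity, after exchanging the two sums for multiplication from the right.\<close>

lemma mrep_R:
  assumes "t \<in> C2" "r \<in> R"
  shows "mrep r t \<in> R" "mrep t r \<in> R"
proof -
  have carr: "a \<in> carrier A \<and> b \<in> carrier A" if "(a, b) \<in> Poly_Mapping.keys t" for a b
    using that assms(1) by (auto simp: C2_def)
  have "mrep r t = lin_ext (\<lambda>(c, d). lin_ext (\<lambda>(a, b). Poly_Mapping.single (a \<otimes> c, b \<otimes> d) 1) r) t"
    unfolding tensor_mult_rep_eq split_def by (rule lin_ext_swap)
  also have "\<dots> \<in> R"
    by (rule span_lin_ext)
      (auto dest!: carr intro!: tensor_rep_map_rels[OF _ _ _ _ _ _ assms(2)] simp: l_distr smult_mult_left)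
  finally show "mrep r t \<in> R" .
  show "mrep t r \<in> R"
    unfolding tensor_mult_rep_eq
    by (rule span_lin_ext)
      (auto dest!: carr intro!: tensor_rep_map_rels[OF _ _ _ _ _ _ assms(2)] simp: r_distr smult_mult_right)
qed

lemma T_mult:
  assumes "s \<in> C2" "t \<in> C2"
  shows "tc s \<otimes>\<^bsub>T\<^esub> tc t = tc (mrep s t)"
proof -
  have "tc (mrep s' t') = tc (mrep s t)" if "s' \<in> tc s" "t' \<in> tc t" for s' t'
  proof -
    have "mrep (s' - s + s) t' - mrep s (t' - (t' - t)) = mrep (s' - s) t' + mrep s (t' - t)"
      using tensor_mult_rep_linear(1)[of A A "s' - s" s t'] tensor_mult_rep_linear(2)[of A A s t "t' - t"]
      by simp
    moreover have "mrep (s' - s) t' \<in> R" "mrep s (t' - t) \<in> R"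
      using that assms tc_C2[of t t'] mrep_R(1)[of t' "s' - s"] mrep_R(2)[of s "t' - t"] by (auto simp: mem_tc)
    ultimately show ?thesis
      by (simp add: tc_eq lincomb.span_add)
  qed
  then have "(\<Union>s'\<in>tc s. \<Union>t'\<in>tc t. tc (mrep s' t')) = (\<Union>s'\<in>tc s. \<Union>t'\<in>tc t. tc (mrep s t))"
    by (intro SUP_cong refl)
  then show ?thesis
    unfolding tensor_alg_def using tc_self[of s] tc_self[of t] by auto
qed

lemma T_zero: "\<zero>\<^bsub>T\<^esub> = tc 0" and T_one: "\<one>\<^bsub>T\<^esub> = tc (Poly_Mapping.single (\<one>, \<one>) 1)"
  by (simp_all add: tensor_alg_def pure_tensor_def)

lemma T_abelian_monoid: "abelian_monoid T"
  by (rule abelian_monoidI) (auto simp: T_carrier T_add T_zero algebra_simps intro!: imageI C2_closed)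

lemma T_closed:
  "S \<in> carrier T \<Longrightarrow> S' \<in> carrier T \<Longrightarrow> S \<oplus>\<^bsub>T\<^esub> S' \<in> carrier T"
  "S \<in> carrier T \<Longrightarrow> S' \<in> carrier T \<Longrightarrow> S \<otimes>\<^bsub>T\<^esub> S' \<in> carrier T"
  "S \<in> carrier T \<Longrightarrow> c \<odot>\<^bsub>T\<^esub> S \<in> carrier T" "\<one>\<^bsub>T\<^esub> \<in> carrier T"
  "a \<in> carrier A \<Longrightarrow> b \<in> carrier A \<Longrightarrow> pure_tensor A A a b \<in> carrier T"
  by (auto simp: T_carrier T_add T_mult T_smult T_one pure_tensor_def intro!: imageI C2_closed C2_mrep C2_single)

end

locale alg_map = A: alg A + B: alg B for A :: "('k::field, 'a) module" and B :: "('k, 'b) module" +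
  fixes f assumes hom: "f \<in> alg_hom A B"
begin

lemma f_simps:
  "a \<in> carrier A \<Longrightarrow> f a \<in> carrier B"
  "a \<in> carrier A \<Longrightarrow> b \<in> carrier A \<Longrightarrow> f (a \<oplus>\<^bsub>A\<^esub> b) = f a \<oplus>\<^bsub>B\<^esub> f b"
  "a \<in> carrier A \<Longrightarrow> b \<in> carrier A \<Longrightarrow> f (a \<otimes>\<^bsub>A\<^esub> b) = f a \<otimes>\<^bsub>B\<^esub> f b"
  "a \<in> carrier A \<Longrightarrow> f (c \<odot>\<^bsub>A\<^esub> a) = c \<odot>\<^bsub>B\<^esub> f a"
  "f \<one>\<^bsub>A\<^esub> = \<one>\<^bsub>B\<^esub>"
  using hom by (auto simp: alg_hom_def ring_hom_def)

definition ff :: "('a \<times> 'a \<Rightarrow>\<^sub>0 'k) \<Rightarrow> ('b \<times> 'b \<Rightarrow>\<^sub>0 'k)" where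
  "ff = lin_ext (\<lambda>(a, b). Poly_Mapping.single (f a, f b) 1)"

lemma tensor_map_eq: "tensor_map B B f f S = (\<Union>t\<in>S. B.tc (ff t))"
  by (simp add: tensor_map_def ff_def lin_ext_def split_def)

lemma tensor_map_tc: "tensor_map B B f f (A.tc t) = B.tc (ff t)"
proof -
  have "B.tc (ff s) = B.tc (ff t)" if "s \<in> A.tc t" for s
  proof -
    have "ff (s - t) \<in> B.R"
      unfolding ff_def by (rule B.tensor_rep_map_rels[of A]) (use that in \<open>auto simp: f_simps A.mem_tc\<close>)
    then show ?thesis
      by (simp add: B.tc_eq ff_def lin_ext_simps)
  qed
  then have "(\<Union>s\<in>A.tc t. B.tc (ff s)) = (\<Union>s\<in>A.tc t. B.tc (ff t))"
    by (intro SUP_cong refl)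
  then show ?thesis
    unfolding tensor_map_eq using A.tc_self[of t] by auto
qed

lemma ff_C2: "t \<in> A.C2 \<Longrightarrow> ff t \<in> B.C2"
  unfolding A.C2_def B.C2_def ff_def mem_Collect_eq
  by (rule keys_lin_ext) (auto simp: f_simps)

lemma ff_mrep:
  assumes "s \<in> A.C2" "t \<in> A.C2"
  shows "ff (A.mrep s t) = B.mrep (ff s) (ff t)"
  unfolding ff_def tensor_mult_rep_eq lin_ext_lin_ext
proof (rule lin_ext_cong, clarify)
  fix a b assume "(a, b) \<in> Poly_Mapping.keys s"
  then have ab: "a \<in> carrier A" "b \<in> carrier A"
    using assms by (auto simp: A.C2_def)
  have "lin_ext (\<lambda>w. lin_ext (\<lambda>(a, b). Poly_Mapping.single (f a, f b) 1)
        (case w of (c, d) \<Rightarrow> Poly_Mapping.single (a \<otimes>\<^bsub>A\<^esub> c, b \<otimes>\<^bsub>A\<^esub> d) 1)) t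
    = lin_ext (\<lambda>w. lin_ext (\<lambda>(c, d). Poly_Mapping.single (f a \<otimes>\<^bsub>B\<^esub> c, f b \<otimes>\<^bsub>B\<^esub> d) 1)
        (case w of (a, b) \<Rightarrow> Poly_Mapping.single (f a, f b) 1)) t"
    using assms ab by (intro lin_ext_cong) (auto simp: A.C2_def f_simps)
  then show "lin_ext (\<lambda>(a, b). Poly_Mapping.single (f a, f b) 1)
      (lin_ext (\<lambda>(c, d). Poly_Mapping.single (a \<otimes>\<^bsub>A\<^esub> c, b \<otimes>\<^bsub>A\<^esub> d) 1) t)
    = lin_ext (\<lambda>(a, b). lin_ext (\<lambda>w. lin_ext (\<lambda>(c, d). Poly_Mapping.single (a \<otimes>\<^bsub>B\<^esub> c, b \<otimes>\<^bsub>B\<^esub> d) 1)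
        (case w of (a, b) \<Rightarrow> Poly_Mapping.single (f a, f b) 1)) t) (Poly_Mapping.single (f a, f b) 1)"
    by (simp add: lin_ext_lin_ext)
qed

lemma tensor_map_hom:
  "S \<in> carrier A.T \<Longrightarrow> tensor_map B B f f S \<in> carrier B.T"
  "S \<in> carrier A.T \<Longrightarrow> S' \<in> carrier A.T \<Longrightarrow>
    tensor_map B B f f (S \<oplus>\<^bsub>A.T\<^esub> S') = tensor_map B B f f S \<oplus>\<^bsub>B.T\<^esub> tensor_map B B f f S'"
  "S \<in> carrier A.T \<Longrightarrow> S' \<in> carrier A.T \<Longrightarrow>
    tensor_map B B f f (S \<otimes>\<^bsub>A.T\<^esub> S') = tensor_map B B f f S \<otimes>\<^bsub>B.T\<^esub> tensor_map B B f f S'"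
  "S \<in> carrier A.T \<Longrightarrow> tensor_map B B f f (c \<odot>\<^bsub>A.T\<^esub> S) = c \<odot>\<^bsub>B.T\<^esub> tensor_map B B f f S"
  "tensor_map B B f f \<one>\<^bsub>A.T\<^esub> = \<one>\<^bsub>B.T\<^esub>" "tensor_map B B f f \<zero>\<^bsub>A.T\<^esub> = \<zero>\<^bsub>B.T\<^esub>"
  "tensor_map B B f f (pure_tensor A A a b) = pure_tensor B B (f a) (f b)"
proof -
  have ff: "ff (s + t) = ff s + ff t" "ff (scal c s) = scal c (ff s)" "ff 0 = 0"
    "ff (Poly_Mapping.single (a, b) 1) = Poly_Mapping.single (f a, f b) 1" for s t c a b
    by (simp_all add: ff_def lin_ext_simps)
  show "S \<in> carrier A.T \<Longrightarrow> tensor_map B B f f S \<in> carrier B.T"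
  "S \<in> carrier A.T \<Longrightarrow> S' \<in> carrier A.T \<Longrightarrow>
    tensor_map B B f f (S \<oplus>\<^bsub>A.T\<^esub> S') = tensor_map B B f f S \<oplus>\<^bsub>B.T\<^esub> tensor_map B B f f S'"
  "S \<in> carrier A.T \<Longrightarrow> S' \<in> carrier A.T \<Longrightarrow>
    tensor_map B B f f (S \<otimes>\<^bsub>A.T\<^esub> S') = tensor_map B B f f S \<otimes>\<^bsub>B.T\<^esub> tensor_map B B f f S'"
  "S \<in> carrier A.T \<Longrightarrow> tensor_map B B f f (c \<odot>\<^bsub>A.T\<^esub> S) = c \<odot>\<^bsub>B.T\<^esub> tensor_map B B f f S"
  "tensor_map B B f f \<one>\<^bsub>A.T\<^esub> = \<one>\<^bsub>B.T\<^esub>" "tensor_map B B f f \<zero>\<^bsub>A.T\<^esub> = \<zero>\<^bsub>B.T\<^esub>"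
  "tensor_map B B f f (pure_tensor A A a b) = pure_tensor B B (f a) (f b)"
    by (auto simp: A.T_carrier B.T_carrier A.T_add B.T_add A.T_mult B.T_mult A.T_smult B.T_smult A.T_one B.T_one
        A.T_zero B.T_zero pure_tensor_def tensor_map_tc ff ff_mrep ff_C2 f_simps)
qed

end

text \<open>Naturality of \<open>free_lift\<close> under relabelling. The hypotheses are stated
  operation by operation so that tensor square, ground field and opposite algebra are all
  covered.\<close>

lemma free_lift_flip:
  fixes A :: "('k::field, 'a) module" and B :: "('k, 'b) module"
  assumes "abelian_monoid A" "abelian_monoid B"
    and A: "\<And>a b. a \<in> carrier A \<Longrightarrow> b \<in> carrier A \<Longrightarrow> a \<otimes>\<^bsub>A\<^esub> b \<in> carrier A"
      "\<And>c a. a \<in> carrier A \<Longrightarrow> c \<odot>\<^bsub>A\<^esub> a \<in> carrier A" "\<one>\<^bsub>A\<^esub> \<in> carrier A"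
    and h: "\<And>a. a \<in> carrier A \<Longrightarrow> h a \<in> carrier B" "h \<zero>\<^bsub>A\<^esub> = \<zero>\<^bsub>B\<^esub>" "h \<one>\<^bsub>A\<^esub> = \<one>\<^bsub>B\<^esub>"
      "\<And>a b. a \<in> carrier A \<Longrightarrow> b \<in> carrier A \<Longrightarrow> h (a \<oplus>\<^bsub>A\<^esub> b) = h a \<oplus>\<^bsub>B\<^esub> h b"
      "\<And>a b. a \<in> carrier A \<Longrightarrow> b \<in> carrier A \<Longrightarrow> h (a \<otimes>\<^bsub>A\<^esub> b) = h a \<otimes>\<^bsub>B\<^esub> h b"
      "\<And>c a. a \<in> carrier A \<Longrightarrow> h (c \<odot>\<^bsub>A\<^esub> a) = c \<odot>\<^bsub>B\<^esub> h a"
    and g: "\<And>x. x \<in> L \<Longrightarrow> g x \<in> carrier A" "\<And>x. x \<in> L \<Longrightarrow> g' (flip_gen n x) = h (g x)"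
    and p: "p \<in> carrier (free_alg L)"
  shows "free_lift B g' (flip n p) = h (free_lift A g p)"
proof -
  interpret A: abelian_monoid A by (rule assms(1))
  interpret B: abelian_monoid B by (rule assms(2))
  define wd where "wd w = foldr (\<lambda>x a. g x \<otimes>\<^bsub>A\<^esub> a) w \<one>\<^bsub>A\<^esub>" for w
  define wd' where "wd' w = foldr (\<lambda>x a. g' x \<otimes>\<^bsub>B\<^esub> a) w \<one>\<^bsub>B\<^esub>" for w
  have wd: "wd w \<in> carrier A" "wd' (map (flip_gen n) w) = h (wd w)" if "set w \<subseteq> L" for w
    using that by (induct w) (auto simp: wd_def wd'_def A h g)
  have sum: "h (\<Oplus>\<^bsub>A\<^esub>w\<in>W. k w) = (\<Oplus>\<^bsub>B\<^esub>w\<in>W. h (k w))" if "finite W" "\<And>w. w \<in> W \<Longrightarrow> k w \<in> carrier A" for W k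
    using that
  proof (induct W rule: finite_induct)
    case (insert w W)
    then show ?case
      by (simp add: A.finsum_insert B.finsum_insert Pi_iff h A.finsum_closed)
  qed (simp add: h)
  have keys: "set w \<subseteq> L" if "w \<in> Poly_Mapping.keys p" for w
    using p that by (auto simp: free_alg_carrier)
  have B: "c \<odot>\<^bsub>B\<^esub> h (wd w) \<in> carrier B" if "w \<in> Poly_Mapping.keys p" for c w
    using h(1)[OF A(2)[OF wd(1)[OF keys[OF that]]], of c] h(6)[OF wd(1)[OF keys[OF that]]] by simp
  have inj: "inj (map (flip_gen n))"
    by (metis (mono_tags, lifting) flip_gen_simps(3) injI inj_mapI)
  have "free_lift B g' (flip n p) = (\<Oplus>\<^bsub>B\<^esub>w\<in>map (flip_gen n) ` Poly_Mapping.keys p.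
      Poly_Mapping.lookup (flip n p) w \<odot>\<^bsub>B\<^esub> wd' w)"
    by (simp add: free_lift_def keys_flip wd'_def)
  also have "\<dots> = (\<Oplus>\<^bsub>B\<^esub>w\<in>Poly_Mapping.keys p.
      Poly_Mapping.lookup (flip n p) (map (flip_gen n) w) \<odot>\<^bsub>B\<^esub> wd' (map (flip_gen n) w))"
  proof (rule B.finsum_reindex)
    show "inj_on (map (flip_gen n)) (Poly_Mapping.keys p)" using inj by (rule inj_on_subset) simp
  qed (auto simp: lookup_flip wd keys B)
  also have "\<dots> = (\<Oplus>\<^bsub>B\<^esub>w\<in>Poly_Mapping.keys p. h (Poly_Mapping.lookup p w \<odot>\<^bsub>A\<^esub> wd w))"
    by (rule B.finsum_cong') (auto simp: lookup_flip wd keys h B)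
  also have "\<dots> = h (free_lift A g p)"
    unfolding free_lift_def wd_def[symmetric] by (rule sum[symmetric]) (auto simp: wd keys A)
  finally show ?thesis .
qed

section \<open>The isomorphism of Hopf algebras\<close>

lemma u_hopf_simps:
  "carrier (u_hopf D \<mu>) = carrier (u_alg D \<mu>)" "mult (u_hopf D \<mu>) = mult (u_alg D \<mu>)"
  "one (u_hopf D \<mu>) = one (u_alg D \<mu>)" "add (u_hopf D \<mu>) = add (u_alg D \<mu>)"
  "zero (u_hopf D \<mu>) = zero (u_alg D \<mu>)" "module.smult (u_hopf D \<mu>) = module.smult (u_alg D \<mu>)"
  "comult (u_hopf D \<mu>) = (\<lambda>A. \<Union>p\<in>A. free_lift (tensor_alg (u_alg D \<mu>) (u_alg D \<mu>)) (u_comult_gen D \<mu>) p)"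
  "counit (u_hopf D \<mu>) = (\<lambda>A. the_elem (free_lift ground_alg u_counit_gen ` A))"
  "antipode (u_hopf D \<mu>) = (\<lambda>A. \<Union>p\<in>A. free_lift (opposite_alg (u_alg D \<mu>)) (u_antipode_gen D \<mu>) p)"
  by (simp_all add: u_hopf_def Let_def module.defs hopf.defs)

lemma alg_hom_u_hopf: "alg_hom (u_hopf D \<mu>) (u_hopf D' \<mu>') = alg_hom (u_alg D \<mu>) (u_alg D' \<mu>')"
  by (simp add: alg_hom_def ring_hom_def u_hopf_simps)

lemma tensor_map_u_hopf:
  "tensor_map (u_hopf D \<mu>) (u_hopf D \<mu>) f g = tensor_map (u_alg D \<mu>) (u_alg D \<mu>) f g"
  by (simp add: tensor_map_def tensor_class_def bilinear_rels_def u_hopf_simps fun_eq_iff)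

lemma ground_abelian_monoid: "abelian_monoid (ground_alg :: ('k::field, 'k) module)"
  by (rule abelian_monoidI) (auto simp: ground_alg_def)

lemma counit_gen_flip: "u_counit_gen (flip_gen n l) = u_counit_gen l"
  by (auto simp: u_counit_gen_def flip_gen_def split: gen.splits)

lemma (in alg) opposite_abelian_monoid: "abelian_monoid (opposite_alg A)"
  by (rule abelian_monoidI) (auto simp: opposite_alg_def a_ac)

context reflected_data
begin

sublocale P: free_alg_quotient "gens D" "u_ideal D \<mu>"
  by (rule free_alg_quotient.intro) (rule u_ideal)

sublocale P': free_alg_quotient "gens D" "u_ideal D' \<mu>'"
  using reflected_data.u_ideal(1)[OF reflected_data_sym[OF reflected_data_axioms]]
  by (intro free_alg_quotient.intro) (simp add: gens')

abbreviation "U \<equiv> u_alg D \<mu>"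
abbreviation "U' \<equiv> u_alg D' \<mu>'"
abbreviation "H \<equiv> u_hopf D \<mu>"
abbreviation "H' \<equiv> u_hopf D' \<mu>'"

lemma U_eq: "U = P.Q" and U'_eq: "U' = P'.Q"
  by (simp_all add: u_alg_def gens')

lemma cls_eq: "u_class D \<mu> p = P.cls p" "u_class D' \<mu>' p = P'.cls p"
  by (simp_all add: u_class_def P.cls_def P'.cls_def gens')

text \<open>A coset is a set of elements of the free algebra, so the induced map of quotients is
  just taking images under \<open>flip n\<close>.\<close>

lemma flip_cls: "flip n ` P'.cls p = P.cls (flip n p)"
proof (intro equalityI subsetI)
  fix r assume "r \<in> flip n ` P'.cls p"
  then obtain s where "s - p \<in> u_ideal D' \<mu>'" "r = flip n s"
    by (auto simp: P'.mem_cls)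
  then have "flip n (s - p) \<in> u_ideal D \<mu>"
    using flip_ideal by blast
  then show "r \<in> P.cls (flip n p)"
    using \<open>r = _\<close> by (simp add: P.mem_cls)
next
  fix r assume "r \<in> P.cls (flip n p)"
  then have "r - flip n p \<in> flip n ` u_ideal D' \<mu>'"
    by (simp add: P.mem_cls flip_ideal)
  then obtain s where s: "s \<in> u_ideal D' \<mu>'" "r - flip n p = flip n s" by blast
  then have "r = flip n (s + p)" by (simp add: algebra_simps)
  moreover have "s + p \<in> P'.cls p" using s by (simp add: P'.mem_cls)
  ultimately show "r \<in> flip n ` P'.cls p" by blast
qed

lemma flip_alg_hom: "(`) (flip n) \<in> alg_hom U' U"
  unfolding alg_hom_def ring_hom_def U_eq U'_eq
  by (intro CollectI conjI ballI allI funcsetI; clarsimp simp: P'.Q_carrier P'.Q_mult P.Q_mult P'.Q_add P.Q_add P'.Q_smult P.Q_smult P'.Q_one P.Q_one flip_cls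
      free_alg_closed free_alg_closed_unary flip_closed)

lemma flip_bij: "bij_betw ((`) (flip n)) (carrier U') (carrier U)"
proof (rule bij_betwI')
  fix S T assume "S \<in> carrier U'" "T \<in> carrier U'"
  have "inj (flip n :: ('g gen list \<Rightarrow>\<^sub>0 'k) \<Rightarrow> _)" by (metis flip_flip injI)
  then show "(flip n ` S = flip n ` T) = (S = T)" by (rule inj_image_eq_iff)
next
  fix S assume "S \<in> carrier U'"
  then show "flip n ` S \<in> carrier U"
    by (auto simp: U_eq U'_eq P'.Q_carrier flip_cls flip_closed)
next
  fix T assume "T \<in> carrier U"
  then obtain p where p: "p \<in> carrier (free_alg (gens D))" "T = P.cls p"
    by (auto simp: U_eq P.Q_carrier)
  then have "T = flip n ` P'.cls (flip n p)" by (simp add: flip_cls)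
  then show "\<exists>S\<in>carrier U'. T = flip n ` S"
    using p by (auto simp: U'_eq flip_closed intro!: bexI[of _ "P'.cls (flip n p)"])
qed

sublocale Phi: alg_map U' U "(`) (flip n)"
  unfolding alg_map_def alg_map_axioms_def
  using P.Q_alg P'.Q_alg flip_alg_hom by (simp add: U_eq U'_eq)

lemma u_x_eq: "i \<in> {1..n} \<Longrightarrow> flip n ` u_x D' \<mu>' i = u_x D \<mu> (n + 1 - i)"
  and u_g_eq: "flip n ` u_g D' \<mu>' a = u_g D \<mu> a"
  by (simp_all only: u_x_def u_g_def cls_eq flip_cls flip_letter flip_gen_simps)

lemma u_x_closed: "i \<in> {1..n} \<Longrightarrow> u_x D' \<mu>' i \<in> carrier U'"
  and u_g_closed: "a \<in> carrier (dgrp D) \<Longrightarrow> u_g D' \<mu>' a \<in> carrier U'"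
proof -
  show "i \<in> {1..n} \<Longrightarrow> u_x D' \<mu>' i \<in> carrier U'"
    unfolding u_x_def cls_eq U'_eq by (intro P'.cls_closed letter_closed) (simp add: gens_def)
  show "a \<in> carrier (dgrp D) \<Longrightarrow> u_g D' \<mu>' a \<in> carrier U'"
    unfolding u_g_def cls_eq U'_eq by (intro P'.cls_closed letter_closed) (simp add: gens_def)
qed

lemma gens_cases:
  assumes "l \<in> gens D"
  obtains a where "l = Grp a" "a \<in> carrier (dgrp D)" | i where "l = X i" "i \<in> {1..n}"
  using assms by (auto simp: gens_def)

lemma dg'_closed: "i \<in> {1..n} \<Longrightarrow> dg D' i \<in> carrier (dgrp D)"
proof -
  assume i: "i \<in> {1..n}"
  then have "n + 1 - i \<in> {1..n}" by auto
  then show ?thesis using dg_closed i by (simp only: D'_gen)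
qed

lemma flip_comult_gen:
  assumes "l \<in> gens D"
  shows "u_comult_gen D' \<mu>' l \<in> carrier Phi.A.T"
    "u_comult_gen D \<mu> (flip_gen n l) = tensor_map U U ((`) (flip n)) ((`) (flip n)) (u_comult_gen D' \<mu>' l)"
proof -
  show "u_comult_gen D' \<mu>' l \<in> carrier Phi.A.T"
    using assms
    by (cases rule: gens_cases)
      (auto simp: u_comult_gen_def Let_def intro!: Phi.A.T_closed u_x_closed u_g_closed dg'_closed)
  show "u_comult_gen D \<mu> (flip_gen n l) = tensor_map U U ((`) (flip n)) ((`) (flip n)) (u_comult_gen D' \<mu>' l)"
    using assms
  proof (cases rule: gens_cases)
    case (1 a)
    then show ?thesis by (simp add: u_comult_gen_def Let_def Phi.tensor_map_hom u_g_eq)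
  next
    case (2 i)
    have "tensor_map U U ((`) (flip n)) ((`) (flip n)) (u_comult_gen D' \<mu>' l)
      = tensor_map U U ((`) (flip n)) ((`) (flip n)) (pure_tensor U' U' (u_g D' \<mu>' (dg D' i)) (u_x D' \<mu>' i))
        \<oplus>\<^bsub>Phi.B.T\<^esub> tensor_map U U ((`) (flip n)) ((`) (flip n)) (pure_tensor U' U' (u_x D' \<mu>' i) \<one>\<^bsub>U'\<^esub>)"
      using 2 by (simp only: u_comult_gen_def Let_def gen.case)
        (rule Phi.tensor_map_hom(2), auto intro!: Phi.A.T_closed u_x_closed u_g_closed dg'_closed)
    also have "\<dots> = u_comult_gen D \<mu> (flip_gen n l)"
      unfolding Phi.tensor_map_hom Phi.f_simps(5) u_g_eq u_x_eq[OF 2(2)] D'_gen[OF 2(2)] 2(1) flip_gen_simps(2)[OF 2(2)]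
      by (simp add: u_comult_gen_def Let_def)
    finally show ?thesis by simp
  qed
qed

lemma flip_antipode_gen:
  assumes "l \<in> gens D"
  shows "u_antipode_gen D' \<mu>' l \<in> carrier U'"
    "u_antipode_gen D \<mu> (flip_gen n l) = flip n ` u_antipode_gen D' \<mu>' l"
proof -
  interpret G: comm_group "dgrp D" using datum by (simp add: cartan_datum_def)
  have inv: "\<ominus>\<^bsub>U\<^esub> (flip n ` S) = flip n ` (\<ominus>\<^bsub>U'\<^esub> S)" if "S \<in> carrier U'" for S
    using that by (clarsimp simp: U_eq U'_eq P'.Q_carrier P'.Q_a_inv P.Q_a_inv flip_cls flip_closed)
  show "u_antipode_gen D' \<mu>' l \<in> carrier U'"
    using assms
    by (cases rule: gens_cases) (auto simp: u_antipode_gen_def Let_def intro!: Phi.A.a_inv_closed Phi.A.m_closed u_x_closed u_g_closed dg'_closed)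
  show "u_antipode_gen D \<mu> (flip_gen n l) = flip n ` u_antipode_gen D' \<mu>' l"
    using assms
  proof (cases rule: gens_cases)
    case (1 a)
    then show ?thesis by (simp add: u_antipode_gen_def Let_def u_g_eq)
  next
    case (2 i)
    have g: "u_g D' \<mu>' (inv\<^bsub>dgrp D\<^esub> dg D' i) \<in> carrier U'"
      using 2 by (intro u_g_closed G.inv_closed dg'_closed)
    have "flip n ` u_antipode_gen D' \<mu>' l
      = \<ominus>\<^bsub>U\<^esub> (flip n ` (u_g D' \<mu>' (inv\<^bsub>dgrp D\<^esub> dg D' i) \<otimes>\<^bsub>U'\<^esub> u_x D' \<mu>' i))"
      unfolding 2(1) u_antipode_gen_def Let_def gen.case D'_simps
      by (rule inv[symmetric]) (intro Phi.A.m_closed g u_x_closed 2)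
    also have "flip n ` (u_g D' \<mu>' (inv\<^bsub>dgrp D\<^esub> dg D' i) \<otimes>\<^bsub>U'\<^esub> u_x D' \<mu>' i)
      = u_g D \<mu> (inv\<^bsub>dgrp D\<^esub> dg D' i) \<otimes>\<^bsub>U\<^esub> u_x D \<mu> (n + 1 - i)"
      unfolding Phi.f_simps(3)[OF g u_x_closed[OF 2(2)]] u_g_eq u_x_eq[OF 2(2)] ..
    finally show ?thesis
      unfolding D'_gen[OF 2(2)] 2(1) flip_gen_simps(2)[OF 2(2)] by (simp add: u_antipode_gen_def Let_def)
  qed
qed

text \<open>The structure maps of a coset are assembled from values at all its representatives, and
  \<open>flip n\<close> maps the representatives of \<open>S\<close> bijectively to those of its
  image. Each compatibility is thus checked at one \<open>p\<close> by
  \<open>free_lift_flip\<close>, with \<open>h\<close> the induced tensor map, the identity and the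
  image map.\<close>

lemma flip_hopf_iso: "(`) (flip n) \<in> hopf_iso H' H"
  unfolding hopf_iso_def alg_hom_u_hopf tensor_map_u_hopf mem_Collect_eq
proof (intro conjI ballI)
  show "(`) (flip n) \<in> alg_hom U' U" by (rule flip_alg_hom)
  show "bij_betw ((`) (flip n)) (carrier H') (carrier H)"
    using flip_bij by (simp add: u_hopf_simps)
next
  fix S assume "S \<in> carrier H'"
  then obtain p0 where p0: "p0 \<in> carrier (free_alg (gens D))" "S = P'.cls p0"
    by (auto simp: u_hopf_simps U'_eq P'.Q_carrier)
  have S: "p \<in> carrier (free_alg (gens D))" if "p \<in> S" for p
    using that p0 P'.cls_carrier by blast
  let ?\<phi> = "(`) (flip n) :: ('g gen list \<Rightarrow>\<^sub>0 'k) set \<Rightarrow> _"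
  have "free_lift Phi.B.T (u_comult_gen D \<mu>) (flip n p) = tensor_map U U ?\<phi> ?\<phi> (free_lift Phi.A.T (u_comult_gen D' \<mu>') p)"
    if "p \<in> S" for p
    by (rule free_lift_flip[where L = "gens D"])
      (use S[OF that] in \<open>simp_all add: Phi.A.T_abelian_monoid Phi.B.T_abelian_monoid Phi.A.T_closed Phi.tensor_map_hom flip_comult_gen\<close>)
  then show "comult H (flip n ` S) = tensor_map U U ?\<phi> ?\<phi> (comult H' S)"
    by (simp add: u_hopf_simps Phi.tensor_map_eq)
  have "free_lift ground_alg u_counit_gen (flip n p) = (free_lift ground_alg u_counit_gen p :: 'k)" if "p \<in> S" for p
    by (rule free_lift_flip[where L = "gens D" and h = "\<lambda>c. c"])
      (use S[OF that] in \<open>auto simp: counit_gen_flip ground_abelian_monoid, auto simp: ground_alg_def\<close>)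
  then show "counit H (flip n ` S) = counit H' S"
    by (simp add: u_hopf_simps image_image cong: image_cong)
  have "free_lift (opposite_alg U) (u_antipode_gen D \<mu>) (flip n p) = flip n ` free_lift (opposite_alg U') (u_antipode_gen D' \<mu>') p"
    if "p \<in> S" for p
  proof (rule free_lift_flip[where L = "gens D"])
    show "flip n ` \<zero>\<^bsub>opposite_alg U'\<^esub> = \<zero>\<^bsub>opposite_alg U\<^esub>"
      by (simp add: opposite_alg_def U_eq U'_eq P.Q_zero P'.Q_zero flip_cls)
  qed (use S[OF that] in \<open>auto simp: opposite_alg_def Phi.f_simps flip_antipode_gen
      intro: Phi.A.opposite_abelian_monoid[unfolded opposite_alg_def] Phi.B.opposite_abelian_monoid[unfolded opposite_alg_def]\<close>)
  then show "antipode H (flip n ` S) = flip n ` antipode H' S"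
    by (simp add: u_hopf_simps image_UN)
qed

text \<open>Agreement passes from letters to words by multiplicativity and from words to all classes
  by linearity.\<close>

lemma alg_hom_unique:
  assumes "\<psi> \<in> alg_hom U' U"
    and x: "\<And>i. i \<in> {1..n} \<Longrightarrow> \<psi> (u_x D' \<mu>' i) = u_x D \<mu> (n + 1 - i)"
    and g: "\<And>a. a \<in> carrier (dgrp D) \<Longrightarrow> \<psi> (u_g D' \<mu>' a) = u_g D \<mu> a"
    and B: "B \<in> carrier U'"
  shows "\<psi> B = flip n ` B"
proof -
  note hom = assms(1)[unfolded alg_hom_def ring_hom_def U_eq U'_eq]
  have letter: "\<psi> (P'.cls (letter l)) = P.cls (flip n (letter l))" if "l \<in> gens D" for l
    using that
  proof (cases rule: gens_cases)
    case (1 a)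
    then show ?thesis using g[of a] by (simp add: u_g_def cls_eq)
  next
    case (2 i)
    then show ?thesis using x[of i] by (simp add: u_x_def cls_eq del: One_nat_def)
  qed
  have word: "\<psi> (P'.cls (Poly_Mapping.single w 1)) = P.cls (flip n (Poly_Mapping.single w 1))" if "set w \<subseteq> gens D" for w
    using that
  proof (induct w)
    case Nil
    then show ?case using hom by (simp add: single_Nil P.Q_one P'.Q_one)
  next
    case (Cons l w)
    have *: "Poly_Mapping.single (l # w) 1 = letter l * Poly_Mapping.single w (1 :: 'k)"
      by (simp add: letter_def mult_single)
    have c: "(letter l :: 'g gen list \<Rightarrow>\<^sub>0 'k) \<in> carrier (free_alg (gens D))" "Poly_Mapping.single w (1 :: 'k) \<in> carrier (free_alg (gens D))"
      using Cons by auto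
    have "\<psi> (P'.cls (letter l) \<otimes>\<^bsub>P'.Q\<^esub> P'.cls (Poly_Mapping.single w 1))
      = \<psi> (P'.cls (letter l)) \<otimes>\<^bsub>P.Q\<^esub> \<psi> (P'.cls (Poly_Mapping.single w 1))"
      using hom P'.cls_closed[OF c(1)] P'.cls_closed[OF c(2)] by blast
    then show ?case
      using Cons letter[of l] c flip_closed[OF c(1)] flip_closed[OF c(2)]
      unfolding * by (simp add: P'.Q_mult P.Q_mult)
  qed
  have add: "\<psi> (P'.cls (p + q)) = P.cls (flip n (p + q))"
    if "p \<in> carrier (free_alg (gens D))" "q \<in> carrier (free_alg (gens D))"
      "\<psi> (P'.cls p) = P.cls (flip n p)" "\<psi> (P'.cls q) = P.cls (flip n q)" for p q
    using hom that P'.cls_closed[OF that(1)] P'.cls_closed[OF that(2)]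
    by (simp add: P'.Q_add[symmetric] P.Q_add[symmetric])
  have scal: "\<psi> (P'.cls (scal c p)) = P.cls (flip n (scal c p))"
    if "p \<in> carrier (free_alg (gens D))" "\<psi> (P'.cls p) = P.cls (flip n p)" for c p
    using hom that P'.cls_closed[OF that(1)]
    by (simp add: P'.Q_smult[symmetric] P.Q_smult[symmetric])
  have sum: "\<psi> (P'.cls (\<Sum>w\<in>W. Poly_Mapping.single w (k w))) = P.cls (flip n (\<Sum>w\<in>W. Poly_Mapping.single w (k w)))"
    if "finite W" "\<And>w. w \<in> W \<Longrightarrow> set w \<subseteq> gens D" for W and k :: "'g gen list \<Rightarrow> 'k"
    using that
  proof (induct W rule: finite_induct)
    case empty
    \<comment> \<open>The empty sum is treated as 0 times the empty word.\<close>
    then show ?case using scal[of 1 0] word[of "[]"] by (simp add: single_Nil)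
  next
    case (insert w W)
    have "\<psi> (P'.cls (Poly_Mapping.single w (k w))) = P.cls (flip n (Poly_Mapping.single w (k w)))"
      using scal[of "Poly_Mapping.single w 1" "k w"] word[of w] insert by simp
    then show ?case
      unfolding sum.insert[OF insert(1,2)]
      by (intro add) (use insert in \<open>auto intro!: sum_closed\<close>)
  qed
  obtain p where p: "p \<in> carrier (free_alg (gens D))" "B = P'.cls p"
    using B by (auto simp: U'_eq P'.Q_carrier)
  then have "\<psi> (P'.cls p) = P.cls (flip n p)"
    using sum[of "Poly_Mapping.keys p" "Poly_Mapping.lookup p"] poly_mapping_eq_sum_single[of p]
    by (simp add: free_alg_carrier)
  then show ?thesis
    by (simp add: p flip_cls)
qed

end

theorem corollary4p4:
  fixes D :: "('g, 'k::{alg_closed_field, field_char_0}) datum"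
    and \<mu> :: "nat \<Rightarrow> nat \<Rightarrow> 'k"
  assumes "cartan_datum D" and "R2 D \<mu>"
  shows "\<exists>\<phi> \<in> hopf_iso (u_hopf (sigma_datum D) (sigma_par D \<mu>)) (u_hopf D \<mu>).
    sigma_on_gens D \<mu> \<phi> \<and>
    (\<forall>\<psi> \<in> alg_hom (u_hopf (sigma_datum D) (sigma_par D \<mu>)) (u_hopf D \<mu>).
       sigma_on_gens D \<mu> \<psi> \<longrightarrow>
       (\<forall>a \<in> carrier (u_hopf (sigma_datum D) (sigma_par D \<mu>)). \<psi> a = \<phi> a))"
proof -
  interpret reflected_data D \<mu> "sigma_datum D" "sigma_par D \<mu>"
    by (intro reflected_data.intro assms reflects_sigma)
  show ?thesis
  proof (intro bexI[OF _ flip_hopf_iso] conjI ballI impI)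
    show "sigma_on_gens D \<mu> ((`) (flip n))"
      using u_x_eq u_g_eq by (simp add: sigma_on_gens_def sigma_idx_def)
    fix \<psi> S
    assume "\<psi> \<in> alg_hom H' H" "sigma_on_gens D \<mu> \<psi>" "S \<in> carrier H'"
    then show "\<psi> S = flip n ` S"
      by (intro alg_hom_unique) (auto simp: alg_hom_u_hopf u_hopf_simps sigma_on_gens_def sigma_idx_def)
  qed
qed

end
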